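(* Let $n$ and $k$ be integers with $3 \leq k \leq n-1$. Then the maximum number of cycles of length $k$ in a nonhamiltonian graph of order $n$ is $$\frac{P(n-1,k)}{2k}.$$ Moreover, up to isomorphism, the complete list of extremal graphs (nonhamiltonian graphs of order $n$ attaining this maximum) is: $K_{n-1}\cdot K_2$ and $K_{n-1}\cup K_1$ when $(n,k)\neq(5,4)$; and $K_4\cdot K_2$, $K_4\cup K_1$, $K_{2,3}$, and $K_2\vee 3K_1$ when $(n,k)=(5,4)$.
   Context: All graphs are finite and simple. The order of a graph is its number of vertices. A graph is nonhamiltonian if it has no Hamilton cycle (a cycle through all its vertices). Cycles are counted as subgraphs. For integers $n,k$, $P(n,k)=\frac{n!}{(n-k)!}$ if $0\le k\le n$ and $n\ge 1$, and $P(n,k)=0$ if $1\le n<k$ or $k<0$. $K_n$ is the complete graph on $n$ vertices and $K_{m,n}$ is the complete bipartite graph with parts of sizes $m$ and $n$. $K_{n-1}\cdot K_2$ is the graph of order $n$ obtained by identifying a vertex of $K_{n-1}$ with a vertex of $K_2$. For vertex-disjoint graphs $G_1,G_2$, the union $G_1\cup G_2$ has vertex set $V(G_1)\cup V(G_2)$ and edge set $E(G_1)\cup E(G_2)$; $tG$ is the disjoint union of $t$ copies of $G$; the join $G_1\vee G_2$ is obtained from $G_1\cup G_2$ by joining every vertex of $G_1$ to every vertex of $G_2$ by an edge. *)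

theory Defs
  imports Complex_Main
begin

section \<open>Finite simple graphs\<close>

record 'a sgraph =
  verts :: "'a set"
  edges :: "'a set set"

definition simple_graph :: "'a sgraph \<Rightarrow> bool" where
  "simple_graph G \<longleftrightarrow> finite (verts G) \<and> (\<forall>e\<in>edges G. e \<subseteq> verts G \<and> card e = 2)"

definition order :: "'a sgraph \<Rightarrow> nat" where
  "order G = card (verts G)"

definition subgraph :: "'a sgraph \<Rightarrow> 'a sgraph \<Rightarrow> bool" where
  "subgraph H G \<longleftrightarrow> simple_graph H \<and> verts H \<subseteq> verts G \<and> edges H \<subseteq> edges G"

definition map_sgraph :: "('a \<Rightarrow> 'b) \<Rightarrow> 'a sgraph \<Rightarrow> 'b sgraph" where
  "map_sgraph f G = \<lparr>verts = f ` verts G, edges = (\<lambda>e. f ` e) ` edges G\<rparr>"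

definition graph_iso :: "'a sgraph \<Rightarrow> 'b sgraph \<Rightarrow> bool" (infix "\<simeq>" 50) where
  "G \<simeq> H \<longleftrightarrow> (\<exists>f. bij_betw f (verts G) (verts H) \<and>
     (\<forall>u\<in>verts G. \<forall>v\<in>verts G. {u, v} \<in> edges G \<longleftrightarrow> {f u, f v} \<in> edges H))"

section \<open>Cycles\<close>

definition cycle_graph :: "nat \<Rightarrow> nat sgraph" where
  "cycle_graph k = \<lparr>verts = {..<k}, edges = {{i, (i + 1) mod k} | i. i < k}\<rparr>"

definition is_cycle :: "nat \<Rightarrow> 'a sgraph \<Rightarrow> bool" where
  "is_cycle k C \<longleftrightarrow> 3 \<le> k \<and> simple_graph C \<and> cycle_graph k \<simeq> C"

definition num_cycles :: "nat \<Rightarrow> 'a sgraph \<Rightarrow> nat" where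
  "num_cycles k G = card {C. subgraph C G \<and> is_cycle k C}"

definition hamiltonian :: "'a sgraph \<Rightarrow> bool" where
  "hamiltonian G \<longleftrightarrow> (\<exists>C k. subgraph C G \<and> is_cycle k C \<and> verts C = verts G)"

definition nonhamiltonian_of_order :: "nat \<Rightarrow> 'a sgraph \<Rightarrow> bool" where
  "nonhamiltonian_of_order n G \<longleftrightarrow> simple_graph G \<and> order G = n \<and> \<not> hamiltonian G"

section \<open>Particular graphs and graph operations\<close>

definition complete_graph :: "nat \<Rightarrow> nat sgraph" where
  "complete_graph n = \<lparr>verts = {..<n}, edges = {e. e \<subseteq> {..<n} \<and> card e = 2}\<rparr>"

definition complete_bipartite :: "nat \<Rightarrow> nat \<Rightarrow> (nat + nat) sgraph" where
  "complete_bipartite m n =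
     \<lparr>verts = {..<m} <+> {..<n}, edges = {{Inl i, Inr j} | i j. i < m \<and> j < n}\<rparr>"

text \<open>
  The next two operations are meant for graphs with disjoint vertex sets; the versions for
  arbitrary graphs first make the vertex sets disjoint by tagging with \<open>Inl\<close> and \<open>Inr\<close>.
\<close>

definition union_graph :: "'a sgraph \<Rightarrow> 'a sgraph \<Rightarrow> 'a sgraph" where
  "union_graph G H = \<lparr>verts = verts G \<union> verts H, edges = edges G \<union> edges H\<rparr>"

definition join_graph :: "'a sgraph \<Rightarrow> 'a sgraph \<Rightarrow> 'a sgraph" where
  "join_graph G H = \<lparr>verts = verts G \<union> verts H,
     edges = edges G \<union> edges H \<union> {{u, v} | u v. u \<in> verts G \<and> v \<in> verts H}\<rparr>"

definition disjoint_union :: "'a sgraph \<Rightarrow> 'b sgraph \<Rightarrow> ('a + 'b) sgraph" where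
  "disjoint_union G H = union_graph (map_sgraph Inl G) (map_sgraph Inr H)"

definition disjoint_join :: "'a sgraph \<Rightarrow> 'b sgraph \<Rightarrow> ('a + 'b) sgraph" where
  "disjoint_join G H = join_graph (map_sgraph Inl G) (map_sgraph Inr H)"

definition copies :: "nat \<Rightarrow> 'a sgraph \<Rightarrow> (nat \<times> 'a) sgraph" where
  "copies t G = \<lparr>verts = (\<Union>i<t. verts (map_sgraph (Pair i) G)),
                 edges = (\<Union>i<t. edges (map_sgraph (Pair i) G))\<rparr>"

text \<open>Identification of the vertex \<open>u\<close> of \<open>G\<close> with the vertex \<open>v\<close> of \<open>H\<close>:
  the merged vertex is \<open>Inl u\<close>.\<close>

definition identify_vertices :: "'a \<Rightarrow> 'b \<Rightarrow> 'a sgraph \<Rightarrow> 'b sgraph \<Rightarrow> ('a + 'b) sgraph" where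
  "identify_vertices u v G H =
     union_graph (map_sgraph Inl G) (map_sgraph (\<lambda>x. if x = v then Inl u else Inr x) H)"

text \<open>\<open>K\<^sub>m \<cdot> K\<^sub>2\<close>; by symmetry the choice of the two vertices (here \<open>0\<close>) is immaterial,
  and \<open>m \<ge> 1\<close> is required for the construction to make sense.\<close>

definition complete_with_pendant :: "nat \<Rightarrow> (nat + nat) sgraph" where
  "complete_with_pendant m = identify_vertices 0 0 (complete_graph m) (complete_graph 2)"

section \<open>The number \<open>P(n,k)\<close>\<close>

text \<open>The values for \<open>n \<le> 0 \<le> k\<close> are a totalization and carry no meaning.\<close>

definition perm_number :: "int \<Rightarrow> int \<Rightarrow> real" where
  "perm_number n k =
     (if 0 \<le> k \<and> k \<le> n \<and> 1 \<le> n then fact (nat n) / fact (nat (n - k)) else 0)"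

end

theory Submission
  imports Defs
begin

text \<open>
A cycle of length \<open>k\<close> is represented by the \<open>2k\<close> lists of distinct vertices that run around it
(\<open>card_cycle_lists\<close>), and \<open>P(n - 1, k)\<close> counts all lists of \<open>k\<close> distinct vertices out of \<open>n - 1\<close>.
The claim is thus that a nonhamiltonian graph of order \<open>n\<close> has at most \<open>P(n - 1, k)\<close> such cycle
lists.

If some vertex has degree at most 1, no cycle passes through it. Then the bound is the trivial one
for the remaining \<open>n - 1\<close> vertices, with equality only if these form a complete graph; this gives
\<open>K\<^sub>n\<^sub>-\<^sub>1 \<cdot> K\<^sub>2\<close> and \<open>K\<^sub>n\<^sub>-\<^sub>1 \<union> K\<^sub>1\<close>. What remains is to show that the inequality is strict when
the minimum degree is at least 2 and \<open>(n, k) \<noteq> (5, 4)\<close>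
(\<open>card_cycle_lists_less_min_degree_2\<close>).

The main tool is an averaging argument. Arrange the vertices in a random cyclic order. Each of its
\<open>n\<close> windows of \<open>k\<close> consecutive vertices, closed up, is a uniformly distributed list of \<open>k\<close>
vertices, so it suffices that on average fewer than \<open>n - k\<close> windows are cycles of the graph. Let
\<open>b\<close> be the number of consecutive pairs in the order that are not edges. As the graph is
nonhamiltonian, \<open>b \<ge> 1\<close>. Each such pair destroys the \<open>k - 1\<close> windows containing it, and \<open>b\<close> pairs
destroy at least \<open>min n (k - 2 + b)\<close> windows, hence at least \<open>k - 2 + min b 3\<close>. So it is enough
that the mean of \<open>min b 3\<close> exceeds 2. For integers \<open>b \<ge> 1\<close> and \<open>0 \<le> z \<le> b\<close>,
\<open>6 min b 3 \<ge> 8 z - z (z - 1) - 2\<close>; with \<open>z\<close> the number of consecutive pairs in a chosen set \<open>F\<close> of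
nonedges, the mean of the right side only involves the first two moments of \<open>z\<close>. They are
determined by the number of edges of \<open>F\<close> and of paths of length 2 in \<open>F\<close>, and the outcome is that
about \<open>3n/2\<close> nonedges suffice (\<open>card_cycle_lists_less_many_nonedges\<close>).

Nonedges are supplied by the classical degree argument of Ore and Chvatal. Adding edges
only creates cycles, so the graph may be taken edge-maximal among the nonhamiltonian ones. Then
nonadjacent vertices have degree sum at most \<open>n - 1\<close>, and a nonadjacent pair of largest degree sum
yields a number \<open>h \<le> (n - 1)/2\<close> and \<open>h\<close> vertices of degree at most \<open>h\<close>. If \<open>h \<ge> 3\<close>, this leaves
at least \<open>h (2n - 1 - 3h)/2\<close> nonedges. This is enough for the averaging argument if \<open>n \<ge> 8\<close>. For
\<open>n = 7\<close> it means 6 nonedges, and a seventh one is available unless there are four pairwise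
nonadjacent vertices; in the latter case the mean is at least 2 and one order is better than
required (\<open>card_cycle_lists_less_order_7\<close>). If \<open>h = 2\<close>, the two vertices of degree 2 lie on so few
cycles that deleting them gives the bound directly, with a tie only for \<open>(n, k) = (5, 4)\<close>.

In that case, a 4-cycle in a nonhamiltonian graph of order 5 with minimum degree 2 forces the fifth
vertex to be adjacent to exactly two opposite vertices of the cycle, and the graph is \<open>K\<^sub>2\<^sub>,\<^sub>3\<close>
or \<open>K\<^sub>2 \<or> 3K\<^sub>1\<close> (\<open>order_5_with_4_cycle\<close>).
\<close>

section \<open>Cycles as cyclic lists of vertices\<close>

text \<open>
The falling factorial \<open>n (n - 1) \<dots> (n - k + 1)\<close>. Over the natural numbers it vanishes for \<open>k > n\<close>,
which matches the convention \<open>P(n, k) = 0\<close>.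
\<close>

fun falling_fact :: "nat \<Rightarrow> nat \<Rightarrow> nat" where
  "falling_fact n 0 = 1"
| "falling_fact n (Suc k) = n * falling_fact (n - 1) k"

lemma falling_fact_mult_fact: "k \<le> n \<Longrightarrow> falling_fact n k * fact (n - k) = fact n"
proof (induction n k rule: falling_fact.induct)
  case (2 n k)
  then obtain m where m: "n = Suc m" by (cases n) auto
  with 2 show ?case by (simp add: algebra_simps)
qed simp

lemma falling_fact_pos: "k \<le> n \<Longrightarrow> 0 < falling_fact n k"
  by (induction n k rule: falling_fact.induct) auto

lemma falling_fact_Suc_right: "falling_fact n (Suc k) = falling_fact n k * (n - k)"
  by (induction n k rule: falling_fact.induct) (auto simp: algebra_simps)

lemma falling_fact_eq_0: "n < k \<Longrightarrow> falling_fact n k = 0"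
proof (induction n k rule: falling_fact.induct)
  case (2 n k)
  then show ?case by (cases n) auto
qed simp

text \<open>
The lists of \<open>Suc k\<close> distinct elements out of \<open>Suc n\<close> either avoid a given element or contain it in
one of \<open>Suc k\<close> positions.
\<close>

lemma falling_fact_pascal: "falling_fact (Suc n) (Suc k) = falling_fact n (Suc k) + Suc k * falling_fact n k"
proof (cases "k \<le> n")
  case True
  then obtain d where "n = k + d" using le_Suc_ex by blast
  then show ?thesis unfolding falling_fact_Suc_right[of n k] by (simp add: algebra_simps)
next
  case False
  then show ?thesis by (simp add: falling_fact_eq_0)
qed

definition distinct_lists :: "nat \<Rightarrow> 'a set \<Rightarrow> 'a list set" where
  "distinct_lists k V = {ys. length ys = k \<and> distinct ys \<and> set ys \<subseteq> V}"

lemma distinct_lists_0 [simp]: "distinct_lists 0 V = {[]}"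
  by (auto simp: distinct_lists_def)

lemma distinct_lists_Suc: "distinct_lists (Suc k) V = (\<lambda>(x, ys). x # ys) ` (SIGMA x:V. distinct_lists k (V - {x}))"
proof -
  have "zs \<in> (\<lambda>(x, ys). x # ys) ` (SIGMA x:V. distinct_lists k (V - {x}))" if "zs \<in> distinct_lists (Suc k) V" for zs
    using that by (cases zs) (force simp: distinct_lists_def)+
  then show ?thesis by (auto simp: distinct_lists_def)
qed

lemma finite_distinct_lists [simp]: "finite V \<Longrightarrow> finite (distinct_lists k V)"
  by (induction k arbitrary: V) (auto simp: distinct_lists_Suc)

lemma card_distinct_lists: "finite V \<Longrightarrow> card (distinct_lists k V) = falling_fact (card V) k"
proof (induction k arbitrary: V)
  case (Suc k)
  have "inj_on (\<lambda>(x, ys). x # ys) (SIGMA x:V. distinct_lists k (V - {x}))"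
    by (auto simp: inj_on_def)
  then have "card (distinct_lists (Suc k) V) = card (SIGMA x:V. distinct_lists k (V - {x}))"
    by (simp add: distinct_lists_Suc card_image)
  also have "\<dots> = (\<Sum>x\<in>V. card (distinct_lists k (V - {x})))"
    using Suc.prems by (simp add: card_SigmaI)
  also have "\<dots> = (\<Sum>x\<in>V. falling_fact (card V - 1) k)"
    using Suc by (intro sum.cong) (auto simp: card_Diff_singleton)
  finally show ?case by simp
qed simp

definition cyclic_links :: "'a list \<Rightarrow> 'a set set" where
  "cyclic_links ys = {{ys ! i, ys ! ((i + 1) mod length ys)} | i. i < length ys}"

definition cycle_lists :: "nat \<Rightarrow> 'a set \<Rightarrow> 'a set set \<Rightarrow> 'a list set" where
  "cycle_lists k V E = {ys \<in> distinct_lists k V. cyclic_links ys \<subseteq> E}"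

lemma cyclic_links_rotate [simp]: "cyclic_links (rotate m ys) = cyclic_links ys"
proof -
  have *: "cyclic_links (rotate m ys) \<subseteq> cyclic_links ys" for m and ys :: "'a list"
  proof
    fix e assume "e \<in> cyclic_links (rotate m ys)"
    then obtain i where i: "i < length ys"
      "e = {rotate m ys ! i, rotate m ys ! ((i + 1) mod length ys)}"
      by (auto simp: cyclic_links_def)
    have "length ys > 0" using i by auto
    then have "(i + 1) mod length ys < length ys" by simp
    then have "e = {ys ! ((m + i) mod length ys), ys ! ((m + (i + 1) mod length ys) mod length ys)}"
      using i by (simp add: nth_rotate)
    also have "(m + (i + 1) mod length ys) mod length ys = ((m + i) mod length ys + 1) mod length ys"
      by (simp add: mod_simps)
    finally show "e \<in> cyclic_links ys"
      using \<open>length ys > 0\<close> unfolding cyclic_links_def by (auto intro!: exI[of _ "(m + i) mod length ys"])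
  qed
  have "\<exists>l. rotate l (rotate m ys) = ys"
  proof (cases "ys = []")
    case False
    have "rotate (length ys - m mod length ys) (rotate m ys)
        = rotate ((length ys - m mod length ys + m) mod length ys) ys"
      using rotate_conv_mod by (metis rotate_rotate)
    also have "(length ys - m mod length ys + m) mod length ys = 0"
    proof -
      have "m mod length ys \<le> length ys" using False by (simp add: less_imp_le)
      then have "length ys - m mod length ys + m = length ys * (1 + m div length ys)"
        using mult_div_mod_eq[of "length ys" m] by (simp only: distrib_left mult_1_right)
      then show ?thesis by (simp only: mod_mult_self1_is_0)
    qed
    finally show ?thesis by auto
  qed simp
  then obtain l where "rotate l (rotate m ys) = ys" by blast
  then show ?thesis using *[of m ys] *[of l "rotate m ys"] by auto
qed

lemma cyclic_links_rev [simp]: "cyclic_links (rev ys) = cyclic_links ys"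
proof -
  have *: "cyclic_links (rev ys) \<subseteq> cyclic_links ys" for ys :: "'a list"
  proof
    fix e assume "e \<in> cyclic_links (rev ys)"
    then obtain i where i: "i < length ys"
      "e = {rev ys ! i, rev ys ! ((i + 1) mod length ys)}"
      by (auto simp: cyclic_links_def)
    define j where "j = (if i + 1 < length ys then length ys - 1 - (i + 1) else length ys - 1)"
    have jl: "j < length ys" using i(1) by (auto simp: j_def)
    have "rev ys ! ((i + 1) mod length ys) = ys ! j"
    proof (cases "i + 1 < length ys")
      case False
      then have "i + 1 = length ys" using i(1) by simp
      then have "(i + 1) mod length ys = 0" "j = length ys - 1" using False by (simp_all add: j_def)
      moreover have "rev ys ! 0 = ys ! (length ys - 1)" using i(1) rev_nth[of 0 ys] by fastforce
      ultimately show ?thesis by simp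
    next
      case True
      then show ?thesis by (simp add: j_def rev_nth)
    qed
    moreover have "rev ys ! i = ys ! ((j + 1) mod length ys)"
    proof (cases "i + 1 < length ys")
      case True
      then have "j + 1 = length ys - 1 - i" by (auto simp: j_def)
      then have "(j + 1) mod length ys = length ys - 1 - i" using True by simp
      then show ?thesis using i(1) by (simp add: rev_nth)
    next
      case False
      then have "i = length ys - 1" "j + 1 = length ys" using i(1) by (auto simp: j_def)
      then show ?thesis using i(1) by (simp add: rev_nth)
    qed
    ultimately have "e = {ys ! j, ys ! ((j + 1) mod length ys)}" using i(2) by auto
    then show "e \<in> cyclic_links ys" using jl unfolding cyclic_links_def by blast
  qed
  from *[of ys] *[of "rev ys"] show ?thesis by auto
qed

text \<open>
This is why walking along a cycle leaves no choice once the direction is fixed. The restriction to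
inner positions avoids wrap-around and is all that an induction along the list needs.
\<close>

lemma cyclic_links_inner_neighbours:
  assumes "distinct ys" "0 < i" "i + 1 < length ys" "{ys ! i, w} \<in> cyclic_links ys"
  shows "w = ys ! (i + 1) \<or> w = ys ! (i - 1)"
proof -
  from assms(4) obtain j where j: "j < length ys" "{ys ! i, w} = {ys ! j, ys ! ((j + 1) mod length ys)}"
    by (auto simp: cyclic_links_def)
  have jm: "(j + 1) mod length ys < length ys" using j(1) by (cases "length ys") auto
  from j(2) consider "ys ! i = ys ! j" "w = ys ! ((j + 1) mod length ys)"
    | "ys ! i = ys ! ((j + 1) mod length ys)" "w = ys ! j"
    by (auto simp: doubleton_eq_iff)
  then show ?thesis
  proof cases
    case 1
    then have "i = j" using assms j by (simp add: nth_eq_iff_index_eq)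
    with 1 assms show ?thesis by simp
  next
    case 2
    then have "i = (j + 1) mod length ys" using assms jm by (simp add: nth_eq_iff_index_eq)
    then have "i = j + 1" using assms(2) j(1) by (cases "j + 1 = length ys") auto
    with 2 show ?thesis by simp
  qed
qed

lemma mem_cyclic_links: "i < length ys \<Longrightarrow> {ys ! i, ys ! ((i + 1) mod length ys)} \<in> cyclic_links ys"
  unfolding cyclic_links_def by blast

lemma mem_cyclic_links_Suc: "Suc i < length ys \<Longrightarrow> {ys ! i, ys ! Suc i} \<in> cyclic_links ys"
  using mem_cyclic_links[of i ys] by simp

lemma cyclic_links_determined_by_first_arc:
  assumes "distinct ys" "distinct zs" "length zs = length ys" "cyclic_links zs = cyclic_links ys"
    and "ys ! 0 = zs ! 0" "ys ! 1 = zs ! 1"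
  shows "ys = zs"
proof (rule nth_equalityI)
  fix i assume "i < length ys"
  then show "ys ! i = zs ! i"
  proof (induction i rule: less_induct)
    case (less i)
    show ?case
    proof (cases "i < 2")
      case True
      then have "i = 0 \<or> i = 1" by auto
      with assms show ?thesis by auto
    next
      case False
      then obtain j where j: "i = Suc (Suc j)" by (metis add_2_eq_Suc le_Suc_ex not_less)
      have IH: "ys ! j = zs ! j" "ys ! Suc j = zs ! Suc j" using less j by auto
      have "{zs ! Suc j, zs ! i} \<in> cyclic_links zs" using less.prems j assms(3) mem_cyclic_links_Suc[of "Suc j" zs] by simp
      then have "{ys ! Suc j, zs ! i} \<in> cyclic_links ys" using assms(4) IH by simp
      then have "zs ! i = ys ! i \<or> zs ! i = ys ! j"
        using cyclic_links_inner_neighbours[of ys "Suc j" "zs ! i"] assms(1) less.prems j by simp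
      moreover have "zs ! i \<noteq> zs ! j" using assms(2,3) less.prems j by (simp add: nth_eq_iff_index_eq)
      ultimately show ?thesis using IH by simp
    qed
  qed
qed (use assms in auto)

lemma card_arcs:
  assumes "finite F" "\<And>e. e \<in> F \<Longrightarrow> card e = 2"
  shows "card {(x, y). {x, y} \<in> F} = 2 * card F" "finite {(x, y). {x, y} \<in> F}"
proof -
  have eq: "{(x, y). {x, y} \<in> F} = (\<Union>e\<in>F. {(x, y). {x, y} = e})" by auto
  have c: "card {(x, y). {x, y} = e} = 2 \<and> finite {(x, y). {x, y} = e}" if "e \<in> F" for e
  proof -
    from assms(2)[OF that] obtain a b where ab: "e = {a, b}" "a \<noteq> b" by (auto simp: card_2_iff)
    then have "{(x, y). {x, y} = e} = {(a, b), (b, a)}" by (auto simp: doubleton_eq_iff)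
    with ab show ?thesis by simp
  qed
  show "finite {(x, y). {x, y} \<in> F}" unfolding eq using c assms(1) by blast
  have "card {(x, y). {x, y} \<in> F} = (\<Sum>e\<in>F. card {(x, y). {x, y} = e})"
    unfolding eq using c assms(1) by (intro card_UN_disjoint) auto
  also have "\<dots> = (\<Sum>e\<in>F. 2)" using c by (intro sum.cong) auto
  finally show "card {(x, y). {x, y} \<in> F} = 2 * card F" by simp
qed

lemma cyclic_links_card_2:
  assumes "distinct ys" "2 \<le> length ys" "e \<in> cyclic_links ys"
  shows "card e = 2"
proof -
  obtain i where i: "i < length ys" "e = {ys ! i, ys ! ((i + 1) mod length ys)}"
    using assms(3) by (auto simp: cyclic_links_def)
  have "(i + 1) mod length ys \<noteq> i" using i(1) assms(2) by (cases "i + 1 = length ys") auto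
  moreover have "(i + 1) mod length ys < length ys" using assms(2) by (intro mod_less_divisor) auto
  ultimately have "ys ! i \<noteq> ys ! ((i + 1) mod length ys)" using assms(1) i(1)
    by (simp add: nth_eq_iff_index_eq)
  with i show ?thesis by simp
qed

lemma cyclic_links_eq_image:
  "cyclic_links ys = (\<lambda>i. {ys ! i, ys ! ((i + 1) mod length ys)}) ` {..<length ys}"
  by (auto simp: cyclic_links_def)

lemma finite_cyclic_links [simp]: "finite (cyclic_links ys)"
  by (simp add: cyclic_links_eq_image)

lemma cyclic_links_subset_set: "e \<in> cyclic_links ys \<Longrightarrow> e \<subseteq> set ys"
  by (cases "length ys") (auto simp: cyclic_links_def)

lemma card_cyclic_links:
  assumes "distinct ys" "3 \<le> length ys"
  shows "card (cyclic_links ys) = length ys"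
proof -
  let ?k = "length ys"
  have "inj_on (\<lambda>i. {ys ! i, ys ! ((i + 1) mod ?k)}) {..<?k}"
  proof (rule inj_onI)
    fix i j assume ij: "i \<in> {..<?k}" "j \<in> {..<?k}"
      and eq: "{ys ! i, ys ! ((i + 1) mod ?k)} = {ys ! j, ys ! ((j + 1) mod ?k)}"
    have m: "(i + 1) mod ?k < ?k" "(j + 1) mod ?k < ?k" using assms(2) by (auto intro!: mod_less_divisor)
    show "i = j"
    proof (rule ccontr)
      assume "i \<noteq> j"
      then have "ys ! i = ys ! ((j + 1) mod ?k)" "ys ! j = ys ! ((i + 1) mod ?k)"
        using eq ij assms(1) by (auto simp: doubleton_eq_iff nth_eq_iff_index_eq)
      then have "i = (j + 1) mod ?k" "j = (i + 1) mod ?k"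
        using ij m assms(1) by (auto simp: nth_eq_iff_index_eq)
      moreover have "(l + 1) mod ?k = (if l + 1 = ?k then 0 else l + 1)" if "l \<in> {..<?k}" for l
        using that by simp
      ultimately show False using ij assms(2) by (simp split: if_splits)
    qed
  qed
  then show ?thesis by (simp add: cyclic_links_eq_image card_image)
qed

text \<open>
A cyclic list is determined by its first arc. Each of the \<open>k\<close> edges of the cycle can be traversed
in two directions, and rotations and reversals of the list realise all \<open>2k\<close> arcs.
\<close>

lemma card_same_cyclic_links:
  assumes "distinct ys" "length ys = k" "3 \<le> k"
  shows "card {zs. length zs = k \<and> distinct zs \<and> set zs = set ys \<and> cyclic_links zs = cyclic_links ys} = 2 * k"
    (is "card ?Z = _")
proof -
  let ?A = "{(x, y). {x, y} \<in> cyclic_links ys}"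
  have "bij_betw (\<lambda>zs. (zs ! 0, zs ! 1)) ?Z ?A"
  proof (rule bij_betw_imageI)
    show "inj_on (\<lambda>zs. (zs ! 0, zs ! 1)) ?Z"
      by (rule inj_onI) (auto intro: cyclic_links_determined_by_first_arc)
    show "(\<lambda>zs. (zs ! 0, zs ! 1)) ` ?Z = ?A"
    proof (intro equalityI subsetI)
      fix p assume "p \<in> (\<lambda>zs. (zs ! 0, zs ! 1)) ` ?Z"
      then obtain zs where zs: "zs \<in> ?Z" "p = (zs ! 0, zs ! 1)" by auto
      then show "p \<in> ?A" using mem_cyclic_links_Suc[of 0 zs] assms(3) by simp
    next
      fix p assume "p \<in> ?A"
      then obtain x y where p: "p = (x, y)" "{x, y} \<in> cyclic_links ys" by auto
      then obtain i where i: "i < k" "{x, y} = {ys ! i, ys ! ((i + 1) mod k)}"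
        using assms(2) by (auto simp: cyclic_links_def)
      define zs where "zs = rotate i ys"
      have k0: "0 < k" "1 < k" using assms(3) by auto
      have z: "zs \<in> ?Z" using assms by (simp add: zs_def)
      have z01: "zs ! 0 = ys ! i" "zs ! 1 = ys ! ((i + 1) mod k)"
        using i k0 assms(2) nth_rotate[of 0 ys i] nth_rotate[of 1 ys i] by (simp_all add: zs_def)
      show "p \<in> (\<lambda>zs. (zs ! 0, zs ! 1)) ` ?Z"
      proof (cases "x = zs ! 0 \<and> y = zs ! 1")
        case True
        then show ?thesis using z p by auto
      next
        case False
        then have xy: "x = zs ! 1" "y = zs ! 0" using i(2) z01 by (auto simp: doubleton_eq_iff)
        obtain r where r: "zs = y # x # r"
        proof -
          have "length zs \<ge> 2" using z k0 by auto
          then obtain a b r where "zs = a # b # r" by (metis Suc_le_length_iff numeral_2_eq_2)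
          with xy that show ?thesis by auto
        qed
        \<comment> \<open>the reversed list, rotated so that the arc comes first\<close>
        have e: "x # y # rev r = rotate (length r) (rev zs)"
          using rotate_append[of "rev r" "[x, y]"] by (simp add: r)
        have "x # y # rev r \<in> ?Z" using z unfolding e by simp
        moreover have "p = ((x # y # rev r) ! 0, (x # y # rev r) ! 1)" using p by simp
        ultimately show ?thesis by (rule rev_image_eqI)
      qed
    qed
  qed
  then have "card ?Z = card ?A" by (rule bij_betw_same_card)
  also have "\<dots> = 2 * card (cyclic_links ys)"
    using assms by (intro card_arcs) (auto intro: cyclic_links_card_2)
  finally show ?thesis using card_cyclic_links[of ys] assms by simp
qed

definition list_graph :: "'a list \<Rightarrow> 'a sgraph" where
  "list_graph ys = \<lparr>verts = set ys, edges = cyclic_links ys\<rparr>"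

lemma finite_cycle_lists [simp]: "finite V \<Longrightarrow> finite (cycle_lists k V E)"
  by (simp add: cycle_lists_def)

lemma edges_cycle_graph: "{i, j} \<in> edges (cycle_graph k) \<longleftrightarrow>
    (i < k \<and> j = (i + 1) mod k) \<or> (j < k \<and> i = (j + 1) mod k)"
  by (auto simp: cycle_graph_def doubleton_eq_iff)

lemma simple_list_graph:
  assumes "distinct ys" "2 \<le> length ys"
  shows "simple_graph (list_graph ys)"
  using assms cyclic_links_card_2 cyclic_links_subset_set by (fastforce simp: simple_graph_def list_graph_def)

lemma is_cycle_list_graph:
  assumes "distinct ys" "3 \<le> length ys"
  shows "is_cycle (length ys) (list_graph ys)"
proof -
  let ?k = "length ys"
  have "bij_betw ((!) ys) {..<?k} (set ys)" using bij_betw_nth[OF assms(1)] by simp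
  moreover have "{u, v} \<in> edges (cycle_graph ?k) \<longleftrightarrow> {ys ! u, ys ! v} \<in> cyclic_links ys"
    if "u < ?k" "v < ?k" for u v
  proof -
    have m: "(i + 1) mod ?k < ?k" for i using that by (cases "?k") auto
    have "{ys ! u, ys ! v} \<in> cyclic_links ys \<longleftrightarrow>
        (\<exists>i<?k. {ys ! u, ys ! v} = {ys ! i, ys ! ((i + 1) mod ?k)})"
      by (auto simp: cyclic_links_def)
    also have "\<dots> \<longleftrightarrow> (v = (u + 1) mod ?k) \<or> (u = (v + 1) mod ?k)"
      using that assms(1) m by (auto simp: doubleton_eq_iff nth_eq_iff_index_eq)
    finally show ?thesis using that by (auto simp: edges_cycle_graph)
  qed
  ultimately have "cycle_graph ?k \<simeq> list_graph ys"
    unfolding graph_iso_def by (auto simp: cycle_graph_def list_graph_def intro!: exI[of _ "(!) ys"])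
  then show ?thesis using assms simple_list_graph[of ys] by (simp add: is_cycle_def)
qed

lemma is_cycleE:
  assumes "is_cycle k C"
  obtains ys where "distinct ys" "length ys = k" "C = list_graph ys"
proof -
  from assms obtain f where f: "bij_betw f {..<k} (verts C)"
    and adj: "\<And>u v. u < k \<Longrightarrow> v < k \<Longrightarrow> {u, v} \<in> edges (cycle_graph k) \<longleftrightarrow> {f u, f v} \<in> edges C"
    and k: "3 \<le> k" and s: "simple_graph C"
    unfolding is_cycle_def graph_iso_def by (auto simp: cycle_graph_def)
  define ys where "ys = map f [0..<k]"
  have len: "length ys = k" by (simp add: ys_def)
  have d: "distinct ys" using f by (simp add: ys_def distinct_map bij_betw_def atLeast0LessThan)
  have sy: "set ys = verts C" using f by (simp add: ys_def bij_betw_def atLeast0LessThan)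
  have nth: "ys ! i = f i" if "i < k" for i using that by (simp add: ys_def)
  have m: "(i + 1) mod k < k" for i using k by simp
  have "cyclic_links ys = edges C"
  proof (intro equalityI subsetI)
    fix e assume "e \<in> cyclic_links ys"
    then obtain i where i: "i < k" "e = {f i, f ((i + 1) mod k)}"
      using m nth by (auto simp: cyclic_links_def len)
    then show "e \<in> edges C" using adj[of i "(i + 1) mod k"] m by (auto simp: edges_cycle_graph)
  next
    fix e assume e: "e \<in> edges C"
    with s have "e \<subseteq> verts C" "card e = 2" by (auto simp: simple_graph_def)
    then obtain x y where xy: "e = {x, y}" "x \<in> verts C" "y \<in> verts C" by (auto simp: card_2_iff)
    then obtain i j where ij: "i < k" "j < k" "x = f i" "y = f j"
      using f by (metis bij_betw_imp_surj_on imageE lessThan_iff)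
    then have "{i, j} \<in> edges (cycle_graph k)" using adj e xy by auto
    then consider "j = (i + 1) mod k" | "i = (j + 1) mod k" by (auto simp: edges_cycle_graph)
    then show "e \<in> cyclic_links ys"
    proof cases
      case 1
      then show ?thesis using mem_cyclic_links[of i ys] ij xy len nth m by simp
    next
      case 2
      then have "e = {f j, f ((j + 1) mod k)}" using ij xy by auto
      then show ?thesis using mem_cyclic_links[of j ys] ij len nth m by simp
    qed
  qed
  then have "C = list_graph ys" by (simp add: list_graph_def sy)
  with d len that show ?thesis by blast
qed

lemma list_graph_eq_iff: "list_graph zs = list_graph ys \<longleftrightarrow> set zs = set ys \<and> cyclic_links zs = cyclic_links ys"
  by (simp add: list_graph_def)

lemma cycles_eq_list_graphs:
  assumes "3 \<le> k"
  shows "{C. subgraph C G \<and> is_cycle k C} = list_graph ` cycle_lists k (verts G) (edges G)"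
proof (intro equalityI subsetI)
  fix C assume "C \<in> {C. subgraph C G \<and> is_cycle k C}"
  then obtain ys where ys: "distinct ys" "length ys = k" "C = list_graph ys" and sub: "subgraph C G"
    by (auto elim: is_cycleE)
  then have "ys \<in> cycle_lists k (verts G) (edges G)"
    by (auto simp: cycle_lists_def distinct_lists_def subgraph_def list_graph_def)
  with ys show "C \<in> list_graph ` cycle_lists k (verts G) (edges G)" by blast
next
  fix C assume "C \<in> list_graph ` cycle_lists k (verts G) (edges G)"
  then obtain ys where ys: "ys \<in> cycle_lists k (verts G) (edges G)" "C = list_graph ys" by blast
  then have d: "distinct ys" "length ys = k" by (auto simp: cycle_lists_def distinct_lists_def)
  then show "C \<in> {C. subgraph C G \<and> is_cycle k C}"
    using ys assms is_cycle_list_graph[of ys] simple_list_graph[of ys]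
    by (auto simp: cycle_lists_def distinct_lists_def subgraph_def list_graph_def)
qed

theorem card_cycle_lists:
  assumes "3 \<le> k" "finite (verts G)"
  shows "card (cycle_lists k (verts G) (edges G)) = 2 * k * num_cycles k G"
proof -
  let ?L = "cycle_lists k (verts G) (edges G)"
  have fin: "finite ?L" using assms by simp
  have fib: "card {zs \<in> ?L. list_graph zs = C} = 2 * k" if "C \<in> list_graph ` ?L" for C
  proof -
    from that obtain ys where ys: "ys \<in> ?L" "C = list_graph ys" by blast
    then have "{zs \<in> ?L. list_graph zs = C} =
        {zs. length zs = k \<and> distinct zs \<and> set zs = set ys \<and> cyclic_links zs = cyclic_links ys}"
      by (auto simp: list_graph_eq_iff cycle_lists_def distinct_lists_def)
    then show ?thesis using card_same_cyclic_links[of ys k] ys assms(1) by (auto simp: cycle_lists_def distinct_lists_def)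
  qed
  have "card ?L = card (\<Union>C\<in>list_graph ` ?L. {zs \<in> ?L. list_graph zs = C})"
    by (rule arg_cong[where f = card]) auto
  also have "\<dots> = (\<Sum>C\<in>list_graph ` ?L. card {zs \<in> ?L. list_graph zs = C})"
    using fin by (intro card_UN_disjoint) auto
  also have "\<dots> = (\<Sum>C\<in>list_graph ` ?L. 2 * k)" using fib by (intro sum.cong) auto
  also have "\<dots> = 2 * k * num_cycles k G"
    unfolding num_cycles_def cycles_eq_list_graphs[OF assms(1)] by simp
  finally show ?thesis .
qed

theorem hamiltonian_iff_cycle_lists:
  assumes "simple_graph G" "3 \<le> order G"
  shows "hamiltonian G \<longleftrightarrow> cycle_lists (order G) (verts G) (edges G) \<noteq> {}"
proof
  assume "hamiltonian G"
  then obtain C k where C: "subgraph C G" "is_cycle k C" "verts C = verts G"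
    by (auto simp: hamiltonian_def)
  from C(2) obtain ys where ys: "distinct ys" "length ys = k" "C = list_graph ys" by (rule is_cycleE)
  then have "order G = k" using C(3) distinct_card[of ys] by (simp add: order_def list_graph_def)
  with C ys have "ys \<in> cycle_lists (order G) (verts G) (edges G)"
    by (auto simp: cycle_lists_def distinct_lists_def list_graph_def subgraph_def)
  then show "cycle_lists (order G) (verts G) (edges G) \<noteq> {}" by blast
next
  assume "cycle_lists (order G) (verts G) (edges G) \<noteq> {}"
  then obtain ys where ys: "ys \<in> cycle_lists (order G) (verts G) (edges G)" by blast
  then have "list_graph ys \<in> {C. subgraph C G \<and> is_cycle (order G) C}"
    unfolding cycles_eq_list_graphs[OF assms(2)] by blast
  moreover have "set ys = verts G"
    using ys assms(1) by (intro card_subset_eq)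
      (auto simp: cycle_lists_def distinct_lists_def order_def simple_graph_def distinct_card)
  ultimately show "hamiltonian G" unfolding hamiltonian_def by (auto simp: list_graph_def)
qed

section \<open>Deleting a vertex of small degree\<close>

definition neighbours :: "'a set \<Rightarrow> 'a set set \<Rightarrow> 'a \<Rightarrow> 'a set" where
  "neighbours V E a = {w \<in> V - {a}. {a, w} \<in> E}"

lemma finite_neighbours [simp]: "finite V \<Longrightarrow> finite (neighbours V E a)"
  by (simp add: neighbours_def)

text \<open>
The edge set may contain edges that leave the vertex set; deleting a vertex therefore only changes
the vertex set.
\<close>

lemma cycle_lists_avoiding: "{ys \<in> cycle_lists k V E. a \<notin> set ys} = cycle_lists k (V - {a}) E"
  by (auto simp: cycle_lists_def distinct_lists_def)

text \<open>
A cyclic list that starts at \<open>a\<close> has two different neighbours of \<open>a\<close> as its second and its last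
entry, and the entries in between are arbitrary.
\<close>

lemma cycle_lists_starting_at:
  assumes "3 \<le> k"
  shows "{ys \<in> cycle_lists k V E. ys ! 0 = a} \<subseteq>
    (\<lambda>(x, y, zs). a # x # zs @ [y]) `
      (SIGMA x:neighbours V E a. SIGMA y:neighbours V E a - {x}. distinct_lists (k - 3) (V - {a, x, y}))"
proof
  fix ys assume "ys \<in> {ys \<in> cycle_lists k V E. ys ! 0 = a}"
  then have ys: "length ys = k" "distinct ys" "set ys \<subseteq> V" "cyclic_links ys \<subseteq> E" "ys ! 0 = a"
    by (auto simp: cycle_lists_def distinct_lists_def)
  obtain x rs where r1: "ys = a # x # rs" "rs \<noteq> []"
  proof -
    from assms ys(1) have "Suc (Suc (Suc 0)) \<le> length ys" by simp
    then obtain b c d ts where "ys = b # c # d # ts" by (metis Suc_le_length_iff)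
    with ys(5) that show ?thesis by auto
  qed
  then obtain zs y where r: "ys = a # x # zs @ [y]" by (metis append_butlast_last_id)
  have "{a, x} \<in> E" using mem_cyclic_links_Suc[of 0 ys] ys(4) by (auto simp: r)
  moreover have "{a, y} \<in> E"
  proof -
    have "ys ! (k - 1) = y" "(k - 1 + 1) mod k = 0" using ys(1) by (auto simp: r nth_append)
    then have "{y, a} \<in> cyclic_links ys" using mem_cyclic_links[of "k - 1" ys] assms ys(1,5) by auto
    then show ?thesis using ys(4) by (auto simp: insert_commute)
  qed
  ultimately have "(x, y, zs) \<in> (SIGMA x:neighbours V E a. SIGMA y:neighbours V E a - {x}. distinct_lists (k - 3) (V - {a, x, y}))"
    using ys by (auto simp: r neighbours_def distinct_lists_def)
  then show "ys \<in> (\<lambda>(x, y, zs). a # x # zs @ [y]) `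
      (SIGMA x:neighbours V E a. SIGMA y:neighbours V E a - {x}. distinct_lists (k - 3) (V - {a, x, y}))"
    by (rule rev_image_eqI) (simp add: r)
qed

lemma card_cycle_lists_starting_at:
  assumes "3 \<le> k" "finite V" "a \<in> V"
  shows "card {ys \<in> cycle_lists k V E. ys ! 0 = a}
    \<le> card (neighbours V E a) * (card (neighbours V E a) - 1) * falling_fact (card V - 3) (k - 3)"
proof -
  let ?N = "neighbours V E a"
  let ?S = "SIGMA x:?N. SIGMA y:?N - {x}. distinct_lists (k - 3) (V - {a, x, y})"
  have "finite ?S" using assms by auto
  then have "card {ys \<in> cycle_lists k V E. ys ! 0 = a} \<le> card ?S"
    using cycle_lists_starting_at[OF assms(1), of V E a] by (rule surj_card_le)
  also have "card ?S = (\<Sum>x\<in>?N. \<Sum>y\<in>?N - {x}. card (distinct_lists (k - 3) (V - {a, x, y})))"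
    using assms by (simp add: card_SigmaI)
  also have "\<dots> = (\<Sum>x\<in>?N. \<Sum>y\<in>?N - {x}. falling_fact (card V - 3) (k - 3))"
  proof (intro sum.cong refl)
    fix x y assume "x \<in> ?N" "y \<in> ?N - {x}"
    then have "card (V - {a, x, y}) = card V - card {a, x, y}" "card {a, x, y} = 3"
      using assms by (auto simp: neighbours_def intro!: card_Diff_subset)
    then show "card (distinct_lists (k - 3) (V - {a, x, y})) = falling_fact (card V - 3) (k - 3)"
      using assms by (simp add: card_distinct_lists)
  qed
  also have "\<dots> = card ?N * (card ?N - 1) * falling_fact (card V - 3) (k - 3)"
    using assms by (simp add: card_Diff_singleton algebra_simps)
  finally show ?thesis .
qed

text \<open>
Rotating a list through \<open>a\<close> so that it starts at \<open>a\<close> costs a factor \<open>k\<close>.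
\<close>

lemma card_cycle_lists_through:
  assumes "3 \<le> k" "finite V" "a \<in> V"
  shows "card {ys \<in> cycle_lists k V E. a \<in> set ys}
    \<le> k * (card (neighbours V E a) * (card (neighbours V E a) - 1) * falling_fact (card V - 3) (k - 3))"
proof -
  let ?M = "{ys \<in> cycle_lists k V E. ys ! 0 = a}"
  have fin: "finite ?M" using assms by simp
  have "{ys \<in> cycle_lists k V E. a \<in> set ys} \<subseteq> (\<lambda>(i, zs). rotate i zs) ` ({1..k} \<times> ?M)"
  proof
    fix ys assume "ys \<in> {ys \<in> cycle_lists k V E. a \<in> set ys}"
    then have ys: "ys \<in> cycle_lists k V E" "length ys = k" "a \<in> set ys" by (auto simp: cycle_lists_def distinct_lists_def)
    then obtain i where i: "i < k" "ys ! i = a" by (metis in_set_conv_nth)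
    have "rotate i ys \<in> ?M"
      using ys i nth_rotate[of 0 ys i] by (auto simp: cycle_lists_def distinct_lists_def)
    moreover have "rotate (k - i) (rotate i ys) = ys"
      using i ys(2) by (simp add: rotate_rotate)
    moreover have "k - i \<in> {1..k}" using i by auto
    ultimately show "ys \<in> (\<lambda>(i, zs). rotate i zs) ` ({1..k} \<times> ?M)" by (force intro: rev_image_eqI)
  qed
  then have "card {ys \<in> cycle_lists k V E. a \<in> set ys} \<le> card ({1..k} \<times> ?M)"
    using fin by (meson card_image_le card_mono finite_SigmaI finite_atLeastAtMost finite_imageI le_trans)
  also have "\<dots> = k * card ?M" by (simp add: card_cartesian_product)
  finally show ?thesis using card_cycle_lists_starting_at[OF assms, of E] by (meson le_trans mult_le_mono2)
qed

lemma card_cycle_lists_delete: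
  assumes "3 \<le> k" "finite V" "a \<in> V" "card (neighbours V E a) \<le> d"
  shows "card (cycle_lists k V E)
    \<le> card (cycle_lists k (V - {a}) E) + k * (d * (d - 1) * falling_fact (card V - 3) (k - 3))"
proof -
  have "cycle_lists k V E = cycle_lists k (V - {a}) E \<union> {ys \<in> cycle_lists k V E. a \<in> set ys}"
    using cycle_lists_avoiding[of k V E a] by auto
  then have "card (cycle_lists k V E)
      \<le> card (cycle_lists k (V - {a}) E) + card {ys \<in> cycle_lists k V E. a \<in> set ys}"
    by (metis card_Un_le)
  moreover have "card (neighbours V E a) * (card (neighbours V E a) - 1) \<le> d * (d - 1)"
    by (rule mult_le_mono) (use assms(4) in auto)
  then have "k * (card (neighbours V E a) * (card (neighbours V E a) - 1) * falling_fact (card V - 3) (k - 3))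
     \<le> k * (d * (d - 1) * falling_fact (card V - 3) (k - 3))"
    by (rule mult_le_mono2[OF mult_le_mono1])
  ultimately show ?thesis using card_cycle_lists_through[OF assms(1-3), of E] by linarith
qed

lemma cycle_lists_degree_le_1:
  assumes "3 \<le> k" "finite V" "a \<in> V" "card (neighbours V E a) \<le> 1"
  shows "cycle_lists k V E = cycle_lists k (V - {a}) E"
proof -
  have "card (neighbours V E a) * (card (neighbours V E a) - 1) = 0" using assms(4) by simp
  then have "card {ys \<in> cycle_lists k V E. a \<in> set ys} = 0"
    using card_cycle_lists_through[OF assms(1-3), of E] by (simp only: mult_0 mult_0_right le_zero_eq)
  then have "{ys \<in> cycle_lists k V E. a \<in> set ys} = {}" using assms(2) by simp
  then show ?thesis using cycle_lists_avoiding[of k V E a] by blast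
qed

lemma card_cycle_lists_le: "finite V \<Longrightarrow> card (cycle_lists k V E) \<le> falling_fact (card V) k"
  by (metis (no_types, lifting) card_distinct_lists card_mono cycle_lists_def finite_distinct_lists mem_Collect_eq subsetI)

lemma cycle_lists_complete:
  assumes "2 \<le> k" "\<And>x y. x \<in> V \<Longrightarrow> y \<in> V \<Longrightarrow> x \<noteq> y \<Longrightarrow> {x, y} \<in> E"
  shows "cycle_lists k V E = distinct_lists k V"
proof -
  have "cyclic_links ys \<subseteq> E" if "ys \<in> distinct_lists k V" for ys
  proof
    fix e assume e: "e \<in> cyclic_links ys"
    then have "card e = 2" "e \<subseteq> V"
      using that assms(1) cyclic_links_card_2[of ys e] cyclic_links_subset_set[OF e] by (auto simp: distinct_lists_def)
    then show "e \<in> E" using assms(2) by (auto simp: card_2_iff)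
  qed
  then show ?thesis by (auto simp: cycle_lists_def)
qed

text \<open>
A missing edge excludes every list that starts with its two ends. This is the source of the
uniqueness of the extremal graphs.
\<close>

lemma complete_if_card_cycle_lists_eq:
  assumes "finite V" "2 \<le> k" "k \<le> card V" "card (cycle_lists k V E) = falling_fact (card V) k"
    and "x \<in> V" "y \<in> V" "x \<noteq> y"
  shows "{x, y} \<in> E"
proof -
  have "cycle_lists k V E \<subseteq> distinct_lists k V" by (auto simp: cycle_lists_def)
  then have eq: "cycle_lists k V E = distinct_lists k V"
    using assms by (intro card_subset_eq) (auto simp: card_distinct_lists)
  have "card (V - {x, y}) = card V - 2" using assms by (subst card_Diff_subset) auto
  then have "card (distinct_lists (k - 2) (V - {x, y})) > 0"
    using assms by (simp add: card_distinct_lists falling_fact_pos)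
  then have "distinct_lists (k - 2) (V - {x, y}) \<noteq> {}" by force
  then obtain zs where zs: "zs \<in> distinct_lists (k - 2) (V - {x, y})" by blast
  then have "x # y # zs \<in> distinct_lists k V" using assms by (auto simp: distinct_lists_def)
  then have "cyclic_links (x # y # zs) \<subseteq> E" using eq by (auto simp: cycle_lists_def)
  then show ?thesis using mem_cyclic_links_Suc[of 0 "x # y # zs"] by auto
qed

text \<open>
Let \<open>Q = P(n - 4, k - 3)\<close> and \<open>P = P(n - 3, k - 3)\<close>. Deleting \<open>a\<close> and \<open>b\<close> removes at most
\<open>2k P + 2k Q\<close> lists, while \<open>P(n - 1, k) - P(n - 2, k) = k (n - 2) (n - 3) Q\<close>. Since
\<open>P \<le> (n - 3) Q\<close>, the former is smaller for \<open>n \<ge> 6\<close>, and for \<open>n = 5\<close> equality holds only if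
\<open>k = 4\<close>.
\<close>

lemma card_cycle_lists_two_degree_2:
  assumes "3 \<le> k" "k < card V" "5 \<le> card V" "finite V" "a \<in> V" "b \<in> V" "a \<noteq> b"
    and "card (neighbours V E a) \<le> 2" "card (neighbours V E b) \<le> 2"
  shows "card (cycle_lists k V E) \<le> falling_fact (card V - 1) k"
    and "(card V, k) \<noteq> (5, 4) \<Longrightarrow> card (cycle_lists k V E) < falling_fact (card V - 1) k"
proof -
  define n where "n = card V"
  obtain m where m: "n = Suc (Suc (Suc m))"
    using assms(1,2) by (metis Suc_le_D Suc_less_eq less_imp_Suc_add n_def numeral_3_eq_3 le_less_trans less_or_eq_imp_le)
  obtain j where j: "k = Suc (Suc (Suc j))" using assms(1) by (metis Suc_le_D numeral_3_eq_3 Suc_le_mono)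
  have jm: "j < m" using assms(2) by (simp add: n_def[symmetric] m j)
  then obtain m' where m': "m = Suc m'" by (cases m) auto
  have V1: "card (V - {a}) = n - 1" using assms by (simp add: n_def)
  have V2: "card (V - {a} - {b}) = n - 2" using assms by (simp add: n_def card_Diff_singleton)
  have "neighbours (V - {a}) E b \<subseteq> neighbours V E b" by (auto simp: neighbours_def)
  then have b: "card (neighbours (V - {a}) E b) \<le> 2"
    using assms by (meson card_mono finite_neighbours le_trans)
  have "card (cycle_lists k V E) \<le> card (cycle_lists k (V - {a}) E) + k * (2 * (2 - 1) * falling_fact (n - 3) (k - 3))"
    using card_cycle_lists_delete[OF assms(1,4,5,8)] by (simp add: n_def)
  also have "card (cycle_lists k (V - {a}) E)
      \<le> card (cycle_lists k (V - {a} - {b}) E) + k * (2 * (2 - 1) * falling_fact (n - 1 - 3) (k - 3))"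
    using card_cycle_lists_delete[OF assms(1) _ _ b] assms V1 by simp
  also have "card (cycle_lists k (V - {a} - {b}) E) \<le> falling_fact (n - 2) k"
    using card_cycle_lists_le[of "V - {a} - {b}" k E] V2 assms by simp
  finally have le: "card (cycle_lists k V E) \<le> falling_fact (n - 2) k + k * (2 * falling_fact (n - 4) (k - 3) + 2 * falling_fact (n - 3) (k - 3))"
    by (simp add: algebra_simps)
  have p: "falling_fact (n - 1) k = falling_fact (n - 2) k + k * ((n - 2) * (n - 3) * falling_fact (n - 4) (k - 3))"
  proof -
    have "n - 1 = Suc (Suc m)" "n - 2 = Suc m" "n - 3 = m" "n - 4 = m - 1" "k - 3 = j" by (simp_all add: m j)
    moreover have "falling_fact (Suc m) (Suc (Suc j)) = Suc m * m * falling_fact (m - 1) j" by (simp add: algebra_simps)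
    ultimately show ?thesis using falling_fact_pascal[of "Suc m" "Suc (Suc j)"] by (simp only: j)
  qed
  have q: "falling_fact (n - 3) (k - 3) * (n - k) = (n - 3) * falling_fact (n - 4) (k - 3)"
    using falling_fact_Suc_right[of m j] by (simp add: m j m')
  define P where "P = falling_fact (n - 3) (k - 3)"
  define Q where "Q = falling_fact (n - 4) (k - 3)"
  have Q0: "0 < Q" using jm by (auto simp: Q_def m m' j intro!: falling_fact_pos)
  have nk: "1 \<le> n - k" using assms(2) by (simp add: n_def)
  have qq: "P * (n - k) = m * Q" using q by (simp add: P_def Q_def m)
  have PQ: "P \<le> m * Q" using nk qq by (metis mult.right_neutral mult_le_mono2)
  have main: "2 * Q + 2 * P \<le> Suc m * m * Q \<and> ((n, k) \<noteq> (5, 4) \<longrightarrow> 2 * Q + 2 * P < Suc m * m * Q)"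
  proof (cases "3 \<le> m")
    case True
    have "2 * Q + 2 * P \<le> 2 * Suc m * Q" using PQ by (simp add: algebra_simps)
    also have "\<dots> < Suc m * m * Q"
    proof (rule mult_strict_right_mono)
      have "2 * Suc m < m * Suc m" using True by (intro mult_strict_right_mono) auto
      then show "2 * Suc m < Suc m * m" by (simp only: mult.commute)
    qed (use Q0 in simp)
    finally show ?thesis by simp
  next
    case False
    then have 2: "m = 2" using assms(3) m by (simp add: n_def[symmetric])
    then have "j = 0 \<or> j = 1" using jm by auto
    with 2 show ?thesis by (auto simp: P_def Q_def m j eval_nat_numeral)
  qed
  have mn: "Suc m * m * Q = (n - 2) * (n - 3) * Q" by (simp add: m)
  have k0: "0 < k" using assms(1) by simp
  show "card (cycle_lists k V E) \<le> falling_fact (card V - 1) k"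
  proof -
    have "k * (2 * Q + 2 * P) \<le> k * ((n - 2) * (n - 3) * Q)"
      using main unfolding mn by (intro mult_le_mono2) simp
    then show ?thesis using le p unfolding P_def[symmetric] Q_def[symmetric] n_def[symmetric] by linarith
  qed
  show "card (cycle_lists k V E) < falling_fact (card V - 1) k" if "(card V, k) \<noteq> (5, 4)"
  proof -
    have "k * (2 * Q + 2 * P) < k * ((n - 2) * (n - 3) * Q)"
      using main that k0 unfolding mn n_def[symmetric] by simp
    then show ?thesis using le p unfolding P_def[symmetric] Q_def[symmetric] n_def[symmetric] by linarith
  qed
qed

section \<open>Orders of the vertex set and prescribed links\<close>

lemma rotate_distinct_lists_iff [simp]: "rotate i ys \<in> distinct_lists k V \<longleftrightarrow> ys \<in> distinct_lists k V"
  by (simp add: distinct_lists_def)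

lemma inj_rotate: "inj (rotate i)"
  unfolding rotate_def by (intro inj_fn inj_rotate1)

lemma bij_betw_distinct_listsI:
  assumes "finite V" "inj_on \<phi> (distinct_lists n V)" "\<And>s. s \<in> distinct_lists n V \<Longrightarrow> \<phi> s \<in> distinct_lists n V"
  shows "bij_betw \<phi> (distinct_lists n V) (distinct_lists n V)"
  using assms by (intro bij_betw_imageI endo_inj_surj) auto

lemma bij_betw_rotate: "finite V \<Longrightarrow> bij_betw (rotate i) (distinct_lists n V) (distinct_lists n V)"
  by (intro bij_betw_distinct_listsI) (auto intro: inj_on_subset[OF inj_rotate])

text \<open>
Rotating all entries but the first two brings an arbitrary later link next to the first one. This
reduces statements on two links at any distance to statements on an initial segment of a list.
\<close>

definition twist :: "nat \<Rightarrow> 'a list \<Rightarrow> 'a list" where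
  "twist m s = take 2 s @ rotate m (drop 2 s)"

lemma bij_betw_twist:
  assumes "finite V"
  shows "bij_betw (twist m) (distinct_lists n V) (distinct_lists n V)"
proof (rule bij_betw_distinct_listsI[OF assms])
  show "inj_on (twist m) (distinct_lists n V)"
  proof (rule inj_onI)
    fix s s' assume s: "s \<in> distinct_lists n V" "s' \<in> distinct_lists n V" and eq: "twist m s = twist m s'"
    have len: "length (take 2 s) = length (take 2 s')" using s by (simp add: distinct_lists_def)
    with eq have "take 2 s = take 2 s'" "rotate m (drop 2 s) = rotate m (drop 2 s')"
      by (simp_all add: twist_def)
    moreover from this have "drop 2 s = drop 2 s'" using injD[OF inj_rotate] by blast
    ultimately show "s = s'" by (metis append_take_drop_id)
  qed
  fix s assume "s \<in> distinct_lists n V"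
  then have s: "length s = n" "distinct s" "set s \<subseteq> V" by (auto simp: distinct_lists_def)
  have "distinct (take 2 s @ drop 2 s)" "set (take 2 s @ drop 2 s) = set s"
    using s(2) by (simp_all only: append_take_drop_id)
  then have "distinct (twist m s)" "set (twist m s) = set s"
    by (simp_all only: twist_def distinct_append set_append set_rotate distinct_rotate)
  then show "twist m s \<in> distinct_lists n V" using s by (simp add: distinct_lists_def twist_def)
qed

lemma take_4_twist:
  assumes "2 \<le> m" "m + 1 < length s"
  shows "take 4 (twist (m - 2) s) = [s ! 0, s ! 1, s ! m, s ! (m + 1)]"
proof (rule nth_equalityI)
  fix i assume "i < length (take 4 (twist (m - 2) s))"
  then have "i < 4" by simp
  then consider "i = 0" | "i = 1" | "i = 2" | "i = 3" by linarith
  moreover have "Suc (Suc (m - 2)) = m" using assms(1) by simp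
  ultimately show "take 4 (twist (m - 2) s) ! i = [s ! 0, s ! 1, s ! m, s ! (m + 1)] ! i"
    by cases (use assms in \<open>auto simp: twist_def nth_append nth_rotate\<close>)
qed (use assms in \<open>simp add: twist_def\<close>)

lemma falling_fact_self: "falling_fact n n = fact n"
  using falling_fact_mult_fact[of n n] by simp

lemma card_distinct_lists_take:
  assumes "finite V" "card V = n" "Q \<subseteq> distinct_lists k V" "k \<le> n"
  shows "card {s \<in> distinct_lists n V. take k s \<in> Q} = card Q * fact (n - k)"
proof -
  let ?S = "SIGMA ys:Q. distinct_lists (n - k) (V - set ys)"
  have finQ: "finite Q" using assms finite_subset finite_distinct_lists by metis
  have "bij_betw (\<lambda>(ys, zs). ys @ zs) ?S {s \<in> distinct_lists n V. take k s \<in> Q}"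
  proof (rule bij_betw_imageI)
    show "inj_on (\<lambda>(ys, zs). ys @ zs) ?S"
      using assms(3) by (auto simp: inj_on_def distinct_lists_def)
    show "(\<lambda>(ys, zs). ys @ zs) ` ?S = {s \<in> distinct_lists n V. take k s \<in> Q}"
    proof (intro equalityI subsetI)
      fix s assume "s \<in> (\<lambda>(ys, zs). ys @ zs) ` ?S"
      then obtain ys zs where "ys \<in> Q" "zs \<in> distinct_lists (n - k) (V - set ys)" "s = ys @ zs" by auto
      then show "s \<in> {s \<in> distinct_lists n V. take k s \<in> Q}"
        using assms(3,4) by (auto simp: distinct_lists_def)
    next
      fix s assume s: "s \<in> {s \<in> distinct_lists n V. take k s \<in> Q}"
      have "distinct (take k s @ drop k s)" "set (take k s @ drop k s) = set s"
        using s by (simp_all add: distinct_lists_def)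
      then have "drop k s \<in> distinct_lists (n - k) (V - set (take k s))"
        using s by (auto simp: distinct_lists_def distinct_append disjoint_iff simp del: append_take_drop_id dest: in_set_dropD)
      then have "(take k s, drop k s) \<in> ?S" using s by auto
      then show "s \<in> (\<lambda>(ys, zs). ys @ zs) ` ?S" by (rule rev_image_eqI) simp
    qed
  qed
  then have "card {s \<in> distinct_lists n V. take k s \<in> Q} = card ?S" by (simp add: bij_betw_same_card)
  also have "\<dots> = (\<Sum>ys\<in>Q. card (distinct_lists (n - k) (V - set ys)))"
    using finQ assms(1) by (simp add: card_SigmaI)
  also have "\<dots> = (\<Sum>ys\<in>Q. fact (n - k))"
  proof (rule sum.cong)
    fix ys assume "ys \<in> Q"
    then have "set ys \<subseteq> V" "card (set ys) = k" using assms(3) by (auto simp: distinct_lists_def distinct_card)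
    then have "card (V - set ys) = n - k" using assms by (simp add: card_Diff_subset)
    then show "card (distinct_lists (n - k) (V - set ys)) = fact (n - k)"
      using assms(1) by (simp add: card_distinct_lists falling_fact_self)
  qed simp
  finally show ?thesis by simp
qed

text \<open>
The uniform distribution of a segment of a random order: \<open>\<phi>\<close> moves the segment of interest to the
front, and its possible values \<open>Q\<close> extend to an order in \<open>fact (n - k)\<close> ways each.
\<close>

lemma card_distinct_lists_take_bij:
  assumes "finite V" "card V = n" "Q \<subseteq> distinct_lists k V" "k \<le> n" "bij_betw \<phi> (distinct_lists n V) (distinct_lists n V)"
  shows "card {s \<in> distinct_lists n V. take k (\<phi> s) \<in> Q} = card Q * fact (n - k)"
proof -
  have "bij_betw \<phi> {s \<in> distinct_lists n V. take k (\<phi> s) \<in> Q} {s \<in> distinct_lists n V. take k s \<in> Q}"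
    using assms(5) unfolding bij_betw_def by (auto simp: inj_on_def)
  then show ?thesis using card_distinct_lists_take[OF assms(1-4)] by (simp add: bij_betw_same_card)
qed

lemma take_2_nth: "2 \<le> length s \<Longrightarrow> take 2 s = [s ! 0, s ! 1]"
  by (cases s; cases "tl s") (auto simp: numeral_2_eq_2)

lemma take_3_nth: "3 \<le> length s \<Longrightarrow> take 3 s = [s ! 0, s ! 1, s ! 2]"
  by (rule nth_equalityI) (auto simp: less_Suc_eq eval_nat_numeral)

text \<open>
The random variable of the averaging argument is the number of these positions: \<open>i\<close> stands for the
cyclically consecutive entries \<open>i\<close> and \<open>i + 1\<close>.
\<close>

definition link_positions :: "'a set set \<Rightarrow> 'a list \<Rightarrow> nat set" where
  "link_positions F s = {i. i < length s \<and> {s ! i, s ! ((i + 1) mod length s)} \<in> F}"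

lemma finite_link_positions [simp]: "finite (link_positions F s)"
  by (simp add: link_positions_def)

definition arcs :: "'a set set \<Rightarrow> ('a \<times> 'a) set" where
  "arcs F = {(x, y). {x, y} \<in> F}"

text \<open>
Cherries and disjoint pairs are ordered versions of the two ways in which two different edges can
lie relative to each other. They are lists because they occur as segments of orders.
\<close>

definition cherries :: "'a set set \<Rightarrow> 'a list set" where
  "cherries F = {[x, y, z] | x y z. {x, y} \<in> F \<and> {y, z} \<in> F \<and> x \<noteq> z}"

definition disjoint_pairs :: "'a set set \<Rightarrow> 'a list set" where
  "disjoint_pairs F = {[x, y, z, w] | x y z w. {x, y} \<in> F \<and> {z, w} \<in> F \<and> distinct [x, y, z, w]}"

text \<open>
\<open>F\<close> will be a set of nonedges of the graph under study.
\<close>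

locale edge_set =
  fixes V :: "'a set" and F :: "'a set set"
  assumes finV: "finite V" and F2: "\<And>e. e \<in> F \<Longrightarrow> e \<subseteq> V \<and> card e = 2"
begin

lemma finF: "finite F"
  using F2 finV by (meson Pow_iff finite_Pow_iff finite_subset subsetI)

lemma card_arcs_F: "card (arcs F) = 2 * card F" "finite (arcs F)"
  using card_arcs[OF finF] F2 unfolding arcs_def by auto

lemma arc_facts: "{x, y} \<in> F \<Longrightarrow> x \<noteq> y \<and> x \<in> V \<and> y \<in> V"
  using F2 by fastforce

lemma cherries_subset: "cherries F \<subseteq> distinct_lists 3 V"
  using arc_facts by (auto simp: cherries_def distinct_lists_def)

lemma disjoint_pairs_subset: "disjoint_pairs F \<subseteq> distinct_lists 4 V"
  using arc_facts by (auto simp: disjoint_pairs_def distinct_lists_def)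

text \<open>
Pairs of arcs of \<open>F\<close> are classified by their common vertices. A cherry arises from four pairs of
arcs, depending on how its two edges are directed, and every arc forms two further pairs, with
itself and with its reverse.
\<close>

lemma card_disjoint_pairs:
  "card (disjoint_pairs F) + 4 * card (cherries F) + 2 * card (arcs F) \<le> card (arcs F) * card (arcs F)"
proof -
  let ?D = "arcs F" and ?C = "cherries F" and ?P = "disjoint_pairs F"
  \<comment> \<open>seven injections into the pairs of arcs with disjoint ranges\<close>
  define f0 where "f0 s = ((s ! 0, s ! 1), (s ! 2, s ! 3))" for s :: "'a list"
  define f1 where "f1 s = ((s ! 0, s ! 1), (s ! 1, s ! 2))" for s :: "'a list"
  define f2 where "f2 s = ((s ! 0, s ! 1), (s ! 2, s ! 1))" for s :: "'a list"
  define f3 where "f3 s = ((s ! 1, s ! 0), (s ! 1, s ! 2))" for s :: "'a list"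
  define f4 where "f4 s = ((s ! 1, s ! 0), (s ! 2, s ! 1))" for s :: "'a list"
  define f5 where "f5 p = ((fst p, snd p), (fst p, snd p))" for p :: "'a \<times> 'a"
  define f6 where "f6 p = ((fst p, snd p), (snd p, fst p))" for p :: "'a \<times> 'a"
  note fs = f0_def f1_def f2_def f3_def f4_def f5_def f6_def
  have fin: "finite ?C" "finite ?P" "finite ?D"
    using cherries_subset disjoint_pairs_subset finV card_arcs_F finite_subset finite_distinct_lists by metis+
  have inj: "inj_on f0 ?P" "inj_on f1 ?C" "inj_on f2 ?C" "inj_on f3 ?C" "inj_on f4 ?C" "inj_on f5 ?D" "inj_on f6 ?D"
    by (auto simp: inj_on_def fs cherries_def disjoint_pairs_def numeral_3_eq_3 numeral_2_eq_2)
  have sub: "f0 ` ?P \<subseteq> ?D \<times> ?D" "f1 ` ?C \<subseteq> ?D \<times> ?D" "f2 ` ?C \<subseteq> ?D \<times> ?D" "f3 ` ?C \<subseteq> ?D \<times> ?D"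
    "f4 ` ?C \<subseteq> ?D \<times> ?D" "f5 ` ?D \<subseteq> ?D \<times> ?D" "f6 ` ?D \<subseteq> ?D \<times> ?D"
    by (auto simp: fs cherries_def disjoint_pairs_def arcs_def insert_commute numeral_3_eq_3 numeral_2_eq_2)
  have ne: "x \<noteq> y" if "{x, y} \<in> F" for x y using arc_facts that by blast
  have d0: "f0 ` ?P \<inter> (f1 ` ?C \<union> f2 ` ?C \<union> f3 ` ?C \<union> f4 ` ?C \<union> f5 ` ?D \<union> f6 ` ?D) = {}"
    by (auto simp: fs cherries_def disjoint_pairs_def arcs_def numeral_3_eq_3 numeral_2_eq_2)
  have d1: "f1 ` ?C \<inter> (f2 ` ?C \<union> f3 ` ?C \<union> f4 ` ?C \<union> f5 ` ?D \<union> f6 ` ?D) = {}"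
    by (auto simp: fs cherries_def arcs_def numeral_2_eq_2 dest: ne)
  have d2: "f2 ` ?C \<inter> (f3 ` ?C \<union> f4 ` ?C \<union> f5 ` ?D \<union> f6 ` ?D) = {}"
    by (auto simp: fs cherries_def arcs_def numeral_2_eq_2 dest: ne)
  have d3: "f3 ` ?C \<inter> (f4 ` ?C \<union> f5 ` ?D \<union> f6 ` ?D) = {}"
    by (auto simp: fs cherries_def arcs_def numeral_2_eq_2 dest: ne)
  have d4: "f4 ` ?C \<inter> (f5 ` ?D \<union> f6 ` ?D) = {}"
    by (auto simp: fs cherries_def arcs_def numeral_2_eq_2 dest: ne)
  have d5: "f5 ` ?D \<inter> f6 ` ?D = {}"
    by (auto simp: fs arcs_def dest: ne)
  have "card ?P + (card ?C + (card ?C + (card ?C + (card ?C + (card ?D + card ?D)))))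
     = card (f0 ` ?P \<union> (f1 ` ?C \<union> (f2 ` ?C \<union> (f3 ` ?C \<union> (f4 ` ?C \<union> (f5 ` ?D \<union> f6 ` ?D))))))"
    using fin inj d0 d1 d2 d3 d4 d5 by (simp add: card_Un_disjoint card_image Un_assoc)
  also have "\<dots> \<le> card (?D \<times> ?D)" using sub fin by (intro card_mono) auto
  finally show ?thesis by (simp add: card_cartesian_product)
qed

lemma card_cherries: "card (cherries F) = (\<Sum>y\<in>V. card {x. {x, y} \<in> F} * (card {x. {x, y} \<in> F} - 1))"
proof -
  let ?N = "\<lambda>y. {x. {x, y} \<in> F}"
  have fN: "finite (?N y)" for y using arc_facts finV by (auto intro: finite_subset[of _ V])
  let ?S = "SIGMA y:V. SIGMA x:?N y. ?N y - {x}"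
  have "bij_betw (\<lambda>(y, x, z). [x, y, z]) ?S (cherries F)"
    using arc_facts by (intro bij_betw_imageI) (auto simp: inj_on_def cherries_def insert_commute image_iff)
  then have "card (cherries F) = card ?S" by (simp add: bij_betw_same_card)
  also have "\<dots> = (\<Sum>y\<in>V. \<Sum>x\<in>?N y. card (?N y - {x}))"
    using finV fN by (simp add: card_SigmaI)
  also have "\<dots> = (\<Sum>y\<in>V. card (?N y) * (card (?N y) - 1))"
    by (intro sum.cong refl) simp
  finally show ?thesis .
qed

lemma card_arcs_degree_sum: "card (arcs F) = (\<Sum>y\<in>V. card {x. {x, y} \<in> F})"
proof -
  let ?N = "\<lambda>y. {x. {x, y} \<in> F}"
  have fN: "finite (?N y)" for y using arc_facts finV by (auto intro: finite_subset[of _ V])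
  have "bij_betw (\<lambda>(y, x). (x, y)) (SIGMA y:V. ?N y) (arcs F)"
    using arc_facts by (intro bij_betw_imageI) (auto simp: inj_on_def arcs_def)
  then show ?thesis using finV fN by (simp add: bij_betw_same_card[symmetric] card_SigmaI)
qed

text \<open>
Since \<open>d (d - 1) \<ge> 2 (d - 1)\<close> for every degree \<open>d\<close>, the number of cherries is bounded below in terms
of the degree sum. The gain is decisive for the orders 7, 8 and 9.
\<close>

lemma card_cherries_ge: "2 * card (arcs F) \<le> card (cherries F) + 2 * card V"
proof -
  have "2 * d \<le> d * (d - 1) + 2" for d :: nat
    by (cases d; cases "d - 1") auto
  then have "(\<Sum>y\<in>V. 2 * card {x. {x, y} \<in> F}) \<le> (\<Sum>y\<in>V. card {x. {x, y} \<in> F} * (card {x. {x, y} \<in> F} - 1) + 2)"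
    by (intro sum_mono)
  then show ?thesis
    unfolding card_cherries card_arcs_degree_sum sum.distrib sum_distrib_left[symmetric] sum_constant
    by (simp add: mult.commute)
qed

lemma card_cherries_gt:
  assumes "y \<in> V" "3 \<le> card {x. {x, y} \<in> F}"
  shows "2 * card (arcs F) < card (cherries F) + 2 * card V"
proof -
  have *: "2 * d \<le> d * (d - 1) + 2" for d :: nat
    by (cases d; cases "d - 1") auto
  have "2 * d < d * (d - 1) + 2" if "3 \<le> d" for d :: nat
  proof -
    have "d * 2 \<le> d * (d - 1)" using that by (intro mult_le_mono2) simp
    then show ?thesis by linarith
  qed
  then have "(\<Sum>y\<in>V. 2 * card {x. {x, y} \<in> F}) < (\<Sum>y\<in>V. card {x. {x, y} \<in> F} * (card {x. {x, y} \<in> F} - 1) + 2)"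
    using finV assms * by (intro sum_strict_mono_ex1) auto
  then show ?thesis
    unfolding card_cherries card_arcs_degree_sum sum.distrib sum_distrib_left[symmetric] sum_constant
    by (simp add: mult.commute)
qed

end

section \<open>Averaging over all orders of the vertex set\<close>

text \<open>
The cyclic shift acts transitively on the positions.
\<close>

lemma mod_Suc_closed:
  assumes "W \<subseteq> {..<n}" "\<And>i. i \<in> W \<Longrightarrow> Suc i mod n \<in> W" "W \<noteq> {}"
  shows "W = {..<n}"
proof -
  obtain i where i: "i \<in> W" using assms(3) by blast
  have n: "0 < n" using i assms(1) by auto
  have *: "(i + t) mod n \<in> W" for t
  proof (induction t)
    case 0
    then show ?case using i assms(1) by auto
  next
    case (Suc t)
    then have "Suc ((i + t) mod n) mod n \<in> W" by (rule assms(2))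
    then show ?case by (simp add: mod_Suc_eq)
  qed
  have "j \<in> W" if "j < n" for j
  proof -
    have "(i + (n - i + j)) mod n = j" using that i assms(1) by auto
    then show ?thesis using *[of "n - i + j"] by simp
  qed
  then show ?thesis using assms(1) by auto
qed

text \<open>
If \<open>B\<close> is the set of broken links, these are the positions from which \<open>j + 1\<close> successive links are
unbroken.
\<close>

definition run_starts :: "nat \<Rightarrow> nat set \<Rightarrow> nat \<Rightarrow> nat set" where
  "run_starts n B j = {i. i < n \<and> (\<forall>t\<le>j. (i + t) mod n \<notin> B)}"

lemma finite_run_starts [simp]: "finite (run_starts n B j)"
  by (simp add: run_starts_def)

text \<open>
Prolonging all runs by one link destroys at least one of them: otherwise the set of starting
positions would be invariant under the cyclic shift, which contradicts the existence of a broken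
link.
\<close>

lemma card_run_starts_Suc:
  assumes "B \<subseteq> {..<n}" "B \<noteq> {}"
  shows "card (run_starts n B (Suc j)) \<le> card (run_starts n B j) - 1"
proof (cases "run_starts n B j = {}")
  case True
  moreover have "run_starts n B (Suc j) \<subseteq> run_starts n B j" by (auto simp: run_starts_def)
  ultimately show ?thesis by simp
next
  case False
  have "\<exists>i\<in>run_starts n B j. Suc i mod n \<notin> run_starts n B j"
  proof (rule ccontr)
    assume "\<not> ?thesis"
    then have "run_starts n B j = {..<n}"
      using False by (intro mod_Suc_closed) (auto simp: run_starts_def)
    moreover obtain b where "b \<in> B" "b < n" using assms by auto
    ultimately have "b \<in> run_starts n B j" by simp
    then show False using \<open>b \<in> B\<close> \<open>b < n\<close> by (auto simp: run_starts_def)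
  qed
  then obtain i where i: "i \<in> run_starts n B j" "Suc i mod n \<notin> run_starts n B j" by blast
  have "i \<notin> run_starts n B (Suc j)"
  proof
    assume a: "i \<in> run_starts n B (Suc j)"
    then have n: "0 < n" by (auto simp: run_starts_def)
    have "(Suc i mod n + t) mod n \<notin> B" if "t \<le> j" for t
    proof -
      have "\<forall>t\<le>Suc j. (i + t) mod n \<notin> B" using a by (simp add: run_starts_def)
      moreover have "Suc t \<le> Suc j" using that by simp
      ultimately have "(i + Suc t) mod n \<notin> B" by blast
      then show ?thesis by (simp add: mod_simps)
    qed
    then have "Suc i mod n \<in> run_starts n B j" using n by (simp add: run_starts_def)
    with i(2) show False by blast
  qed
  then have "run_starts n B (Suc j) \<subseteq> run_starts n B j - {i}" by (auto simp: run_starts_def)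
  then have "card (run_starts n B (Suc j)) \<le> card (run_starts n B j - {i})" by (intro card_mono) auto
  then show ?thesis using i(1) by (simp add: card_Diff_singleton)
qed

lemma card_run_starts_add:
  assumes "B \<subseteq> {..<n}" "B \<noteq> {}"
  shows "card (run_starts n B (i + j)) \<le> card (run_starts n B i) - j"
proof (induction j)
  case (Suc j)
  then show ?case using card_run_starts_Suc[OF assms, of "i + j"] by simp
qed simp

lemma card_run_starts:
  assumes "B \<subseteq> {..<n}" "B \<noteq> {}"
  shows "card (run_starts n B j) \<le> n - card B - j"
proof -
  have "run_starts n B 0 = {..<n} - B" by (auto simp: run_starts_def)
  then have "card (run_starts n B 0) = n - card B"
    using assms(1) by (simp add: card_Diff_subset finite_subset)
  then show ?thesis using card_run_starts_add[OF assms, of 0 j] by simp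
qed

lemma link_positions_rotate:
  assumes "m < length s"
  shows "(i + m) mod length s \<in> link_positions F s \<longleftrightarrow> m \<in> link_positions F (rotate i s)"
proof -
  have n: "0 < length s" using assms by auto
  have "rotate i s ! ((m + 1) mod length s) = s ! ((i + (m + 1) mod length s) mod length s)"
    using n by (simp add: nth_rotate)
  also have "(i + (m + 1) mod length s) mod length s = ((i + m) mod length s + 1) mod length s"
    by (simp add: mod_simps)
  finally show ?thesis using assms n by (simp add: link_positions_def nth_rotate)
qed

lemma link_positions_subset: "link_positions F s \<subseteq> {..<length s}"
  by (auto simp: link_positions_def)

definition windows :: "nat \<Rightarrow> 'a list set \<Rightarrow> 'a list \<Rightarrow> nat set" where
  "windows k L s = {i. i < length s \<and> take k (rotate i s) \<in> L}"

lemma windows_subset_run_starts: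
  assumes "2 \<le> k" "k \<le> length s" "L \<subseteq> cycle_lists k V E" "F \<inter> E = {}"
  shows "windows k L s \<subseteq> run_starts (length s) (link_positions F s) (k - 2)"
proof
  fix i assume i: "i \<in> windows k L s"
  then have il: "i < length s" and c: "cyclic_links (take k (rotate i s)) \<subseteq> E"
    using assms(3) by (auto simp: windows_def cycle_lists_def)
  have "(i + t) mod length s \<notin> link_positions F s" if t: "t \<le> k - 2" for t
  proof -
    have t1: "Suc t < k" "Suc t < length s" using t assms(1,2) by auto
    have "{take k (rotate i s) ! t, take k (rotate i s) ! Suc t} \<in> E"
      using mem_cyclic_links_Suc[of t "take k (rotate i s)"] c t1 assms(2) by auto
    then have "{rotate i s ! t, rotate i s ! Suc t} \<in> E" using t1 by simp
    then have "t \<notin> link_positions F (rotate i s)"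
      using t1 assms(4) by (auto simp: link_positions_def)
    then show ?thesis using link_positions_rotate[of t s i F] t1 by simp
  qed
  then show "i \<in> run_starts (length s) (link_positions F s) (k - 2)"
    using il by (simp add: run_starts_def)
qed

lemma double_counting:
  assumes "finite A" "finite B"
  shows "(\<Sum>a\<in>A. card {b \<in> B. R a b}) = (\<Sum>b\<in>B. card {a \<in> A. R a b})"
proof -
  have "(\<Sum>a\<in>A. card {b \<in> B. R a b}) = (\<Sum>a\<in>A. \<Sum>b\<in>B. if R a b then 1 else 0)"
    using assms by (simp add: sum.If_cases Int_def)
  also have "\<dots> = (\<Sum>b\<in>B. \<Sum>a\<in>A. if R a b then 1 else 0)" by (rule sum.swap)
  also have "\<dots> = (\<Sum>b\<in>B. card {a \<in> A. R a b})"
    using assms by (simp add: sum.If_cases Int_def)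
  finally show ?thesis .
qed

text \<open>
Each of the \<open>n\<close> windows of a random order is uniformly distributed.
\<close>

lemma sum_card_windows:
  assumes "finite V" "card V = n" "L \<subseteq> distinct_lists k V" "k \<le> n"
  shows "(\<Sum>s\<in>distinct_lists n V. card (windows k L s)) = n * (card L * fact (n - k))"
proof -
  have "(\<Sum>s\<in>distinct_lists n V. card (windows k L s)) = (\<Sum>s\<in>distinct_lists n V. card {i \<in> {..<n}. take k (rotate i s) \<in> L})"
    by (intro sum.cong refl arg_cong[where f = card]) (auto simp: windows_def distinct_lists_def)
  also have "\<dots> = (\<Sum>i\<in>{..<n}. card {s \<in> distinct_lists n V. take k (rotate i s) \<in> L})"
    using assms(1) by (intro double_counting) auto
  also have "\<dots> = (\<Sum>i\<in>{..<n}. card L * fact (n - k))"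
    using assms by (intro sum.cong refl card_distinct_lists_take_bij bij_betw_rotate)
  finally show ?thesis by simp
qed

context edge_set
begin

lemma sum_card_link_positions:
  assumes "card V = n" "2 \<le> n"
  shows "(\<Sum>s\<in>distinct_lists n V. card (link_positions F s)) = n * (card (arcs F) * fact (n - 2))"
proof -
  let ?Q = "{[x, y] | x y. {x, y} \<in> F}"
  have sub: "?Q \<subseteq> distinct_lists 2 V" using arc_facts by (auto simp: distinct_lists_def)
  have "bij_betw (\<lambda>(x, y). [x, y]) (arcs F) ?Q"
    by (intro bij_betw_imageI) (auto simp: inj_on_def arcs_def)
  then have cQ: "card ?Q = card (arcs F)" by (simp add: bij_betw_same_card)
  have eq: "i \<in> link_positions F s \<longleftrightarrow> take 2 (rotate i s) \<in> ?Q" if "s \<in> distinct_lists n V" "i < n" for s i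
  proof -
    have l: "length s = n" using that by (simp add: distinct_lists_def)
    have "i \<in> link_positions F s \<longleftrightarrow> 0 \<in> link_positions F (rotate i s)"
      using link_positions_rotate[of 0 s i F] that l by simp
    also have "\<dots> \<longleftrightarrow> take 2 (rotate i s) \<in> ?Q"
      using assms l by (auto simp: take_2_nth link_positions_def)
    finally show ?thesis .
  qed
  have "link_positions F s = windows 2 ?Q s" if s: "s \<in> distinct_lists n V" for s
  proof (rule set_eqI)
    fix i
    have l: "length s = n" using s by (simp add: distinct_lists_def)
    show "i \<in> link_positions F s \<longleftrightarrow> i \<in> windows 2 ?Q s"
    proof (cases "i < n")
      case True
      then show ?thesis using eq[OF s True] by (simp only: windows_def mem_Collect_eq l simp_thms)
    next
      case False
      then show ?thesis by (simp add: windows_def link_positions_def l)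
    qed
  qed
  then have "(\<Sum>s\<in>distinct_lists n V. card (link_positions F s)) = (\<Sum>s\<in>distinct_lists n V. card (windows 2 ?Q s))"
    by (intro sum.cong) simp_all
  also have "\<dots> = n * (card ?Q * fact (n - 2))"
    by (rule sum_card_windows[OF finV assms(1) sub assms(2)])
  finally show ?thesis by (simp add: cQ)
qed

text \<open>
Second moments depend on whether the two links share an entry, which happens for \<open>m = 1\<close> and, around
the cycle, for \<open>m = n - 1\<close>.
\<close>

lemma card_two_links_at_distance:
  assumes n: "card V = n" "5 \<le> n" and i: "i < n" and m: "m \<in> {1..<n}"
  shows "card {s \<in> distinct_lists n V. i \<in> link_positions F s \<and> (i + m) mod n \<in> link_positions F s}
    = (if m = 1 \<or> m = n - 1 then card (cherries F) * fact (n - 3) else card (disjoint_pairs F) * fact (n - 4))"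
    (is "card ?S = _")
proof -
  have rot: "(i + m) mod n \<in> link_positions F s \<longleftrightarrow> m \<in> link_positions F (rotate i s)"
    if "s \<in> distinct_lists n V" "m < n" for s i m
    using link_positions_rotate[of m s i F] that by (simp add: distinct_lists_def)
  have S: "?S = {s \<in> distinct_lists n V. 0 \<in> link_positions F (rotate i s) \<and> m \<in> link_positions F (rotate i s)}"
    using rot[of _ 0 i] rot[of _ m i] i m by auto
  have ch: "0 \<in> link_positions F r \<and> 1 \<in> link_positions F r \<longleftrightarrow> take 3 r \<in> cherries F" if "r \<in> distinct_lists n V" for r
  proof -
    have r: "length r = n" "distinct r" using that by (auto simp: distinct_lists_def)
    then have "r ! 0 \<noteq> r ! 2" using n by (simp add: nth_eq_iff_index_eq)
    then show ?thesis using r n by (auto simp: take_3_nth cherries_def link_positions_def numeral_2_eq_2)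
  qed
  consider "m = 1" | "m = n - 1" "m \<noteq> 1" | "2 \<le> m" "m + 1 < n" using m by fastforce
  then show ?thesis
  proof cases
    case 1
    then have "?S = {s \<in> distinct_lists n V. take 3 (rotate i s) \<in> cherries F}"
      unfolding S by (intro Collect_cong conj_cong refl) (simp only: ch rotate_distinct_lists_iff)
    then show ?thesis
      using card_distinct_lists_take_bij[OF finV n(1) cherries_subset _ bij_betw_rotate[OF finV]] 1 n(2) by simp
  next
    case 2
    have "?S = {s \<in> distinct_lists n V. take 3 (rotate (n - 1) (rotate i s)) \<in> cherries F}"
    proof -
      have *: "0 \<in> link_positions F r \<and> m \<in> link_positions F r \<longleftrightarrow> take 3 (rotate (n - 1) r) \<in> cherries F"
        if "r \<in> distinct_lists n V" for r
        using rot[OF that, of 0 "n - 1"] rot[OF that, of 1 "n - 1"] ch[of "rotate (n - 1) r"] that n(2) 2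
        by auto
      show ?thesis unfolding S by (intro Collect_cong conj_cong refl) (simp only: * rotate_distinct_lists_iff)
    qed
    then have "?S = {s \<in> distinct_lists n V. take 3 (rotate (n - 1 + i) s) \<in> cherries F}" by (simp add: rotate_rotate)
    then show ?thesis
      using card_distinct_lists_take_bij[OF finV n(1) cherries_subset _ bij_betw_rotate[OF finV]] 2 n(2) by simp
  next
    case 3
    have *: "0 \<in> link_positions F r \<and> m \<in> link_positions F r \<longleftrightarrow> take 4 (twist (m - 2) r) \<in> disjoint_pairs F"
      if "r \<in> distinct_lists n V" for r
    proof -
      have r: "length r = n" "distinct r" using that by (auto simp: distinct_lists_def)
      have "distinct [r ! 0, r ! 1, r ! m, r ! (m + 1)]" using r 3 by (simp add: nth_eq_iff_index_eq)
      moreover have "take 4 (twist (m - 2) r) = [r ! 0, r ! 1, r ! m, r ! (m + 1)]"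
        using take_4_twist[of m r] 3 r by simp
      ultimately show ?thesis using r 3 by (auto simp: disjoint_pairs_def link_positions_def)
    qed
    have "?S = {s \<in> distinct_lists n V. take 4 ((twist (m - 2) \<circ> rotate i) s) \<in> disjoint_pairs F}"
      unfolding S by (intro Collect_cong conj_cong refl) (simp only: * rotate_distinct_lists_iff comp_apply)
    then show ?thesis
      using card_distinct_lists_take_bij[OF finV n(1) disjoint_pairs_subset _
          bij_betw_trans[OF bij_betw_rotate[OF finV] bij_betw_twist[OF finV]]] 3 n(2) by simp
  qed
qed

lemma sum_card_link_pairs:
  assumes n: "card V = n" "5 \<le> n"
  shows "(\<Sum>s\<in>distinct_lists n V. card (link_positions F s) * (card (link_positions F s) - 1))
    \<le> n * ((2 * card (cherries F) + card (disjoint_pairs F)) * fact (n - 3))"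
proof -
  let ?R = "\<lambda>s p. fst p \<in> link_positions F s \<and> (fst p + snd p) mod n \<in> link_positions F s"
  let ?T = "{..<n} \<times> {1..<n}"
  have le: "card (link_positions F s) * (card (link_positions F s) - 1) \<le> card {p \<in> ?T. ?R s p}"
    if s: "s \<in> distinct_lists n V" for s
  proof -
    let ?B = "link_positions F s"
    have B: "?B \<subseteq> {..<n}" using link_positions_subset s by (auto simp: distinct_lists_def)
    have "(SIGMA i:?B. ?B - {i}) \<subseteq> (\<lambda>p. (fst p, (fst p + snd p) mod n)) ` {p \<in> ?T. ?R s p}"
    proof
      fix q assume "q \<in> (SIGMA i:?B. ?B - {i})"
      then obtain i j where q: "q = (i, j)" "i \<in> ?B" "j \<in> ?B" "i \<noteq> j" by auto
      then have ij: "i < n" "j < n" using B by auto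
      \<comment> \<open>the cyclic distance from \<open>i\<close> to \<open>j\<close>\<close>
      define m where "m = (if i < j then j - i else n - i + j)"
      have m: "(i + m) mod n = j" "m \<in> {1..<n}" using ij q(4) by (auto simp: m_def)
      then have "(i, m) \<in> {p \<in> ?T. ?R s p}" using q ij by auto
      then show "q \<in> (\<lambda>p. (fst p, (fst p + snd p) mod n)) ` {p \<in> ?T. ?R s p}"
        by (rule rev_image_eqI) (use m q in simp)
    qed
    then have "card (SIGMA i:?B. ?B - {i}) \<le> card {p \<in> ?T. ?R s p}"
      by (intro surj_card_le) auto
    then show ?thesis by (simp add: card_SigmaI)
  qed
  let ?c = "card (cherries F) * fact (n - 3)" and ?d = "card (disjoint_pairs F) * fact (n - 4)"
  have "(\<Sum>s\<in>distinct_lists n V. card (link_positions F s) * (card (link_positions F s) - 1))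
      \<le> (\<Sum>s\<in>distinct_lists n V. card {p \<in> ?T. ?R s p})"
    by (intro sum_mono le)
  also have "\<dots> = (\<Sum>p\<in>?T. card {s \<in> distinct_lists n V. ?R s p})"
    using finV by (intro double_counting) auto
  also have "\<dots> = (\<Sum>p\<in>?T. if snd p = 1 \<or> snd p = n - 1 then ?c else ?d)"
    by (intro sum.cong refl, rule card_two_links_at_distance[OF n]) auto
  also have "\<dots> = n * (\<Sum>m\<in>{1..<n}. if m = 1 \<or> m = n - 1 then ?c else ?d)"
  proof -
    have "(\<Sum>i\<in>{..<n}. \<Sum>m\<in>{1..<n}. if m = 1 \<or> m = n - 1 then ?c else ?d)
        = (\<Sum>p\<in>?T. if snd p = 1 \<or> snd p = n - 1 then ?c else ?d)"
      unfolding sum.cartesian_product by (intro sum.cong) auto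
    then show ?thesis by (simp only: sum_constant card_lessThan of_nat_id)
  qed
  also have "(\<Sum>m\<in>{1..<n}. if m = 1 \<or> m = n - 1 then ?c else ?d)
      = (\<Sum>m\<in>{1, n - 1}. ?c) + (\<Sum>m\<in>{2..<n - 1}. ?d)"
  proof -
    have "{1..<n} = {1, n - 1} \<union> {2..<n - 1}" using n(2) by auto
    then have "(\<Sum>m\<in>{1..<n}. if m = 1 \<or> m = n - 1 then ?c else ?d)
      = (\<Sum>m\<in>{1, n - 1}. if m = 1 \<or> m = n - 1 then ?c else ?d) + (\<Sum>m\<in>{2..<n - 1}. if m = 1 \<or> m = n - 1 then ?c else ?d)"
      by (simp only:) (rule sum.union_disjoint, auto)
    also have "\<dots> = (\<Sum>m\<in>{1, n - 1}. ?c) + (\<Sum>m\<in>{2..<n - 1}. ?d)"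
      by (intro arg_cong2[where f = "(+)"] sum.cong) auto
    finally show ?thesis .
  qed
  also have "\<dots> = 2 * ?c + (n - 3) * ?d"
  proof -
    have "card {1, n - 1} = 2" "card {2..<n - 1} = n - 3" using n(2) by auto
    then show ?thesis by (simp only: sum_constant of_nat_id)
  qed
  also have "(n - 3) * ?d = card (disjoint_pairs F) * fact (n - 3)"
  proof -
    have "n - 3 = Suc (n - 4)" using n(2) by simp
    then have "fact (n - 3) = (n - 3) * (fact (n - 4) :: nat)" by (metis fact_Suc of_nat_id)
    then show ?thesis by (simp add: algebra_simps)
  qed
  finally show ?thesis by (simp add: algebra_simps)
qed

end

text \<open>
The conclusion of the averaging argument in terms of \<open>P(n - 1, k)\<close>: dividing by \<open>fact (n - k)\<close>
turns \<open>(n - k) (n - 1)!\<close> into \<open>(n - 1)! / (n - 1 - k)!\<close>.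
\<close>

lemma less_falling_fact_if:
  assumes "k < n" "X * fact (n - k) < (n - k) * fact (n - 1)"
  shows "X < falling_fact (n - 1) k"
proof -
  have "n - k = Suc (n - 1 - k)" using assms(1) by simp
  then have "fact (n - k) = (n - k) * (fact (n - 1 - k) :: nat)" by (metis fact_Suc of_nat_id)
  moreover have "falling_fact (n - 1) k * fact (n - 1 - k) = fact (n - 1)"
    using assms(1) by (intro falling_fact_mult_fact) simp
  ultimately have "X * fact (n - k) < falling_fact (n - 1) k * fact (n - k)"
    using assms(2) by (simp add: algebra_simps)
  then show ?thesis by simp
qed

lemma nonhamiltonian_order_has_broken_link:
  assumes "s \<in> distinct_lists n V" "cycle_lists n V E = {}"
  shows "link_positions (- E) s \<noteq> {}"
proof -
  have "\<not> cyclic_links s \<subseteq> E" using assms by (auto simp: cycle_lists_def)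
  then obtain i where "i < length s" "{s ! i, s ! ((i + 1) mod length s)} \<notin> E"
    by (auto simp: cyclic_links_def)
  then show ?thesis by (auto simp: link_positions_def)
qed

text \<open>
The witness \<open>b\<close> is the number of all broken links of the order. It is positive because the graph is
nonhamiltonian, and at least the number of links in \<open>F\<close>.
\<close>

lemma card_windows_le:
  assumes "s \<in> distinct_lists n V" "cycle_lists n V E = {}" "2 \<le> k" "k < n" "F \<inter> E = {}"
  shows "\<exists>b\<ge>1. card (link_positions F s) \<le> b \<and> card (windows k (cycle_lists k V E) s) \<le> n - b - (k - 2)"
proof (intro exI conjI)
  let ?B = "link_positions (- E) s"
  have l: "length s = n" using assms(1) by (simp add: distinct_lists_def)
  have B: "?B \<noteq> {}" "?B \<subseteq> {..<n}"
    using nonhamiltonian_order_has_broken_link[OF assms(1,2)] link_positions_subset l by blast+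
  show "1 \<le> card ?B" using B(1) by (simp add: Suc_leI card_gt_0_iff)
  show "card (link_positions F s) \<le> card ?B"
    using assms(5) by (intro card_mono) (auto simp: link_positions_def)
  have "card (windows k (cycle_lists k V E) s) \<le> card (run_starts n ?B (k - 2))"
    using windows_subset_run_starts[of k s "cycle_lists k V E" V E "- E"] assms l by (intro card_mono) auto
  then show "card (windows k (cycle_lists k V E) s) \<le> n - card ?B - (k - 2)"
    using card_run_starts[OF B(2,1), of "k - 2"] by simp
qed

text \<open>
The common factor \<open>f\<close> will be \<open>(n - 3)!\<close>.
\<close>

lemma averaging_arith:
  fixes n x d a b f c t :: nat
  assumes "6 * (n * x) + 8 * (n * (d * (b * f))) \<le> n * (a * (b * f)) * (6 * c + 14) + n * (t * f)"
    and "14 * (a * b) + t < 8 * (d * b)" "0 < n" "0 < f"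
  shows "x < c * (a * (b * f))"
proof -
  have "n * (6 * x + 8 * (d * b) * f) \<le> n * ((a * b) * f * (6 * c) + (14 * (a * b) + t) * f)"
    using assms(1) by (simp add: algebra_simps)
  then have "6 * x + 8 * (d * b) * f \<le> (a * b) * f * (6 * c) + (14 * (a * b) + t) * f"
    using assms(3) by simp
  moreover have "(14 * (a * b) + t) * f < 8 * (d * b) * f"
    using assms(2,4) by (intro mult_strict_right_mono)
  ultimately have "6 * x < (a * b) * f * (6 * c)" by linarith
  then show ?thesis by (simp add: algebra_simps)
qed

text \<open>
The numerical hypothesis says that the mean of \<open>8 z - z (z - 1)\<close> exceeds 14, where \<open>z\<close> is the number
of links of a random order that lie in \<open>F\<close>; it has been multiplied by \<open>(n - 1) (n - 2)\<close>.
\<close>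

theorem card_cycle_lists_less_many_nonedges:
  assumes "edge_set V F" "F \<inter> E = {}" "card V = n" "5 \<le> n" "3 \<le> k" "k < n" "cycle_lists n V E = {}"
    and many: "14 * ((n - 1) * (n - 2)) + card (arcs F) * card (arcs F)
      < 8 * card (arcs F) * (n - 2) + 2 * card (arcs F) + 2 * card (cherries F)"
  shows "card (cycle_lists k V E) < falling_fact (n - 1) k"
proof -
  interpret edge_set V F by fact
  let ?L = "cycle_lists k V E" and ?\<Omega> = "distinct_lists n V"
  let ?Z = "\<lambda>s. card (link_positions F s)"
  let ?f = "fact (n - 3) :: nat"
  have pt: "6 * card (windows k ?L s) + 8 * ?Z s \<le> (6 * (n - k) + 14) + ?Z s * (?Z s - 1)"
    if s: "s \<in> ?\<Omega>" for s
  proof -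
    obtain b where b: "1 \<le> b" "?Z s \<le> b" "card (windows k ?L s) \<le> n - b - (k - 2)"
      using card_windows_le[OF s assms(7), of k F] assms by auto
    \<comment> \<open>this is \<open>(z - 4) (z - 5) \<ge> 0\<close>\<close>
    have quad: "8 * z \<le> 20 + z * (z - 1)" for z :: nat
    proof (cases "z \<le> 9")
      case True
      then have "z \<in> {0,1,2,3,4,5,6,7,8,9}" by auto
      then show ?thesis by auto
    next
      case False
      then have "z * 8 \<le> z * (z - 1)" by (intro mult_le_mono2) auto
      then show ?thesis by linarith
    qed
    define z where "z = ?Z s"
    have zb: "z \<le> b" using b(2) by (simp add: z_def)
    consider "b = 1" | "b = 2" | "3 \<le> b" using b(1) by linarith
    then show ?thesis
    proof cases
      case 1
      then have "z = 0 \<or> z = 1" using zb by auto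
      then show ?thesis using b(3) 1 assms(5,6) unfolding z_def[symmetric] by auto
    next
      case 2
      then have "z = 0 \<or> z = 1 \<or> z = 2" using zb by auto
      then show ?thesis using b(3) 2 assms(5,6) unfolding z_def[symmetric] by auto
    next
      case 3
      then have "card (windows k ?L s) + 1 \<le> n - k" using b(3) assms(5,6) by linarith
      then show ?thesis using quad[of z] unfolding z_def[symmetric] by linarith
    qed
  qed
  have facts: "fact n = n * ((n - 1) * ((n - 2) * ?f))" "fact (n - 2) = (n - 2) * ?f" "fact (n - 1) = (n - 1) * ((n - 2) * ?f)"
  proof -
    define m where "m = n - 3"
    then have m: "n = Suc (Suc (Suc m))" using assms(4) by simp
    have "n - 1 = Suc (Suc m)" "n - 2 = Suc m" "n - 3 = m" by (simp_all add: m)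
    then show "fact n = n * ((n - 1) * ((n - 2) * ?f))" "fact (n - 2) = (n - 2) * ?f" "fact (n - 1) = (n - 1) * ((n - 2) * ?f)"
      unfolding m by (simp_all only: fact_Suc of_nat_id mult.assoc diff_Suc_1)
  qed
  have "(\<Sum>s\<in>?\<Omega>. 6 * card (windows k ?L s) + 8 * ?Z s)
      \<le> (\<Sum>s\<in>?\<Omega>. (6 * (n - k) + 14) + ?Z s * (?Z s - 1))"
    by (intro sum_mono pt)
  then have "6 * (\<Sum>s\<in>?\<Omega>. card (windows k ?L s)) + 8 * (\<Sum>s\<in>?\<Omega>. ?Z s)
      \<le> card ?\<Omega> * (6 * (n - k) + 14) + (\<Sum>s\<in>?\<Omega>. ?Z s * (?Z s - 1))"
    unfolding sum.distrib sum_distrib_left[symmetric] sum_constant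
    by (simp only: of_nat_id distrib_left)
  moreover have "card ?\<Omega> = fact n" using finV assms(3) by (simp add: card_distinct_lists falling_fact_self)
  moreover have "(\<Sum>s\<in>?\<Omega>. card (windows k ?L s)) = n * (card ?L * fact (n - k))"
    using assms finV by (intro sum_card_windows) (auto simp: cycle_lists_def)
  moreover have "(\<Sum>s\<in>?\<Omega>. ?Z s) = n * (card (arcs F) * fact (n - 2))"
    using assms by (intro sum_card_link_positions) auto
  moreover note sum_card_link_pairs[OF assms(3,4)]
  ultimately have "6 * (n * (card ?L * fact (n - k))) + 8 * (n * (card (arcs F) * fact (n - 2)))
     \<le> fact n * (6 * (n - k) + 14) + n * ((2 * card (cherries F) + card (disjoint_pairs F)) * ?f)"
    by simp
  moreover have "14 * ((n - 1) * (n - 2)) + (2 * card (cherries F) + card (disjoint_pairs F)) < 8 * (card (arcs F) * (n - 2))"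
    using many card_disjoint_pairs by linarith
  ultimately have "card ?L * fact (n - k) < (n - k) * ((n - 1) * ((n - 2) * ?f))"
    unfolding facts by (intro averaging_arith[where n = n and f = ?f]) (use assms(4) in simp_all)
  then have "card ?L * fact (n - k) < (n - k) * fact (n - 1)"
    unfolding facts .
  then show ?thesis using less_falling_fact_if assms(6) by blast
qed

text \<open>
Here the nonedges in \<open>X\<close> form a \<open>K\<^sub>4\<close> and the general averaging argument just fails. The number \<open>z\<close>
of links in \<open>X\<close> is at most 3, so that \<open>min b 3 \<ge> z\<close>, and the mean of \<open>z\<close> is exactly 2. Strictness
comes from an order in which two nonadjacent links are broken: together
they destroy at least \<open>k + 1\<close> windows, while two broken links are only guaranteed to destroy \<open>k\<close>.
\<close>

theorem card_cycle_lists_less_order_7: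
  assumes "finite V" "card V = 7" "X \<subseteq> V" "card X = 4"
    and indep: "\<And>x y. x \<in> X \<Longrightarrow> y \<in> X \<Longrightarrow> x \<noteq> y \<Longrightarrow> {x, y} \<notin> E"
    and "3 \<le> k" "k < 7" "cycle_lists 7 V E = {}"
  shows "card (cycle_lists k V E) < falling_fact 6 k"
proof -
  define F where "F = {e. e \<subseteq> X \<and> card e = 2}"
  interpret edge_set V F using assms by unfold_locales (auto simp: F_def)
  have FE: "F \<inter> E = {}" using indep by (auto simp: F_def card_2_iff)
  let ?L = "cycle_lists k V E" and ?\<Omega> = "distinct_lists 7 V"
  let ?Z = "\<lambda>s. card (link_positions F s)"
  have finX: "finite X" using assms by (meson finite_subset)
  have "card F = 6"
    unfolding F_def using n_subsets[OF finX, of 2] assms(4) by (simp add: choose_two)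
  then have D: "card (arcs F) = 12" using card_arcs_F by simp
  have inF: "{x, y} \<in> F \<longleftrightarrow> x \<noteq> y \<and> x \<in> X \<and> y \<in> X" for x y
    by (auto simp: F_def card_2_iff doubleton_eq_iff)
  have Z3: "?Z s \<le> 3" if "s \<in> ?\<Omega>" for s
  proof -
    have s: "length s = 7" "distinct s" "set s \<subseteq> V" using that by (auto simp: distinct_lists_def)
    have sV: "set s = V" using s assms(1,2) by (intro card_subset_eq) (auto simp: distinct_card)
    define I where "I = {i. i < 7 \<and> s ! i \<in> X}"
    have I: "I \<subseteq> {..<7}" "finite I" by (auto simp: I_def)
    have "bij_betw ((!) s) I X"
      using s assms(3) sV by (intro bij_betw_imageI)
        (auto simp: I_def inj_on_def nth_eq_iff_index_eq in_set_conv_nth image_iff, metis in_set_conv_nth subsetD)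
    then have cI: "card I = 4" using assms(4) by (simp add: bij_betw_same_card)
    have sub: "link_positions F s \<subseteq> {i \<in> I. Suc i mod 7 \<in> I}"
      using s by (auto simp: link_positions_def inF I_def)
    have "{i \<in> I. Suc i mod 7 \<in> I} \<noteq> I"
    proof
      assume "{i \<in> I. Suc i mod 7 \<in> I} = I"
      then have "I = {..<7}" using cI I by (intro mod_Suc_closed) auto
      with cI show False by simp
    qed
    then have "link_positions F s \<subset> I" using sub by auto
    then have "?Z s < card I" using I by (intro psubset_card_mono) auto
    then show ?thesis using cI by simp
  qed
  have pt: "card (windows k ?L s) + ?Z s \<le> 9 - k" if s: "s \<in> ?\<Omega>" for s
  proof -
    obtain b where b: "1 \<le> b" "?Z s \<le> b" "card (windows k ?L s) \<le> 7 - b - (k - 2)"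
      using card_windows_le[OF s assms(8), of k F] FE assms(6,7) by auto
    then show ?thesis using Z3[OF s] assms(6,7) by linarith
  qed
  obtain xs where xs: "set xs = X" "distinct xs" using finX finite_distinct_list by blast
  then have "length xs = 4" using assms(4) distinct_card[of xs] by simp
  then obtain a b c d where abcd: "xs = [a, b, c, d]" by (auto simp: length_Suc_conv numeral_eq_Suc)
  have "card (V - X) = 3" using assms finX by (simp add: card_Diff_subset)
  moreover obtain ys where ys: "set ys = V - X" "distinct ys"
    using assms(1) finite_distinct_list[of "V - X"] by auto
  ultimately have "length ys = 3" using distinct_card[of ys] by simp
  then obtain e f g where efg: "ys = [e, f, g]" by (auto simp: length_Suc_conv numeral_eq_Suc)
  \<comment> \<open>exactly the links at the positions 0 and 3 lie within \<open>X\<close>\<close>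
  define s where "s = [a, b, e, c, d, f, g]"
  have X: "X = {a, b, c, d}" and VX: "V - X = {e, f, g}" using xs ys abcd efg by auto
  have s\<Omega>: "s \<in> ?\<Omega>" using xs ys abcd efg X VX assms(3) by (auto simp: distinct_lists_def s_def)
  have less7: "i < 7 \<longleftrightarrow> i = 0 \<or> i = 1 \<or> i = 2 \<or> i = 3 \<or> i = 4 \<or> i = 5 \<or> i = (6::nat)" for i by auto
  have mem: "a \<in> X" "b \<in> X" "c \<in> X" "d \<in> X" "e \<notin> X" "f \<notin> X" "g \<notin> X" "a \<noteq> b" "c \<noteq> d"
    using X VX xs abcd by auto
  have LP: "link_positions F s = {0, 3}"
  proof (rule set_eqI)
    fix i
    show "i \<in> link_positions F s \<longleftrightarrow> i \<in> {0, 3}"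
    proof (cases "i < 7")
      case True
      then consider "i = 0" | "i = 1" | "i = 2" | "i = 3" | "i = 4" | "i = 5" | "i = 6"
        unfolding less7 by blast
      then show ?thesis by cases (simp_all add: link_positions_def inF s_def mem)
    next
      case False
      then have "i \<noteq> 0" "i \<noteq> 3" by auto
      with False show ?thesis by (simp add: link_positions_def s_def)
    qed
  qed
  have strict: "card (windows k ?L s) + ?Z s < 9 - k"
  proof -
    have len: "length s = 7" by (simp add: s_def)
    have k1: "k - 2 = 1 + (k - 3)" using assms(6) by simp
    \<comment> \<open>two steps of the run already exclude four starting positions: 0, 3 and their predecessors\<close>
    have "windows k ?L s \<subseteq> run_starts 7 {0, 3} (1 + (k - 3))"
      using windows_subset_run_starts[of k s ?L V E F] assms(6,7) FE LP len k1 by simp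
    then have "card (windows k ?L s) \<le> card (run_starts 7 {0, 3} (1 + (k - 3)))" by (intro card_mono) auto
    also have "\<dots> \<le> card (run_starts 7 {0, 3} 1) - (k - 3)" by (intro card_run_starts_add) auto
    also have "run_starts 7 {0, 3} 1 \<subseteq> {1, 4, 5}"
    proof
      fix i assume i: "i \<in> run_starts 7 {0, 3} 1"
      then have "i < 7" "(i + 0) mod 7 \<notin> {0, 3}" "(i + 1) mod 7 \<notin> {0, 3}" by (auto simp: run_starts_def)
      then show "i \<in> {1, 4, 5}" by (auto simp: less7)
    qed
    then have "card (run_starts 7 {0, 3} 1) \<le> card {1, 4, 5 :: nat}" by (intro card_mono) auto
    then have "card (run_starts 7 {0, 3} 1) - (k - 3) \<le> 3 - (k - 3)" by simp
    finally show ?thesis using assms(6,7) LP by simp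
  qed
  have "(\<Sum>s\<in>?\<Omega>. card (windows k ?L s) + ?Z s) < (\<Sum>s\<in>?\<Omega>. 9 - k)"
    using assms(1) pt strict s\<Omega> by (intro sum_strict_mono_ex1) auto
  moreover have "card ?\<Omega> = fact 7" using assms by (simp add: card_distinct_lists falling_fact_self)
  moreover have "(\<Sum>s\<in>?\<Omega>. card (windows k ?L s)) = 7 * (card ?L * fact (7 - k))"
    using assms by (intro sum_card_windows) (auto simp: cycle_lists_def)
  moreover have "(\<Sum>s\<in>?\<Omega>. ?Z s) = 7 * (card (arcs F) * fact (7 - 2))"
    using assms by (intro sum_card_link_positions) auto
  ultimately have "7 * (card ?L * fact (7 - k)) + 7 * (12 * fact 5) < fact 7 * (9 - k)"
    by (simp add: sum.distrib D)
  moreover have "fact 7 * (9 - k) = fact 7 * (7 - k) + 7 * (12 * fact 5 :: nat)"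
  proof -
    have "9 - k = (7 - k) + 2" using assms(7) by simp
    then show ?thesis by (simp add: fact_numeral algebra_simps)
  qed
  ultimately have "7 * (card ?L * fact (7 - k)) < 7 * ((7 - k) * fact (7 - 1))"
    by (simp add: fact_numeral)
  then have "card ?L < falling_fact (7 - 1) k" using assms(7) by (intro less_falling_fact_if) simp_all
  then show ?thesis by simp
qed

section \<open>Degrees in nonhamiltonian graphs\<close>

text \<open>
The links of a list that is not closed up, for cutting cycles into paths and reassembling them.
\<close>

fun path_links :: "'a list \<Rightarrow> 'a set set" where
  "path_links (x # y # zs) = insert {x, y} (path_links (y # zs))"
| "path_links _ = {}"

lemma path_links_append:
  "as \<noteq> [] \<Longrightarrow> bs \<noteq> [] \<Longrightarrow> path_links (as @ bs) = insert {last as, hd bs} (path_links as \<union> path_links bs)"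
proof (induction as rule: path_links.induct)
  case ("2_2" v)
  then show ?case by (cases bs) auto
qed auto

lemma path_links_rev [simp]: "path_links (rev xs) = path_links xs"
proof (induction xs rule: path_links.induct)
  case (1 x y zs)
  then show ?case using path_links_append[of "rev (y # zs)" "[x]"] by (simp add: insert_commute)
qed auto

lemma path_links_nth: "path_links xs = {{xs ! i, xs ! Suc i} | i. Suc i < length xs}"
proof (induction xs rule: path_links.induct)
  case (1 x y zs)
  have "{{(x # y # zs) ! i, (x # y # zs) ! Suc i} | i. Suc i < length (x # y # zs)}
     = insert {x, y} {{(y # zs) ! i, (y # zs) ! Suc i} | i. Suc i < length (y # zs)}" (is "?L = ?R")
  proof (intro equalityI subsetI)
    fix e assume "e \<in> ?L"
    then obtain i where "Suc i < length (x # y # zs)" "e = {(x # y # zs) ! i, (x # y # zs) ! Suc i}" by blast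
    then show "e \<in> ?R" by (cases i) auto
  next
    fix e assume "e \<in> ?R"
    then consider "e = {x, y}" | i where "Suc i < length (y # zs)" "e = {(y # zs) ! i, (y # zs) ! Suc i}" by blast
    then show "e \<in> ?L"
    proof cases
      case 1
      then show ?thesis by (auto intro!: exI[of _ 0])
    next
      case (2 i)
      then show ?thesis by (auto intro!: exI[of _ "Suc i"])
    qed
  qed
  with 1 show ?case by simp
qed auto

lemma cyclic_links_path_links:
  assumes "xs \<noteq> []"
  shows "cyclic_links xs = insert {last xs, hd xs} (path_links xs)"
proof (intro equalityI subsetI)
  fix e assume "e \<in> cyclic_links xs"
  then obtain i where i: "i < length xs" "e = {xs ! i, xs ! ((i + 1) mod length xs)}" by (auto simp: cyclic_links_def)
  show "e \<in> insert {last xs, hd xs} (path_links xs)"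
  proof (cases "Suc i < length xs")
    case True
    then show ?thesis using i by (auto simp: path_links_nth)
  next
    case False
    then have "i = length xs - 1" "(i + 1) mod length xs = 0" using i(1) by (auto simp: not_less le_Suc_eq)
    then show ?thesis using i(2) assms by (simp add: last_conv_nth hd_conv_nth)
  qed
next
  fix e assume "e \<in> insert {last xs, hd xs} (path_links xs)"
  then consider "e = {last xs, hd xs}" | "e \<in> path_links xs" by blast
  then show "e \<in> cyclic_links xs"
  proof cases
    case 1
    then show ?thesis using mem_cyclic_links[of "length xs - 1" xs] assms by (simp add: last_conv_nth hd_conv_nth)
  next
    case 2
    then show ?thesis by (auto simp: path_links_nth intro: mem_cyclic_links_Suc)
  qed
qed

text \<open>
The crossing argument of Ore. Let the path be \<open>z\<^sub>0, \<dots>, z\<^sub>n\<^sub>-\<^sub>1\<close>. If \<open>z\<^sub>0\<close> were adjacent to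
\<open>z\<^sub>j\<^sub>+\<^sub>1\<close> and \<open>z\<^sub>n\<^sub>-\<^sub>1\<close> to \<open>z\<^sub>j\<close>, then reversing the part after \<open>z\<^sub>j\<close> would give a Hamilton cycle. So the
neighbours of the two ends correspond to disjoint sets of indices \<open>j < n - 1\<close>.
\<close>

lemma hamiltonian_path_end_degrees:
  assumes "finite V" "card V = n" "2 \<le> n" "cycle_lists n V E = {}"
    and zs: "zs \<in> distinct_lists n V" "path_links zs \<subseteq> E"
  shows "card (neighbours V E (hd zs)) + card (neighbours V E (last zs)) \<le> n - 1"
proof -
  have l: "length zs = n" and d: "distinct zs" and "set zs \<subseteq> V" using zs(1) by (auto simp: distinct_lists_def)
  then have V: "set zs = V" using assms(1,2) by (intro card_subset_eq) (auto simp: distinct_card)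
  have ne: "zs \<noteq> []" using l assms(3) by auto
  define x where "x = hd zs"
  define y where "y = last zs"
  have x: "x = zs ! 0" and y: "y = zs ! (n - 1)" using ne l by (simp_all add: x_def y_def hd_conv_nth last_conv_nth)
  define A where "A = {j. j < n - 1 \<and> {x, zs ! Suc j} \<in> E}"
  define B where "B = {j. j < n - 1 \<and> {zs ! j, y} \<in> E}"
  have "neighbours V E x \<subseteq> (\<lambda>j. zs ! Suc j) ` A"
  proof
    fix w assume w: "w \<in> neighbours V E x"
    then obtain i where i: "i < n" "w = zs ! i" using V l by (auto simp: neighbours_def in_set_conv_nth)
    moreover have "i \<noteq> 0" using w i x by (intro notI) (simp add: neighbours_def)
    ultimately obtain j where "i = Suc j" by (cases i) auto
    then show "w \<in> (\<lambda>j. zs ! Suc j) ` A" using w i by (auto simp: A_def neighbours_def)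
  qed
  then have cA: "card (neighbours V E x) \<le> card A" by (rule surj_card_le[rotated]) (simp add: A_def)
  have "neighbours V E y \<subseteq> (\<lambda>j. zs ! j) ` B"
  proof
    fix w assume w: "w \<in> neighbours V E y"
    then obtain i where i: "i < n" "w = zs ! i" using V l by (auto simp: neighbours_def in_set_conv_nth)
    moreover have "i \<noteq> n - 1" using w i y by (intro notI) (simp add: neighbours_def)
    ultimately show "w \<in> (\<lambda>j. zs ! j) ` B" using w by (auto simp: B_def neighbours_def insert_commute)
  qed
  then have cB: "card (neighbours V E y) \<le> card B" by (rule surj_card_le[rotated]) (simp add: B_def)
  have "A \<inter> B = {}"
  proof (rule ccontr)
    assume "A \<inter> B \<noteq> {}"
    then obtain j where j: "j < n - 1" "{x, zs ! Suc j} \<in> E" "{zs ! j, y} \<in> E" by (auto simp: A_def B_def)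
    \<comment> \<open>cut the path between the two crossing edges\<close>
    define as where "as = take (Suc j) zs"
    define bs where "bs = drop (Suc j) zs"
    have ab: "zs = as @ bs" by (simp add: as_def bs_def)
    have nes: "as \<noteq> []" "bs \<noteq> []" using j l by (auto simp: as_def bs_def)
    have "last as = zs ! j" "hd bs = zs ! Suc j"
      using j l ne by (auto simp: as_def bs_def hd_drop_conv_nth last_conv_nth)
    moreover have "hd as = x" "last bs = y" using nes unfolding x_def y_def by (subst ab, simp)+
    ultimately have ends: "hd as = x" "last as = zs ! j" "hd bs = zs ! Suc j" "last bs = y" by simp_all
    have "path_links as \<union> path_links bs \<subseteq> E" using zs(2) path_links_append[OF nes] ab by auto
    then have "cyclic_links (as @ rev bs) \<subseteq> E"
      using nes j ends by (simp add: cyclic_links_path_links path_links_append hd_rev last_rev insert_commute)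
    moreover have "as @ rev bs \<in> distinct_lists n V" using zs(1) ab by (auto simp: distinct_lists_def)
    ultimately show False using assms(4) by (auto simp: cycle_lists_def)
  qed
  then have "card A + card B = card (A \<union> B)" by (simp add: A_def B_def card_Un_disjoint)
  also have "\<dots> \<le> card {..<n - 1}" by (intro card_mono) (auto simp: A_def B_def)
  finally show ?thesis using cA cB by (simp add: x_def y_def)
qed

text \<open>
A Hamilton cycle that appears with the edge \<open>uv\<close> is a Hamilton path from \<open>u\<close> to \<open>v\<close> without it.
\<close>

lemma ore_degree_sum:
  assumes "finite V" "card V = n" "3 \<le> n" "cycle_lists n V E = {}" "cycle_lists n V (insert {u, v} E) \<noteq> {}"
  shows "card (neighbours V E u) + card (neighbours V E v) \<le> n - 1"
proof -
  obtain ys where ys: "ys \<in> distinct_lists n V" "cyclic_links ys \<subseteq> insert {u, v} E" using assms(5) by (auto simp: cycle_lists_def)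
  have l: "length ys = n" using ys by (simp add: distinct_lists_def)
  have "\<not> cyclic_links ys \<subseteq> E" using assms(4) ys(1) by (auto simp: cycle_lists_def)
  then have "{u, v} \<in> cyclic_links ys" using ys(2) by auto
  then obtain i where i: "i < n" "{u, v} = {ys ! i, ys ! ((i + 1) mod n)}" using l by (auto simp: cyclic_links_def)
  define zs where "zs = rotate (i + 1) ys"
  have zs: "zs \<in> distinct_lists n V" "cyclic_links zs \<subseteq> insert {u, v} E" unfolding zs_def using ys by (simp_all only: rotate_distinct_lists_iff cyclic_links_rotate)
  have lz: "length zs = n" "distinct zs" using zs(1) by (auto simp: distinct_lists_def)
  have ne: "zs \<noteq> []" using lz assms(3) by auto
  have "hd zs = ys ! ((i + 1) mod n)" "last zs = ys ! i"
  proof -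
    show "hd zs = ys ! ((i + 1) mod n)" using ne l i(1) nth_rotate[of 0 ys "i + 1"] assms(3)
      by (simp add: hd_conv_nth zs_def)
    have "(i + 1 + (n - 1)) mod n = i" using i(1) assms(3) by simp
    then show "last zs = ys ! i" using ne l lz nth_rotate[of "n - 1" ys "i + 1"] assms(3)
      by (simp add: last_conv_nth zs_def del: rotate_Suc)
  qed
  then have uv: "{u, v} = {hd zs, last zs}" using i(2) by auto
  have "path_links zs \<subseteq> E"
  proof
    fix e assume e: "e \<in> path_links zs"
    then obtain j where j: "Suc j < n" "e = {zs ! j, zs ! Suc j}" using lz by (auto simp: path_links_nth)
    have "e \<noteq> {zs ! 0, zs ! (n - 1)}"
      using j lz assms(3) by (auto simp: doubleton_eq_iff nth_eq_iff_index_eq)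
    then have "e \<noteq> {u, v}" using uv ne lz by (simp add: hd_conv_nth last_conv_nth)
    then show "e \<in> E" using e zs(2) cyclic_links_path_links[OF ne] by auto
  qed
  then have "card (neighbours V E (hd zs)) + card (neighbours V E (last zs)) \<le> n - 1"
    using assms zs(1) by (intro hamiltonian_path_end_degrees) auto
  then show ?thesis using uv by (auto simp: doubleton_eq_iff)
qed

definition pairs :: "'a set \<Rightarrow> 'a set set" where
  "pairs V = {e. e \<subseteq> V \<and> card e = 2}"

lemma doubleton_in_pairs [simp]: "{x, y} \<in> pairs V \<longleftrightarrow> x \<noteq> y \<and> x \<in> V \<and> y \<in> V"
  by (auto simp: pairs_def card_2_iff doubleton_eq_iff)

lemma finite_pairs [simp]: "finite V \<Longrightarrow> finite (pairs V)"
  by (simp add: pairs_def)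

lemma cycle_lists_mono: "E \<subseteq> E' \<Longrightarrow> cycle_lists k V E \<subseteq> cycle_lists k V E'"
  by (auto simp: cycle_lists_def)

lemma neighbours_mono: "E \<subseteq> E' \<Longrightarrow> neighbours V E v \<subseteq> neighbours V E' v"
  by (auto simp: neighbours_def)

lemma saturated_extension:
  assumes "finite V" "card V = n" "3 \<le> n" "cycle_lists n V E = {}" "E \<subseteq> pairs V"
  obtains E' where "E \<subseteq> E'" "E' \<subseteq> pairs V" "cycle_lists n V E' = {}"
    "\<And>u v. u \<in> V \<Longrightarrow> v \<in> V \<Longrightarrow> u \<noteq> v \<Longrightarrow> {u, v} \<notin> E' \<Longrightarrow>
       card (neighbours V E' u) + card (neighbours V E' v) \<le> n - 1"
proof -
  let ?A = "{E'. E' \<subseteq> pairs V \<and> cycle_lists n V E' = {}}"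
  have "finite ?A" using assms(1) by simp
  moreover have "E \<in> ?A" using assms by simp
  ultimately have "\<exists>E'\<in>?A. E \<subseteq> E' \<and> (\<forall>E''\<in>?A. E' \<subseteq> E'' \<longrightarrow> E' = E'')"
    by (rule finite_has_maximal2)
  then obtain E' where E': "E' \<in> ?A" "E \<subseteq> E'" "\<forall>E''\<in>?A. E' \<subseteq> E'' \<longrightarrow> E' = E''" by blast
  show thesis
  proof
    fix u v assume uv: "u \<in> V" "v \<in> V" "u \<noteq> v" "{u, v} \<notin> E'"
    have "insert {u, v} E' \<notin> ?A"
    proof
      assume "insert {u, v} E' \<in> ?A"
      then have "E' = insert {u, v} E'" using bspec[OF E'(3)] by (simp only: subset_insertI)
      then show False using uv(4) by blast
    qed
    then have "cycle_lists n V (insert {u, v} E') \<noteq> {}" using E'(1) uv by auto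
    then show "card (neighbours V E' u) + card (neighbours V E' v) \<le> n - 1"
      using ore_degree_sum[OF assms(1-3)] E'(1) by auto
  qed (use E' in auto)
qed

lemma card_nonneighbours:
  assumes "finite V" "v \<in> V"
  shows "card {w \<in> V - {v}. {v, w} \<notin> E} + card (neighbours V E v) = card V - 1"
proof -
  have "{w \<in> V - {v}. {v, w} \<notin> E} \<union> neighbours V E v = V - {v}" by (auto simp: neighbours_def)
  moreover have "card ({w \<in> V - {v}. {v, w} \<notin> E} \<union> neighbours V E v) = card {w \<in> V - {v}. {v, w} \<notin> E} + card (neighbours V E v)"
    using assms by (intro card_Un_disjoint) (auto simp: neighbours_def)
  ultimately show ?thesis using assms by (simp add: card_Diff_singleton)
qed

lemma ex_maximizer:
  fixes f :: "'b \<Rightarrow> nat"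
  assumes "S \<noteq> {}" "finite S"
  shows "\<exists>p\<in>S. \<forall>q\<in>S. f q \<le> f p"
proof -
  have "Max (f ` S) \<in> f ` S" using assms by (intro Max_in) auto
  then obtain p where "p \<in> S" "f p = Max (f ` S)" by force
  then show ?thesis using assms by (intro bexI[of _ p]) auto
qed

text \<open>
Take a nonadjacent pair \<open>u, v\<close> of largest degree sum, with \<open>d u \<le> d v\<close>. By maximality, no vertex
that is nonadjacent to \<open>v\<close> has degree greater than \<open>d u\<close>, and there are \<open>n - 1 - d v \<ge> d u\<close> such
vertices.
\<close>

lemma chvatal_low_degrees:
  assumes "finite V" "card V = n" "3 \<le> n" "cycle_lists n V E = {}"
    and ore: "\<And>u v. u \<in> V \<Longrightarrow> v \<in> V \<Longrightarrow> u \<noteq> v \<Longrightarrow> {u, v} \<notin> E \<Longrightarrow>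
       card (neighbours V E u) + card (neighbours V E v) \<le> n - 1"
  obtains u v h where "u \<in> V" "v \<in> V" "card (neighbours V E u) = h" "h \<le> card (neighbours V E v)"
    "card (neighbours V E v) + h \<le> n - 1"
    "\<And>w. w \<in> V - {v} \<Longrightarrow> {v, w} \<notin> E \<Longrightarrow> card (neighbours V E w) \<le> h"
proof -
  let ?d = "\<lambda>w. card (neighbours V E w)"
  define S where "S = {(u, v) \<in> V \<times> V. u \<noteq> v \<and> {u, v} \<notin> E}"
  have "S \<noteq> {}"
  proof
    assume "S = {}"
    then have "cycle_lists n V E = distinct_lists n V"
      using assms(3) by (intro cycle_lists_complete) (auto simp: S_def)
    then have "card (distinct_lists n V) = 0" using assms(4) by simp
    then show False using assms(1,2) by (simp add: card_distinct_lists falling_fact_self)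
  qed
  moreover have "finite S" using assms(1) by (auto simp: S_def intro: finite_subset[of _ "V \<times> V"])
  ultimately obtain p where p: "p \<in> S" "\<And>q. q \<in> S \<Longrightarrow> ?d (fst q) + ?d (snd q) \<le> ?d (fst p) + ?d (snd p)"
    using ex_maximizer[of S "\<lambda>q. ?d (fst q) + ?d (snd q)"] by blast
  have pS: "fst p \<in> V" "snd p \<in> V" "fst p \<noteq> snd p" "{fst p, snd p} \<notin> E"
    using p(1) by (auto simp: S_def)
  obtain u v where uv: "u \<in> V" "v \<in> V" "u \<noteq> v" "{u, v} \<notin> E" "?d u \<le> ?d v"
    and max: "\<And>x y. (x, y) \<in> S \<Longrightarrow> ?d x + ?d y \<le> ?d u + ?d v"
  proof (cases "?d (fst p) \<le> ?d (snd p)")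
    case True
    then show ?thesis using p that[of "fst p" "snd p"] pS by fastforce
  next
    case False
    moreover have "{snd p, fst p} \<notin> E" using pS by (simp add: insert_commute)
    ultimately show ?thesis using p that[of "snd p" "fst p"] pS by fastforce
  qed
  show thesis
  proof
    show "?d v + ?d u \<le> n - 1" using ore[OF uv(1-4)] by simp
    fix w assume "w \<in> V - {v}" "{v, w} \<notin> E"
    then have "(v, w) \<in> S" using uv(2) by (auto simp: S_def)
    then show "?d w \<le> ?d u" using max[of v w] by simp
  qed (use uv in auto)
qed

text \<open>
Each of the \<open>h\<close> vertices of \<open>A\<close> has at least \<open>n - 1 - h\<close> nonneighbours. The correction term
accounts for the nonedges within \<open>A\<close>, which are seen from both ends.
\<close>

lemma nonedges_lower_bound:
  assumes "finite V" "card V = n" "A \<subseteq> V" "card A = h" "\<And>a. a \<in> A \<Longrightarrow> card (neighbours V E a) \<le> h"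
  shows "2 * (h * (n - 1 - h)) \<le> 2 * card (pairs V - E) + card {(a, b) \<in> A \<times> A. a \<noteq> b \<and> {a, b} \<notin> E}"
proof -
  let ?N = "pairs V - E"
  have fA: "finite A" using assms by (meson finite_subset)
  define D where "D = (SIGMA a:A. {w \<in> V - {a}. {a, w} \<notin> E})"
  have fD: "finite D" using fA assms(1) by (auto simp: D_def)
  have "h * (n - 1 - h) = (\<Sum>a\<in>A. n - 1 - h)" using assms(4) by simp
  also have "\<dots> \<le> (\<Sum>a\<in>A. card {w \<in> V - {a}. {a, w} \<notin> E})"
  proof (rule sum_mono)
    fix a assume "a \<in> A"
    then show "n - 1 - h \<le> card {w \<in> V - {a}. {a, w} \<notin> E}"
      using card_nonneighbours[of V a E] assms(1,2,3) assms(5)[of a] by force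
  qed
  also have "\<dots> = card D" using fA assms(1) by (simp add: D_def card_SigmaI)
  finally have D: "h * (n - 1 - h) \<le> card D" .
  have "D \<union> D\<inverse> \<subseteq> arcs ?N" using assms(3) by (auto simp: D_def arcs_def insert_commute)
  moreover have fN: "finite ?N" and N2: "\<And>e. e \<in> ?N \<Longrightarrow> card e = 2"
    using assms(1) by (simp_all add: pairs_def)
  moreover have "finite (arcs ?N)" using card_arcs(2)[OF fN N2] by (simp add: arcs_def)
  ultimately have "card (D \<union> D\<inverse>) \<le> card (arcs ?N)" by (intro card_mono)
  also have "\<dots> = 2 * card ?N" using card_arcs(1)[OF fN N2] by (simp add: arcs_def)
  finally have 1: "card (D \<union> D\<inverse>) \<le> 2 * card ?N" .
  have "D \<inter> D\<inverse> = {(a, b) \<in> A \<times> A. a \<noteq> b \<and> {a, b} \<notin> E}"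
    using assms(3) by (auto simp: D_def insert_commute)
  then have 2: "card D + card (D\<inverse>) = card (D \<union> D\<inverse>) + card {(a, b) \<in> A \<times> A. a \<noteq> b \<and> {a, b} \<notin> E}"
    using card_Un_Int[of D "D\<inverse>"] fD by simp
  show ?thesis using D 1 2 by simp
qed

lemma card_off_diagonal: "finite A \<Longrightarrow> card {(a, b) \<in> A \<times> A. a \<noteq> b} = card A * (card A - 1)"
proof -
  assume "finite A"
  moreover have "{(a, b) \<in> A \<times> A. a \<noteq> b} = (SIGMA a:A. A - {a})" by auto
  ultimately show ?thesis by (simp add: card_SigmaI)
qed

lemma subset_of_nonedges_edge_set: "finite V \<Longrightarrow> F \<subseteq> pairs V - E \<Longrightarrow> edge_set V F"
  by unfold_locales (auto simp: pairs_def)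

text \<open>
With \<open>m = n - 1\<close> and \<open>3m/2\<close> nonedges, the requirement of the averaging argument becomes
\<open>14 m (m - 1) + 9 m\<^sup>2 < 24 m (m - 1) + 6 m\<close>, that is, \<open>m > 4\<close>; rounding up to an integer
number of nonedges is harmless as well.
\<close>

lemma many_nonedges_large_order:
  assumes "finite V" "card V = n" "10 \<le> n" "3 \<le> k" "k < n" "cycle_lists n V E = {}"
    and "3 * (n - 1) \<le> 2 * card (pairs V - E)"
  shows "card (cycle_lists k V E) < falling_fact (n - 1) k"
proof -
  define f where "f = (3 * (n - 1) + 1) div 2"
  have "f \<le> card (pairs V - E)" using assms(7) by (simp add: f_def)
  then obtain F where F: "F \<subseteq> pairs V - E" "card F = f" by (meson obtain_subset_with_card_n)
  interpret edge_set V F using subset_of_nonedges_edge_set[OF assms(1) F(1)] .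
  define m where "m = n - 1"
  have m: "9 \<le> m" "n - 1 = m" "n - 2 = m - 1" using assms(3) by (auto simp: m_def)
  obtain l where l: "m = Suc l" using m(1) by (cases m) auto
  have l8: "8 \<le> l" using m l by simp
  have D: "card (arcs F) = 3 * m \<or> card (arcs F) = 3 * m + 1"
    using card_arcs_F(1) F(2) unfolding f_def m(2) by presburger
  have sq: "8 * l \<le> l * l" using l8 by (intro mult_le_mono1)
  have "14 * (m * (m - 1)) + card (arcs F) * card (arcs F) < 8 * card (arcs F) * (m - 1) + 2 * card (arcs F)"
    using D
  proof
    assume "card (arcs F) = 3 * m"
    then show ?thesis unfolding l by (simp add: algebra_simps) (use l8 sq in linarith)
  next
    assume "card (arcs F) = 3 * m + 1"
    then show ?thesis unfolding l by (simp add: algebra_simps) (use l8 sq in linarith)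
  qed
  then have "14 * ((n - 1) * (n - 2)) + card (arcs F) * card (arcs F)
      < 8 * card (arcs F) * (n - 2) + 2 * card (arcs F) + 2 * card (cherries F)"
    unfolding m by linarith
  then show ?thesis
    using assms F by (intro card_cycle_lists_less_many_nonedges[where F = F]) (auto simp: edge_set_axioms)
qed

text \<open>
For the small orders the bound on the number of cherries is needed. In order 7 it leads to a tie
that is broken by a vertex with three nonneighbours, whose nonedges are put into \<open>F\<close>.
\<close>

lemma many_nonedges_order_7_8_9:
  assumes "finite V" "card V = n" "3 \<le> k" "k < n" "cycle_lists n V E = {}"
    and "n = 7 \<and> 7 \<le> card (pairs V - E) \<and> a \<in> V \<and> card (neighbours V E a) \<le> 3
      \<or> n = 8 \<and> 9 \<le> card (pairs V - E) \<or> n = 9 \<and> 10 \<le> card (pairs V - E)"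
  shows "card (cycle_lists k V E) < falling_fact (n - 1) k"
proof -
  have fin: "finite (pairs V - E)" using assms(1) by simp
  have "\<exists>F. F \<subseteq> pairs V - E \<and> (n = 7 \<and> card F = 7 \<and> a \<in> V \<and> 3 \<le> card {x. {x, a} \<in> F} \<or> n = 8 \<and> card F = 9 \<or> n = 9 \<and> card F = 10)"
    using assms(6)
  proof (elim disjE conjE)
    assume 7: "n = 7" "7 \<le> card (pairs V - E)" "a \<in> V" "card (neighbours V E a) \<le> 3"
    have "3 \<le> card {w \<in> V - {a}. {a, w} \<notin> E}"
      using card_nonneighbours[OF assms(1) 7(3), of E] 7 assms(2) by linarith
    then obtain W where W: "W \<subseteq> {w \<in> V - {a}. {a, w} \<notin> E}" "card W = 3" by (meson obtain_subset_with_card_n)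
    have finW: "finite W" using W(2) card.infinite by fastforce
    let ?S = "(\<lambda>w. {w, a}) ` W"
    have "?S \<subseteq> pairs V - E" using W(1) 7(3) by (auto simp: insert_commute)
    moreover have "card ?S \<le> 7" using card_image_le[OF finW, of "\<lambda>w. {w, a}"] W(2) by simp
    ultimately obtain F where F: "?S \<subseteq> F" "F \<subseteq> pairs V - E" "card F = 7"
      using exists_subset_between[of ?S 7 "pairs V - E"] 7(2) fin by blast
    have "W \<subseteq> {x. {x, a} \<in> F}" using F(1) by auto
    moreover have "{x. {x, a} \<in> F} \<subseteq> V" using F(2) by (auto simp: pairs_def)
    then have "finite {x. {x, a} \<in> F}" using assms(1) finite_subset by blast
    ultimately have "3 \<le> card {x. {x, a} \<in> F}" using W(2) card_mono by metis
    then show ?thesis using F 7 by blast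
  next
    assume "n = 8" "9 \<le> card (pairs V - E)"
    then show ?thesis by (meson obtain_subset_with_card_n)
  next
    assume "n = 9" "10 \<le> card (pairs V - E)"
    then show ?thesis by (meson obtain_subset_with_card_n)
  qed
  then obtain F where F: "F \<subseteq> pairs V - E"
    and c: "n = 7 \<and> card F = 7 \<and> a \<in> V \<and> 3 \<le> card {x. {x, a} \<in> F} \<or> n = 8 \<and> card F = 9 \<or> n = 9 \<and> card F = 10"
    by blast
  interpret edge_set V F using subset_of_nonedges_edge_set[OF assms(1) F] .
  have "14 * ((n - 1) * (n - 2)) + card (arcs F) * card (arcs F)
      < 8 * card (arcs F) * (n - 2) + 2 * card (arcs F) + 2 * card (cherries F)"
    using c
  proof (elim disjE conjE)
    assume "n = 7" "card F = 7" "a \<in> V" "3 \<le> card {x. {x, a} \<in> F}"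
    then show ?thesis using card_cherries_gt[of a] assms(2) by (simp add: card_arcs_F)
  next
    assume "n = 8" "card F = 9"
    then show ?thesis using card_cherries_ge assms(2) by (simp add: card_arcs_F)
  next
    assume "n = 9" "card F = 10"
    then show ?thesis using card_cherries_ge assms(2) by (simp add: card_arcs_F)
  qed
  moreover have "5 \<le> n" using c by auto
  ultimately show ?thesis
    using assms F by (intro card_cycle_lists_less_many_nonedges[where F = F]) (auto simp: edge_set_axioms)
qed

theorem card_cycle_lists_less_min_degree_2:
  assumes "finite V" "card V = n" "E \<subseteq> pairs V" "cycle_lists n V E = {}" "3 \<le> k" "k < n"
    and deg: "\<And>v. v \<in> V \<Longrightarrow> 2 \<le> card (neighbours V E v)" and "(n, k) \<noteq> (5, 4)"
  shows "card (cycle_lists k V E) < falling_fact (n - 1) k"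
proof -
  have n3: "3 \<le> n" using assms by simp
  obtain E' where E': "E \<subseteq> E'" "E' \<subseteq> pairs V" "cycle_lists n V E' = {}"
    and ore: "\<And>u v. u \<in> V \<Longrightarrow> v \<in> V \<Longrightarrow> u \<noteq> v \<Longrightarrow> {u, v} \<notin> E' \<Longrightarrow>
       card (neighbours V E' u) + card (neighbours V E' v) \<le> n - 1"
    using saturated_extension[OF assms(1,2) n3 assms(4,3)] by blast
  let ?d = "\<lambda>v. card (neighbours V E' v)"
  have le: "card (cycle_lists k V E) \<le> card (cycle_lists k V E')"
    using assms(1) E'(1) by (intro card_mono cycle_lists_mono) auto
  obtain u v h where uv: "u \<in> V" "v \<in> V" "?d u = h" "h \<le> ?d v" "?d v + h \<le> n - 1"
    and low: "\<And>w. w \<in> V - {v} \<Longrightarrow> {v, w} \<notin> E' \<Longrightarrow> ?d w \<le> h"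
    using chvatal_low_degrees[OF assms(1,2) n3 E'(3) ore] by blast
  have "card (neighbours V E u) \<le> ?d u"
    using assms(1) E'(1) by (intro card_mono neighbours_mono) auto
  then have h2: "2 \<le> h" using deg[OF uv(1)] uv(3) by simp
  define A where "A = {w \<in> V - {v}. {v, w} \<notin> E'}"
  have cA: "card A + ?d v = n - 1"
    using card_nonneighbours[OF assms(1) uv(2), of E'] assms(2) by (simp add: A_def)
  have AV: "A \<subseteq> V" by (auto simp: A_def)
  have lowA: "?d w \<le> h" if "w \<in> A" for w using low that by (auto simp: A_def)
  obtain A' where A': "A' \<subseteq> A" "card A' = h" using cA uv(5) obtain_subset_with_card_n[of h A] by auto
  have finA': "finite A'" using A' AV assms(1) by (meson finite_subset)
  have "card (cycle_lists k V E') < falling_fact (n - 1) k"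
  proof (cases "h = 2")
    case True
    then obtain a b where ab: "A' = {a, b}" "a \<noteq> b" using A'(2) by (auto simp: card_2_iff)
    have "5 \<le> n" using uv(4,5) True by linarith
    moreover have "a \<in> V" "b \<in> V" "?d a \<le> 2" "?d b \<le> 2" using ab A' AV lowA True by auto
    ultimately show ?thesis
      using card_cycle_lists_two_degree_2(2)[of k V a b E'] assms(1,2,5,6,8) ab(2) by simp
  next
    case False
    then have h3: "3 \<le> h" using h2 by simp
    have hn: "2 * h \<le> n - 1" using uv(4,5) by simp
    let ?I = "{(a, b) \<in> A' \<times> A'. a \<noteq> b \<and> {a, b} \<notin> E'}"
    let ?N = "card (pairs V - E')"
    have low': "2 * (h * (n - 1 - h)) \<le> 2 * ?N + card ?I"
      using A' AV lowA by (intro nonedges_lower_bound[OF assms(1,2)]) auto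
    have fd: "finite {(a, b) \<in> A' \<times> A'. a \<noteq> b}" using finA' by (auto intro: finite_subset[of _ "A' \<times> A'"])
    have "card ?I \<le> card {(a, b) \<in> A' \<times> A'. a \<noteq> b}" using fd by (intro card_mono) auto
    then have I: "card ?I \<le> h * (h - 1)" using card_off_diagonal[OF finA'] A'(2) by simp
    consider "10 \<le> n" | "n = 9" | "n = 8" | "n = 7" using h3 hn by linarith
    then show ?thesis
    proof cases
      case 1
      \<comment> \<open>with these parameters the estimate involves no subtraction; \<open>n \<ge> 10\<close> makes \<open>b\<close> large if \<open>h\<close> is 3 or 4\<close>
      obtain j where j: "h = 3 + j" using h3 le_Suc_ex by blast
      obtain b where b: "n - 1 = 2 * h + b" using hn le_Suc_ex by blast
      have "3 * (n - 1) + h * (h - 1) \<le> 2 * (h * (n - 1 - h))"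
      proof -
        have "3 * (2 * (3 + j) + b) + (3 + j) * (2 + j) \<le> 2 * ((3 + j) * (3 + j + b))"
        proof -
          consider "j = 0" | "j = 1" | "2 \<le> j" by linarith
          then show ?thesis
          proof cases
            case 3
            then have "2 * 2 \<le> j * j" by (intro mult_le_mono)
            with 3 show ?thesis by (simp add: algebra_simps)
          qed (use 1 b j in auto)
        qed
        moreover have e: "n - 1 - h = 3 + j + b" "h - 1 = 2 + j" and e': "n - 1 = 2 * (3 + j) + b"
          using b j by simp_all
        ultimately show ?thesis unfolding e unfolding e' j by blast
      qed
      then have "3 * (n - 1) \<le> 2 * ?N" using low' I by linarith
      then show ?thesis
        using many_nonedges_large_order[OF assms(1,2) 1 assms(5,6) E'(3)] by blast
    next
      case 2
      then have "h = 3 \<or> h = 4" using h3 hn by linarith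
      then have "10 \<le> ?N" using low' I 2 by auto
      then show ?thesis
        using many_nonedges_order_7_8_9[OF assms(1,2,5,6) E'(3)] 2 by blast
    next
      case 3
      then have "h = 3" using h3 hn by linarith
      then have "9 \<le> ?N" using low' I 3 by auto
      then show ?thesis
        using many_nonedges_order_7_8_9[OF assms(1,2,5,6) E'(3)] 3 by blast
    next
      case 4
      then have h: "h = 3" using h3 hn by linarith
      have dv: "?d v = 3" using uv(4,5) h 4 by simp
      then have "card A = 3" using cA 4 by simp
      then have AA: "A' = A" using A' h AV assms(1) by (metis card_subset_eq finite_subset)
      show ?thesis
      proof (cases "\<exists>x\<in>A. \<exists>y\<in>A. x \<noteq> y \<and> {x, y} \<in> E'")
        case True
        then obtain x y where xy: "x \<in> A" "y \<in> A" "x \<noteq> y" "{x, y} \<in> E'" by blast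
        have "?I \<subseteq> {(a, b) \<in> A' \<times> A'. a \<noteq> b} - {(x, y), (y, x)}"
          using xy by (auto simp: insert_commute)
        then have "card ?I \<le> card ({(a, b) \<in> A' \<times> A'. a \<noteq> b} - {(x, y), (y, x)})"
          using fd by (intro card_mono) auto
        also have "\<dots> = card {(a, b) \<in> A' \<times> A'. a \<noteq> b} - card {(x, y), (y, x)}"
          using xy AA by (intro card_Diff_subset) auto
        also have "\<dots> = 4" using card_off_diagonal[OF finA'] A'(2) h xy(3) by simp
        finally have "7 \<le> ?N" using low' 4 h by simp
        moreover have "x \<in> V" "?d x \<le> 3" using xy(1) AV lowA h by auto
        ultimately show ?thesis
          using many_nonedges_order_7_8_9[OF assms(1,2,5,6) E'(3), of x] 4 by blast
      next
        case False
        have nb: "{v, w} \<notin> E'" "{w, v} \<notin> E'" if "w \<in> A" for w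
          using that by (simp_all add: A_def insert_commute)
        have "v \<notin> A" by (simp add: A_def)
        then have "card (insert v A) = 4" using \<open>card A = 3\<close> finA' AA by simp
        moreover have "{x, y} \<notin> E'" if "x \<in> insert v A" "y \<in> insert v A" "x \<noteq> y" for x y
          using that False nb by auto
        ultimately show ?thesis
          using card_cycle_lists_less_order_7[of V "insert v A" E' k] assms(1,2,5,6) E'(3) AV uv(2) 4 by simp
      qed
    qed
  qed
  with le show ?thesis by simp
qed

section \<open>The extremal graphs\<close>

text \<open>
An isomorphism class of graphs of order \<open>n\<close> is described by the adjacency relation of the indices of
a suitable enumeration of the vertices. This makes graphs on different vertex types comparable.
\<close>

definition has_pattern :: "(nat \<Rightarrow> nat \<Rightarrow> bool) \<Rightarrow> nat \<Rightarrow> 'a sgraph \<Rightarrow> bool" where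
  "has_pattern R n G \<longleftrightarrow> (\<exists>as. distinct as \<and> length as = n \<and> set as = verts G \<and>
     (\<forall>i<n. \<forall>j<n. {as ! i, as ! j} \<in> edges G \<longleftrightarrow> R i j))"

lemma has_pattern_card: "has_pattern R n G \<Longrightarrow> card (verts G) = n"
  unfolding has_pattern_def by (metis distinct_card)

lemma graph_iso_iff_has_pattern:
  fixes G :: "'a sgraph" and H :: "'b sgraph"
  assumes "has_pattern R n H"
  shows "G \<simeq> H \<longleftrightarrow> has_pattern R n G"
proof
  obtain bs where bs: "distinct bs" "length bs = n" "set bs = verts H"
    "\<And>i j. i < n \<Longrightarrow> j < n \<Longrightarrow> {bs ! i, bs ! j} \<in> edges H \<longleftrightarrow> R i j"
    using assms unfolding has_pattern_def by blast
  have bb: "bij_betw ((!) bs) {..<n} (verts H)" using bij_betw_nth[OF bs(1)] bs(2,3) by simp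
  {
    assume "G \<simeq> H"
    then obtain f where f: "bij_betw f (verts G) (verts H)"
      "\<And>u v. u \<in> verts G \<Longrightarrow> v \<in> verts G \<Longrightarrow> {u, v} \<in> edges G \<longleftrightarrow> {f u, f v} \<in> edges H"
      unfolding graph_iso_def by blast
    define g where "g = inv_into (verts G) f"
    have g: "bij_betw g (verts H) (verts G)" unfolding g_def using f(1) by (rule bij_betw_inv_into)
    have fg: "f (g x) = x" if "x \<in> verts H" for x
      using that f(1) unfolding g_def by (rule bij_betw_inv_into_right[rotated])
    have "distinct (map g bs)" "set (map g bs) = verts G"
      using g bs by (auto simp: distinct_map bij_betw_def)
    moreover have "{map g bs ! i, map g bs ! j} \<in> edges G \<longleftrightarrow> R i j" if "i < n" "j < n" for i j
    proof -
      have "bs ! i \<in> verts H" "bs ! j \<in> verts H" using that bs(2,3) nth_mem by blast+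
      then show ?thesis using that bs(2,4) f(2) g fg by (simp add: bij_betw_apply)
    qed
    ultimately show "has_pattern R n G" unfolding has_pattern_def using bs(2) by (metis length_map)
  }
  {
    assume "has_pattern R n G"
    then obtain as where as: "distinct as" "length as = n" "set as = verts G"
      "\<And>i j. i < n \<Longrightarrow> j < n \<Longrightarrow> {as ! i, as ! j} \<in> edges G \<longleftrightarrow> R i j"
      unfolding has_pattern_def by blast
    have ba: "bij_betw ((!) as) {..<n} (verts G)" using bij_betw_nth[OF as(1)] as(2,3) by simp
    define p where "p = inv_into {..<n} ((!) as)"
    have p: "bij_betw p (verts G) {..<n}" unfolding p_def using ba by (rule bij_betw_inv_into)
    have ap: "as ! p x = x" if "x \<in> verts G" for x
      using that ba unfolding p_def by (rule bij_betw_inv_into_right[rotated])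
    have "bij_betw (\<lambda>x. bs ! p x) (verts G) (verts H)"
      using bij_betw_trans[OF p bb] by (simp add: comp_def)
    moreover have "{u, v} \<in> edges G \<longleftrightarrow> {bs ! p u, bs ! p v} \<in> edges H"
      if uv: "u \<in> verts G" "v \<in> verts G" for u v
    proof -
      have "p u < n" "p v < n" using p uv by (auto dest: bij_betw_apply)
      then show ?thesis using as(4)[of "p u" "p v"] bs(4)[of "p u" "p v"] ap uv by simp
    qed
    ultimately show "G \<simeq> H" unfolding graph_iso_def by blast
  }
qed

text \<open>
The next four patterns describe \<open>K\<^sub>n\<^sub>-\<^sub>1 \<union> K\<^sub>1\<close>, \<open>K\<^sub>n\<^sub>-\<^sub>1 \<cdot> K\<^sub>2\<close>, \<open>K\<^sub>2\<^sub>,\<^sub>3\<close> and \<open>K\<^sub>2 \<or> 3K\<^sub>1\<close>, where the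
vertex outside the large complete graph, respectively the part of size 2, comes first.
\<close>

definition isolated_pattern :: "nat \<Rightarrow> nat \<Rightarrow> bool" where
  "isolated_pattern i j \<longleftrightarrow> i \<noteq> j \<and> 0 < i \<and> 0 < j"

definition pendant_pattern :: "nat \<Rightarrow> nat \<Rightarrow> bool" where
  "pendant_pattern i j \<longleftrightarrow> isolated_pattern i j \<or> i = 0 \<and> j = 1 \<or> i = 1 \<and> j = 0"

definition bipartite_pattern :: "nat \<Rightarrow> nat \<Rightarrow> bool" where
  "bipartite_pattern i j \<longleftrightarrow> (i < 2 \<longleftrightarrow> \<not> j < 2)"

definition split_pattern :: "nat \<Rightarrow> nat \<Rightarrow> bool" where
  "split_pattern i j \<longleftrightarrow> i \<noteq> j \<and> (i < 2 \<or> j < 2)"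

lemma image_doubleton_eq_iff:
  "inj f \<Longrightarrow> {f x, f y} \<in> (`) f ` S \<longleftrightarrow> {x, y} \<in> S"
proof
  assume "inj f" "{f x, f y} \<in> (`) f ` S"
  then obtain e where e: "e \<in> S" "{f x, f y} = f ` e" by blast
  then have "f ` e = f ` {x, y}" by simp
  then have "e = {x, y}" unfolding inj_image_eq_iff[OF \<open>inj f\<close>] .
  with e(1) show "{x, y} \<in> S" by (simp only:)
next
  assume "{x, y} \<in> S"
  then have "f ` {x, y} \<in> (`) f ` S" by (rule imageI)
  then show "{f x, f y} \<in> (`) f ` S" by simp
qed

lemma edges_complete_graph: "edges (complete_graph m) = pairs {..<m}"
  by (simp add: complete_graph_def pairs_def)

lemma verts_complete_graph: "verts (complete_graph m) = {..<m}"
  by (simp add: complete_graph_def)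

lemma pairs_singleton: "pairs {..<Suc 0} = {}"
proof -
  have "card e \<noteq> 2" if "e \<subseteq> {..<Suc 0}" for e
    using card_mono[OF _ that] by fastforce
  then show ?thesis unfolding pairs_def by blast
qed

lemma pairs_two: "pairs {..<2::nat} = {{0, 1}}"
proof (intro equalityI subsetI)
  fix e assume "e \<in> pairs {..<2::nat}"
  then have e: "e \<subseteq> {..<2}" "card e = 2" by (simp_all add: pairs_def)
  have "e = {..<2}" using e by (intro card_subset_eq) simp_all
  also have "{..<2} = {0, 1 :: nat}" by auto
  finally show "e \<in> {{0, 1}}" by simp
qed simp

lemma disjoint_union_has_pattern:
  assumes "1 \<le> n"
  shows "has_pattern isolated_pattern n (disjoint_union (complete_graph (n - 1)) (complete_graph 1))" (is "has_pattern _ _ ?H")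
proof -
  let ?as = "Inr 0 # map Inl [0..<n - 1] :: (nat + nat) list"
  have E: "edges ?H = (`) Inl ` pairs {..<n - 1}"
    by (simp add: disjoint_union_def union_graph_def map_sgraph_def edges_complete_graph pairs_singleton)
  have "distinct ?as" "length ?as = n" using assms by (auto simp: distinct_map inj_on_def)
  moreover have "set ?as = verts ?H"
    by (auto simp: disjoint_union_def union_graph_def map_sgraph_def verts_complete_graph)
  moreover have "{?as ! i, ?as ! j} \<in> edges ?H \<longleftrightarrow> isolated_pattern i j" if "i < n" "j < n" for i j
  proof (cases "i = 0 \<or> j = 0")
    case True
    then have "Inr 0 \<in> {?as ! i, ?as ! j}" by auto
    moreover have "Inr 0 \<notin> e" if "e \<in> edges ?H" for e using that unfolding E by auto
    ultimately show ?thesis using True by (auto simp: isolated_pattern_def)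
  next
    case False
    then have "?as ! i = Inl (i - 1)" "?as ! j = Inl (j - 1)" using that by auto
    then show ?thesis unfolding E using False that
      by (auto simp: image_doubleton_eq_iff isolated_pattern_def)
  qed
  ultimately show ?thesis unfolding has_pattern_def by blast
qed

lemma complete_with_pendant_has_pattern:
  assumes "2 \<le> n"
  shows "has_pattern pendant_pattern n (complete_with_pendant (n - 1))" (is "has_pattern _ _ ?H")
proof -
  let ?as = "Inr 1 # map Inl [0..<n - 1] :: (nat + nat) list"
  have E: "edges ?H = insert {Inl 0, Inr 1} ((`) Inl ` pairs {..<n - 1})"
    by (simp add: complete_with_pendant_def identify_vertices_def union_graph_def map_sgraph_def
        edges_complete_graph pairs_two) (simp only: insert_commute[of "Inl 0" "Inr (Suc 0)"])
  have "distinct ?as" "length ?as = n" using assms by (auto simp: distinct_map inj_on_def)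
  moreover have "set ?as = verts ?H"
  proof -
    have two: "{..<2} = {0, 1 :: nat}" by auto
    have 1: "verts ?H = Inl ` {..<n - 1} \<union> {Inl 0, Inr 1}"
      by (simp add: complete_with_pendant_def identify_vertices_def union_graph_def map_sgraph_def
          verts_complete_graph two) blast
    have 2: "Inl 0 \<in> Inl ` {..<n - 1}" using assms by simp
    have 3: "set ?as = insert (Inr 1) (Inl ` {..<n - 1})" by (simp add: atLeast0LessThan)
    have "S \<union> {p, q} = insert q S" if "p \<in> S" for p q :: "nat + nat" and S using that by blast
    from this[OF 2] show ?thesis unfolding 1 3 by (rule sym)
  qed
  moreover have "{?as ! i, ?as ! j} \<in> edges ?H \<longleftrightarrow> pendant_pattern i j" if "i < n" "j < n" for i j
  proof -
    have nt: "Inr 1 \<notin> e" if "e \<in> (`) Inl ` pairs {..<n - 1}" for e :: "(nat + nat) set"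
      using that by auto
    have nth: "?as ! l = Inl (l - 1)" if "l < n" "l \<noteq> 0" for l using that by auto
    show ?thesis
    proof (cases "i = 0 \<or> j = 0")
      case True
      then have "{?as ! i, ?as ! j} \<notin> (`) Inl ` pairs {..<n - 1}" using nt[of "{?as ! i, ?as ! j}"] by auto
      then have "{?as ! i, ?as ! j} \<in> edges ?H \<longleftrightarrow> {?as ! i, ?as ! j} = {Inl 0, Inr 1}"
        unfolding E by blast
      also have "\<dots> \<longleftrightarrow> pendant_pattern i j"
        using True that nth by (cases "i = 0"; cases "j = 0")
          (auto simp: pendant_pattern_def isolated_pattern_def doubleton_eq_iff)
      finally show ?thesis .
    next
      case False
      then show ?thesis unfolding E using that nth[of i] nth[of j]
        by (auto simp: image_doubleton_eq_iff pendant_pattern_def isolated_pattern_def doubleton_eq_iff)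
    qed
  qed
  ultimately show ?thesis unfolding has_pattern_def by blast
qed

lemma less_5: "i < 5 \<longleftrightarrow> i = 0 \<or> i = 1 \<or> i = 2 \<or> i = 3 \<or> i = (4::nat)"
  by auto

lemma complete_bipartite_has_pattern:
  "has_pattern bipartite_pattern 5 (complete_bipartite 2 3)" (is "has_pattern _ _ ?H")
proof -
  let ?as = "[Inl 0, Inl 1, Inr 0, Inr 1, Inr 2] :: (nat + nat) list"
  have e1: "{Inl i, Inr j} \<in> edges ?H \<longleftrightarrow> i < 2 \<and> j < 3" for i j
    by (auto simp: complete_bipartite_def doubleton_eq_iff)
  have e2: "{Inr j, Inl i} \<in> edges ?H \<longleftrightarrow> i < 2 \<and> j < 3" for i j
    by (auto simp: complete_bipartite_def doubleton_eq_iff)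
  have e3: "{Inl i, Inl j} \<notin> edges ?H" "{Inr i, Inr j} \<notin> edges ?H" for i j
    by (auto simp: complete_bipartite_def doubleton_eq_iff)
  have "set ?as = verts ?H"
  proof -
    have "{..<2} = {0, 1 :: nat}" "{..<3} = {0, 1, 2 :: nat}" by auto
    then show ?thesis by (simp add: complete_bipartite_def Plus_def insert_commute)
  qed
  moreover have "{?as ! i, ?as ! j} \<in> edges ?H \<longleftrightarrow> bipartite_pattern i j" if "i < 5" "j < 5" for i j
    using that unfolding less_5 by (elim disjE) (simp_all add: e1 e2 e3 bipartite_pattern_def del: insert_absorb2)
  moreover have "distinct ?as" "length ?as = 5" by simp_all
  ultimately show ?thesis unfolding has_pattern_def by blast
qed

lemma disjoint_join_has_pattern:
  "has_pattern split_pattern 5 (disjoint_join (complete_graph 2) (copies 3 (complete_graph 1)))"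
  (is "has_pattern _ _ ?H")
proof -
  let ?as = "[Inl 0, Inl 1, Inr (0, 0), Inr (1, 0), Inr (2, 0)] :: (nat + nat \<times> nat) list"
  have two: "{..<2} = {0, 1 :: nat}" and three: "{..<3} = {0, 1, 2 :: nat}" by auto
  have C: "verts (copies 3 (complete_graph 1)) = {(0, 0), (1, 0), (2, 0)}" "edges (copies 3 (complete_graph 1)) = {}"
    by (auto simp: copies_def map_sgraph_def verts_complete_graph edges_complete_graph three pairs_singleton)
  have K: "verts (complete_graph 2) = {0, 1}" "edges (complete_graph 2) = {{0, 1}}"
    by (simp only: verts_complete_graph two) (simp only: edges_complete_graph pairs_two)
  have V: "verts ?H = Inl ` {0, 1} \<union> Inr ` {(0, 0), (1, 0), (2, 0)}"
    by (simp add: disjoint_join_def join_graph_def map_sgraph_def C[unfolded One_nat_def] K)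
  have E: "edges ?H = {{Inl 0, Inl 1}} \<union> {{u, v} | u v. u \<in> Inl ` {0, 1} \<and> v \<in> Inr ` {(0, 0), (1, 0), (2, 0)}}"
    by (simp add: disjoint_join_def join_graph_def map_sgraph_def C[unfolded One_nat_def] K)
  have e1: "{Inl i, Inr p} \<in> edges ?H \<longleftrightarrow> i \<in> {0, 1} \<and> p \<in> {(0, 0), (1, 0), (2, 0)}" for i p
    unfolding E by (auto simp: doubleton_eq_iff)
  have e2: "{Inr p, Inl i} \<in> edges ?H \<longleftrightarrow> i \<in> {0, 1} \<and> p \<in> {(0, 0), (1, 0), (2, 0)}" for i p
    using e1[of i p] by (simp add: insert_commute)
  have e3: "{Inr p, Inr q} \<notin> edges ?H" for p q
    unfolding E by (auto simp: doubleton_eq_iff)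
  have e4: "{Inl i, Inl j} \<in> edges ?H \<longleftrightarrow> {i, j} = {0, 1}" for i j
    unfolding E by (auto simp: doubleton_eq_iff)
  have "set ?as = verts ?H" unfolding V by auto
  moreover have "{?as ! i, ?as ! j} \<in> edges ?H \<longleftrightarrow> split_pattern i j" if "i < 5" "j < 5" for i j
    using that unfolding less_5
    by (elim disjE) (simp_all add: e1[unfolded One_nat_def] e2[unfolded One_nat_def] e3[unfolded One_nat_def]
        e4[unfolded One_nat_def] split_pattern_def doubleton_eq_iff del: insert_absorb2)
  moreover have "distinct ?as" "length ?as = 5" by simp_all
  ultimately show ?thesis unfolding has_pattern_def by blast
qed

text \<open>
The vertex with index 0 has degree at most 1 and lies on no cycle; the others form a complete graph.
\<close>

lemma low_degree_pattern_extremal: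
  fixes G :: "'a sgraph"
  assumes "has_pattern R n G" "3 \<le> k" "k < n"
    and R: "\<And>i j. 0 < i \<Longrightarrow> 0 < j \<Longrightarrow> i \<noteq> j \<Longrightarrow> R i j" "\<And>j. R 0 j \<Longrightarrow> j = 1"
  shows "cycle_lists n (verts G) (edges G) = {}"
    and "card (cycle_lists k (verts G) (edges G)) = falling_fact (n - 1) k"
proof -
  let ?V = "verts G" and ?E = "edges G"
  obtain as where as: "distinct as" "length as = n" "set as = ?V"
    "\<And>i j. i < n \<Longrightarrow> j < n \<Longrightarrow> {as ! i, as ! j} \<in> ?E \<longleftrightarrow> R i j"
    using assms(1) unfolding has_pattern_def by blast
  have fin: "finite ?V" and card: "card ?V = n"
    using as by (auto simp: distinct_card simp flip: as(3))
  define a where "a = as ! 0"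
  have a: "a \<in> ?V" using as(2,3) assms(2,3) nth_mem[of 0 as] by (simp add: a_def)
  have "neighbours ?V ?E a \<subseteq> {as ! 1}"
  proof
    fix w assume w: "w \<in> neighbours ?V ?E a"
    then have "w \<in> set as" using as(3) by (simp add: neighbours_def)
    then obtain j where j: "j < n" "w = as ! j" using as(2) by (metis in_set_conv_nth)
    then have "R 0 j" using w as(4)[of 0 j] by (simp add: neighbours_def a_def)
    then show "w \<in> {as ! 1}" using R(2) j by simp
  qed
  then have "card (neighbours ?V ?E a) \<le> card {as ! 1}" by (intro card_mono) auto
  then have deg: "card (neighbours ?V ?E a) \<le> 1" by simp
  have compl: "{x, y} \<in> ?E" if "x \<in> ?V - {a}" "y \<in> ?V - {a}" "x \<noteq> y" for x y
  proof -
    have "x \<in> set as" "y \<in> set as" using that as(3) by auto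
    then obtain i j where i: "i < n" "x = as ! i" and j: "j < n" "y = as ! j"
      using as(2) by (metis in_set_conv_nth)
    have "0 < i" "0 < j" using that i j by (auto simp: a_def intro!: gr0I)
    moreover have "i \<noteq> j" using that i j by auto
    ultimately show ?thesis using R(1) as(4) i j by simp
  qed
  have c1: "card (?V - {a}) = n - 1" using a card by simp
  have del: "cycle_lists l ?V ?E = distinct_lists l (?V - {a})" if "3 \<le> l" for l
    using cycle_lists_degree_le_1[OF that fin a deg] cycle_lists_complete[of l "?V - {a}" ?E] compl that by simp
  have fd: "finite (?V - {a})" using fin by simp
  show "card (cycle_lists k ?V ?E) = falling_fact (n - 1) k"
    using del[OF assms(2)] card_distinct_lists[OF fd, of k] c1 by simp
  have "card (distinct_lists n (?V - {a})) = 0"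
    using card_distinct_lists[OF fd, of n] c1 assms(2,3) falling_fact_eq_0[of "n - 1" n] by simp
  then show "cycle_lists n ?V ?E = {}" using del[of n] assms(2,3) fd by simp
qed

text \<open>
The vertices other than \<open>a\<close> must carry all possible cycle lists and so are pairwise adjacent. The
pattern depends on whether \<open>a\<close> has a neighbour.
\<close>

lemma extremal_low_degree_pattern:
  fixes G :: "'a sgraph"
  assumes "simple_graph G" "card (verts G) = n" "3 \<le> k" "k < n"
    and "card (cycle_lists k (verts G) (edges G)) = falling_fact (n - 1) k"
    and "a \<in> verts G" "card (neighbours (verts G) (edges G) a) \<le> 1"
  shows "has_pattern isolated_pattern n G \<or> has_pattern pendant_pattern n G"
proof -
  let ?V = "verts G" and ?E = "edges G"
  have fin: "finite ?V" and E2: "\<And>e. e \<in> ?E \<Longrightarrow> e \<subseteq> ?V \<and> card e = 2" using assms(1) by (auto simp: simple_graph_def)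
  have noloop: "{x} \<notin> ?E" for x using E2[of "{x}"] by auto
  have c1: "card (?V - {a}) = n - 1" using assms by simp
  have eq: "card (cycle_lists k (?V - {a}) ?E) = falling_fact (card (?V - {a})) k"
    using cycle_lists_degree_le_1[OF assms(3) fin assms(6,7)] assms(5) c1 by simp
  have compl: "{x, y} \<in> ?E" if "x \<in> ?V - {a}" "y \<in> ?V - {a}" "x \<noteq> y" for x y
    using complete_if_card_cycle_lists_eq[OF _ _ _ eq that] fin assms(3,4) c1 by simp
  have *: "{(a # bs) ! i, (a # bs) ! j} \<in> ?E \<longleftrightarrow> isolated_pattern i j"
    if "distinct bs" "set bs = ?V - {a}" "length bs = n - 1" "i < n" "j < n" "0 < i" "0 < j" for bs i j
  proof -
    have m: "bs ! (i - 1) \<in> ?V - {a}" "bs ! (j - 1) \<in> ?V - {a}"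
      using that nth_mem[of "i - 1" bs] nth_mem[of "j - 1" bs] by auto
    show ?thesis
    proof (cases "i = j")
      case True
      then show ?thesis using noloop by (simp add: isolated_pattern_def)
    next
      case False
      then have "bs ! (i - 1) \<noteq> bs ! (j - 1)" using that by (simp add: nth_eq_iff_index_eq)
      then show ?thesis using compl[OF m] False that by (simp add: isolated_pattern_def nth_Cons')
    qed
  qed
  consider "neighbours ?V ?E a = {}" | b where "neighbours ?V ?E a = {b}"
  proof (cases "card (neighbours ?V ?E a) = 0")
    case True
    then show thesis using that fin by simp
  next
    case False
    then have "card (neighbours ?V ?E a) = 1" using assms(7) by linarith
    then show thesis using that by (auto simp: card_1_singleton_iff)
  qed
  then show ?thesis
  proof cases
    case 1
    obtain bs where bs: "set bs = ?V - {a}" "distinct bs" using fin finite_distinct_list[of "?V - {a}"] by auto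
    then have lb: "length bs = n - 1" using c1 distinct_card by metis
    have na: "{a, x} \<notin> ?E \<and> {x, a} \<notin> ?E" for x
    proof (cases "x = a")
      case False
      have "x \<in> ?V" if "{a, x} \<in> ?E" using E2[OF that] by simp
      then show ?thesis using 1 False by (auto simp: neighbours_def insert_commute)
    qed (use noloop in simp)
    have "{(a # bs) ! i, (a # bs) ! j} \<in> ?E \<longleftrightarrow> isolated_pattern i j" if "i < n" "j < n" for i j
      using *[OF bs(2,1) lb that] na noloop by (cases "i = 0"; cases "j = 0") (auto simp: isolated_pattern_def)
    moreover have "distinct (a # bs)" "length (a # bs) = n" "set (a # bs) = ?V"
      using bs lb assms by auto
    ultimately have "has_pattern isolated_pattern n G" unfolding has_pattern_def by blast
    then show ?thesis ..
  next
    case (2 b)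
    then have b: "b \<in> ?V - {a}" "{a, b} \<in> ?E" by (auto simp: neighbours_def)
    obtain cs where cs: "set cs = ?V - {a} - {b}" "distinct cs" using fin finite_distinct_list[of "?V - {a} - {b}"] by auto
    define bs where "bs = b # cs"
    have bs: "set bs = ?V - {a}" "distinct bs" using cs b by (auto simp: bs_def)
    then have lb: "length bs = n - 1" using c1 distinct_card by metis
    have na: "({a, x} \<in> ?E \<longleftrightarrow> x = b) \<and> ({x, a} \<in> ?E \<longleftrightarrow> x = b)" for x
    proof (cases "x = a")
      case True
      then show ?thesis using noloop b by auto
    next
      case False
      have "x \<in> ?V" if "{a, x} \<in> ?E" using E2[OF that] by simp
      then have "{a, x} \<in> ?E \<longleftrightarrow> x \<in> neighbours ?V ?E a" using False by (auto simp: neighbours_def)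
      then show ?thesis using 2 by (simp add: insert_commute)
    qed
    have nthb: "(a # bs) ! i = b \<longleftrightarrow> i = 1" if "i < n" for i
    proof -
      have d: "distinct (a # bs)" using bs by simp
      have "(a # bs) ! i = (a # bs) ! 1 \<longleftrightarrow> i = 1"
        using d that lb assms(3,4) by (subst nth_eq_iff_index_eq) auto
      then show ?thesis by (simp add: bs_def)
    qed
    have "{(a # bs) ! i, (a # bs) ! j} \<in> ?E \<longleftrightarrow> pendant_pattern i j" if "i < n" "j < n" for i j
    proof -
      consider "i = 0" | "j = 0" | "0 < i" "0 < j" by auto
      then show ?thesis
      proof cases
        case 1
        then show ?thesis using na nthb[OF that(2)] by (auto simp: pendant_pattern_def isolated_pattern_def)
      next
        case 2
        then show ?thesis using na nthb[OF that(1)] by (auto simp: pendant_pattern_def isolated_pattern_def)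
      next
        case 3
        then show ?thesis using *[OF bs(2,1) lb that] by (auto simp: pendant_pattern_def)
      qed
    qed
    moreover have "distinct (a # bs)" "length (a # bs) = n" "set (a # bs) = ?V"
      using bs lb assms by auto
    ultimately have "has_pattern pendant_pattern n G" unfolding has_pattern_def by blast
    then show ?thesis ..
  qed
qed

lemma distinct_5E:
  assumes "distinct as" "length as = 5"
  obtains x y u v w where "as = [x, y, u, v, w]"
  using assms by (auto simp: length_Suc_conv numeral_eq_Suc)

text \<open>
Three pairwise nonadjacent vertices do not fit on a cycle of length 5. The number of 4-cycles is at
most 3 because there are two vertices of degree 2, and the 24 lists that alternate between the two
parts show that it is attained.
\<close>

lemma bipartite_or_split_pattern_extremal:
  fixes G :: "'a sgraph"
  assumes "has_pattern R 5 G"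
    and R: "\<And>i j. 2 \<le> i \<Longrightarrow> 2 \<le> j \<Longrightarrow> \<not> R i j" "\<And>i j. i < 2 \<Longrightarrow> 2 \<le> j \<Longrightarrow> R i j \<and> R j i"
  shows "cycle_lists 5 (verts G) (edges G) = {}"
    and "card (cycle_lists 4 (verts G) (edges G)) = falling_fact 4 4"
proof -
  let ?V = "verts G" and ?E = "edges G"
  obtain as where as: "distinct as" "length as = 5" "set as = ?V"
    "\<And>i j. i < 5 \<Longrightarrow> j < 5 \<Longrightarrow> {as ! i, as ! j} \<in> ?E \<longleftrightarrow> R i j"
    using assms(1) unfolding has_pattern_def by blast
  obtain x y u v w where xs: "as = [x, y, u, v, w]" using as(1,2) by (rule distinct_5E)
  have V: "?V = {x, y, u, v, w}" and d: "distinct [x, y, u, v, w]" using as(1,3) xs by auto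
  have fin: "finite ?V" and card: "card ?V = 5" using V d by auto
  have adj: "{p, r} \<in> ?E \<and> {r, p} \<in> ?E" if pr: "p \<in> {x, y}" "r \<in> {u, v, w}" for p r
  proof -
    have "p = as ! 0 \<or> p = as ! 1" using pr(1) by (simp add: xs)
    then obtain i where i: "i < 2" "p = as ! i" by (metis one_less_numeral_iff pos2 semiring_norm(76))
    have "\<exists>j. 2 \<le> j \<and> j < 5 \<and> r = as ! j"
    proof -
      have "r = as ! 2 \<or> r = as ! 3 \<or> r = as ! 4" using pr(2) by (simp add: xs)
      then show ?thesis by (elim disjE) (rule exI[of _ 2], simp, rule exI[of _ 3], simp, rule exI[of _ 4], simp)
    qed
    then obtain j where j: "2 \<le> j" "j < 5" "r = as ! j" by blast
    show ?thesis using as(4)[of i j] as(4)[of j i] i j R(2)[of i j] by simp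
  qed
  have nadj: "{p, r} \<notin> ?E" if pr: "p \<in> {u, v, w}" "r \<in> {u, v, w}" for p r
  proof -
    have idx: "\<exists>j. 2 \<le> j \<and> j < 5 \<and> r = as ! j" if "r \<in> {u, v, w}" for r
    proof -
      have "r = as ! 2 \<or> r = as ! 3 \<or> r = as ! 4" using that by (simp add: xs)
      then show ?thesis by (elim disjE) (rule exI[of _ 2], simp, rule exI[of _ 3], simp, rule exI[of _ 4], simp)
    qed
    obtain i where i: "2 \<le> i" "i < 5" "p = as ! i" using idx[OF pr(1)] by blast
    obtain j where j: "2 \<le> j" "j < 5" "r = as ! j" using idx[OF pr(2)] by blast
    show ?thesis using as(4)[of i j] i j R(1)[of i j] by simp
  qed
  show "cycle_lists 5 ?V ?E = {}"
  proof (rule ccontr)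
    assume "cycle_lists 5 ?V ?E \<noteq> {}"
    then obtain ys where ys: "ys \<in> distinct_lists 5 ?V" "cyclic_links ys \<subseteq> ?E" by (auto simp: cycle_lists_def)
    then have l: "length ys = 5" "distinct ys" "set ys \<subseteq> ?V" by (auto simp: distinct_lists_def)
    have sV: "set ys = ?V" using l fin card by (intro card_subset_eq) (auto simp: distinct_card)
    define I where "I = {i. i < 5 \<and> ys ! i \<in> {u, v, w}}"
    have "bij_betw ((!) ys) I {u, v, w}"
    proof (rule bij_betw_imageI)
      show "inj_on ((!) ys) I" using l by (auto simp: I_def inj_on_def nth_eq_iff_index_eq)
      show "(!) ys ` I = {u, v, w}"
      proof (intro equalityI subsetI)
        fix r assume r: "r \<in> {u, v, w}"
        then have "r \<in> set ys" using sV V by blast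
        then obtain i where "i < 5" "ys ! i = r" using l(1) by (metis in_set_conv_nth)
        then show "r \<in> (!) ys ` I" using r by (auto simp: I_def)
      qed (auto simp: I_def)
    qed
    then have cI: "card I = 3" using d by (simp add: bij_betw_same_card)
    let ?J = "(\<lambda>i. Suc i mod 5) ` I"
    have "inj_on (\<lambda>i. Suc i mod 5) I" by (auto simp: inj_on_def I_def mod_Suc split: if_splits)
    then have cJ: "card ?J = 3" using cI by (simp add: card_image)
    have "I \<inter> ?J = {}"
    proof (rule ccontr)
      assume "I \<inter> ?J \<noteq> {}"
      then obtain i where i: "i \<in> I" "Suc i mod 5 \<in> I" by blast
      then have "ys ! i \<in> {u, v, w}" "ys ! (Suc i mod 5) \<in> {u, v, w}" unfolding I_def by blast+
      then have "{ys ! i, ys ! (Suc i mod 5)} \<notin> ?E" by (rule nadj)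
      moreover have "{ys ! i, ys ! (Suc i mod 5)} \<in> cyclic_links ys"
        using mem_cyclic_links[of i ys] i l by (simp add: I_def)
      ultimately show False using ys(2) by blast
    qed
    moreover have fI: "finite I" by (simp add: I_def)
    ultimately have "card (I \<union> ?J) = 6" using cI cJ by (subst card_Un_disjoint) auto
    moreover have "I \<union> ?J \<subseteq> {..<5}" by (auto simp: I_def)
    then have "card (I \<union> ?J) \<le> card {..<5::nat}" by (intro card_mono) auto
    ultimately show False by simp
  qed
  have nb: "card (neighbours ?V ?E p) \<le> 2" if "p \<in> {u, v, w}" for p
  proof -
    have "neighbours ?V ?E p \<subseteq> {x, y}" using nadj[OF that] unfolding neighbours_def V by blast
    then have "card (neighbours ?V ?E p) \<le> card {x, y}" by (intro card_mono) auto
    also have "\<dots> \<le> 2" using d by simp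
    finally show ?thesis .
  qed
  have up: "card (cycle_lists 4 ?V ?E) \<le> falling_fact 4 4"
    using card_cycle_lists_two_degree_2(1)[of 4 ?V u v ?E] fin card V d nb by simp
  define P where "P = {(x, y), (y, x)}"
  define Q where "Q = {(u, v), (u, w), (v, u), (v, w), (w, u), (w, v)}"
  define f where "f = (\<lambda>((p :: 'a, q), (r, s)). [p, r, q, s])"
  define g where "g = (\<lambda>((p :: 'a, q), (r, s)). [r, p, s, q])"
  have cPQ: "card (P \<times> Q) = 12" "finite (P \<times> Q)"
    using d by (simp_all add: P_def Q_def card_cartesian_product)
  have PQ: "p \<in> {x, y} \<and> q \<in> {x, y} \<and> p \<noteq> q \<and> r \<in> {u, v, w} \<and> s \<in> {u, v, w} \<and> r \<noteq> s"
    if "((p, q), (r, s)) \<in> P \<times> Q" for p q r s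
    using that d by (auto simp: P_def Q_def)
  have "inj_on f (P \<times> Q)" "inj_on g (P \<times> Q)" by (auto simp: inj_on_def f_def g_def)
  then have cfg: "card (f ` (P \<times> Q)) = 12" "card (g ` (P \<times> Q)) = 12" using cPQ by (simp_all add: card_image)
  have disj: "f ` (P \<times> Q) \<inter> g ` (P \<times> Q) = {}"
  proof -
    have "hd l \<in> {x, y}" if l: "l \<in> f ` (P \<times> Q)" for l
    proof -
      from l obtain p q r s where pq: "((p, q), (r, s)) \<in> P \<times> Q" "l = [p, r, q, s]" by (auto simp: f_def)
      show ?thesis using PQ[OF pq(1)] pq(2) by simp
    qed
    moreover have "hd l \<in> {u, v, w}" if l: "l \<in> g ` (P \<times> Q)" for l
    proof -
      from l obtain p q r s where pq: "((p, q), (r, s)) \<in> P \<times> Q" "l = [r, p, s, q]" by (auto simp: g_def)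
      show ?thesis using PQ[OF pq(1)] pq(2) by simp
    qed
    ultimately show ?thesis using d by fastforce
  qed
  have "f ` (P \<times> Q) \<union> g ` (P \<times> Q) \<subseteq> cycle_lists 4 ?V ?E"
  proof -
    have "[p, r, q, s] \<in> cycle_lists 4 ?V ?E \<and> [r, p, s, q] \<in> cycle_lists 4 ?V ?E"
      if "((p, q), (r, s)) \<in> P \<times> Q" for p q r s
    proof -
      note m = PQ[OF that]
      have "{p, r} \<in> ?E" "{r, p} \<in> ?E" "{p, s} \<in> ?E" "{s, p} \<in> ?E" "{q, r} \<in> ?E" "{r, q} \<in> ?E" "{q, s} \<in> ?E" "{s, q} \<in> ?E"
        using m adj by blast+
      then have "cyclic_links [p, r, q, s] \<subseteq> ?E" "cyclic_links [r, p, s, q] \<subseteq> ?E" by (simp_all add: cyclic_links_path_links)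
      moreover have "[p, r, q, s] \<in> distinct_lists 4 ?V" "[r, p, s, q] \<in> distinct_lists 4 ?V"
        unfolding distinct_lists_def V using m d by auto
      ultimately show ?thesis by (simp add: cycle_lists_def)
    qed
    then show ?thesis unfolding f_def g_def by fast
  qed
  then have "card (f ` (P \<times> Q) \<union> g ` (P \<times> Q)) \<le> card (cycle_lists 4 ?V ?E)"
    using fin by (intro card_mono) auto
  then have "24 \<le> card (cycle_lists 4 ?V ?E)"
    using disj cfg cPQ(2) by (simp add: card_Un_disjoint)
  moreover have "falling_fact 4 4 = 24" by (simp add: numeral_eq_Suc)
  ultimately show "card (cycle_lists 4 ?V ?E) = falling_fact 4 4" using up by simp
qed

text \<open>
Let the cycle be \<open>p r q s\<close> and \<open>v\<close> the fifth vertex. A Hamilton cycle arises if \<open>v\<close> is adjacent to two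
consecutive vertices of the cycle, so its neighbours are two opposite ones, say \<open>p\<close> and \<open>q\<close>. It also
arises if \<open>r\<close> and \<open>s\<close> are adjacent. Only the pair \<open>p, q\<close> remains undetermined.
\<close>

lemma order_5_with_4_cycle:
  fixes G :: "'a sgraph"
  assumes "simple_graph G" "card (verts G) = 5" "cycle_lists 5 (verts G) (edges G) = {}"
    and "cycle_lists 4 (verts G) (edges G) \<noteq> {}"
    and deg: "\<And>v. v \<in> verts G \<Longrightarrow> 2 \<le> card (neighbours (verts G) (edges G) v)"
  shows "has_pattern bipartite_pattern 5 G \<or> has_pattern split_pattern 5 G"
proof -
  let ?V = "verts G" and ?E = "edges G"
  have fin: "finite ?V" and E2: "\<And>e. e \<in> ?E \<Longrightarrow> e \<subseteq> ?V \<and> card e = 2" using assms(1) by (auto simp: simple_graph_def)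
  have noloop: "{x} \<notin> ?E" for x using E2[of "{x}"] by auto
  have ham: False if "distinct [a, b, c, d, e]" "set [a, b, c, d, e] \<subseteq> ?V"
    "{a, b} \<in> ?E" "{b, c} \<in> ?E" "{c, d} \<in> ?E" "{d, e} \<in> ?E" "{e, a} \<in> ?E" for a b c d e
  proof -
    have "cyclic_links [a, b, c, d, e] \<subseteq> ?E" using that by (simp add: cyclic_links_path_links)
    moreover have "[a, b, c, d, e] \<in> distinct_lists 5 ?V" using that by (simp add: distinct_lists_def)
    ultimately show False using assms(3) by (auto simp: cycle_lists_def)
  qed
  obtain ys where ys: "ys \<in> distinct_lists 4 ?V" "cyclic_links ys \<subseteq> ?E" using assms(4) by (auto simp: cycle_lists_def)
  obtain p r q s where y: "ys = [p, r, q, s]"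
    using ys(1) by (auto simp: distinct_lists_def length_Suc_conv numeral_eq_Suc)
  have cyc: "{p, r} \<in> ?E" "{r, q} \<in> ?E" "{q, s} \<in> ?E" "{s, p} \<in> ?E" using ys(2) by (auto simp: y cyclic_links_path_links)
  have yd: "distinct [p, r, q, s]" "{p, r, q, s} \<subseteq> ?V" using ys(1) by (auto simp: y distinct_lists_def)
  have "card (?V - {p, r, q, s}) = 1" using yd assms(2) by (subst card_Diff_subset) auto
  then obtain v where v: "?V - {p, r, q, s} = {v}" by (auto simp: card_1_singleton_iff)
  then have vV: "v \<in> ?V" and vn: "v \<notin> {p, r, q, s}" and V: "?V = {p, r, q, s, v}" using yd by auto
  have goal: "has_pattern bipartite_pattern 5 G \<or> has_pattern split_pattern 5 G"
    if d: "distinct [p, q, r, s, v]" "set [p, q, r, s, v] = ?V"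
      and c: "{p, r} \<in> ?E" "{r, q} \<in> ?E" "{q, s} \<in> ?E" "{s, p} \<in> ?E" "{v, p} \<in> ?E" "{v, q} \<in> ?E"
    for p r q s
  proof -
    have c': "{r, p} \<in> ?E" "{q, r} \<in> ?E" "{s, q} \<in> ?E" "{p, s} \<in> ?E" "{p, v} \<in> ?E" "{q, v} \<in> ?E"
      using c by (simp_all add: insert_commute)
    have "{v, r} \<notin> ?E" using ham[of v r q s p] d c c' by auto
    moreover have "{v, s} \<notin> ?E" using ham[of v s q r p] d c c' by auto
    moreover have "{r, s} \<notin> ?E" using ham[of v p r s q] d c c' by auto
    ultimately have n: "{v, r} \<notin> ?E" "{v, s} \<notin> ?E" "{r, s} \<notin> ?E" "{r, v} \<notin> ?E" "{s, v} \<notin> ?E" "{s, r} \<notin> ?E"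
      by (simp_all add: insert_commute)
    let ?as = "[p, q, r, s, v]"
    show ?thesis
    proof (cases "{p, q} \<in> ?E")
      case True
      then have "{q, p} \<in> ?E" by (simp add: insert_commute)
      then have "{?as ! i, ?as ! j} \<in> ?E \<longleftrightarrow> split_pattern i j" if "i < 5" "j < 5" for i j
        using that unfolding less_5 by (elim disjE) (simp_all add: c c' n noloop True split_pattern_def)
      then have "has_pattern split_pattern 5 G" unfolding has_pattern_def using d by (intro exI[of _ ?as]) simp
      then show ?thesis ..
    next
      case False
      then have "{q, p} \<notin> ?E" by (simp add: insert_commute)
      then have "{?as ! i, ?as ! j} \<in> ?E \<longleftrightarrow> bipartite_pattern i j" if "i < 5" "j < 5" for i j
        using that unfolding less_5 by (elim disjE) (simp_all add: c c' n noloop False bipartite_pattern_def)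
      then have "has_pattern bipartite_pattern 5 G" unfolding has_pattern_def using d by (intro exI[of _ ?as]) simp
      then show ?thesis ..
    qed
  qed
  have cyc': "{r, p} \<in> ?E" "{q, r} \<in> ?E" "{s, q} \<in> ?E" "{p, s} \<in> ?E"
    using cyc by (simp_all add: insert_commute)
  have sub: "neighbours ?V ?E v \<subseteq> {p, r, q, s}" unfolding neighbours_def V by blast
  have vv: "{x, v} \<in> ?E \<longleftrightarrow> {v, x} \<in> ?E" for x by (simp add: insert_commute)
  have not2: "\<not> ({v, a} \<in> ?E \<and> {v, b} \<in> ?E)"
    if "distinct [a, b, c, d]" "{a, b, c, d} = {p, r, q, s}" "{b, c} \<in> ?E" "{c, d} \<in> ?E" "{d, a} \<in> ?E" for a b c d
  proof
    assume "{v, a} \<in> ?E \<and> {v, b} \<in> ?E"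
    moreover have "a \<noteq> v" "b \<noteq> v" "c \<noteq> v" "d \<noteq> v" using vn that(2) by blast+
    moreover have "set [v, b, c, d, a] \<subseteq> ?V" using that(2) V by auto
    ultimately show False using ham[of v b c d a] that vv by auto
  qed
  have n1: "\<not> ({v, p} \<in> ?E \<and> {v, r} \<in> ?E)" using not2[of p r q s] yd cyc by auto
  have n2: "\<not> ({v, r} \<in> ?E \<and> {v, q} \<in> ?E)" using not2[of r q s p] yd cyc by auto
  have n3: "\<not> ({v, q} \<in> ?E \<and> {v, s} \<in> ?E)" using not2[of q s p r] yd cyc by auto
  have n4: "\<not> ({v, s} \<in> ?E \<and> {v, p} \<in> ?E)" using not2[of s p r q] yd cyc by auto
  have "\<not> neighbours ?V ?E v \<subseteq> {x}" for x
  proof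
    assume "neighbours ?V ?E v \<subseteq> {x}"
    then have "card (neighbours ?V ?E v) \<le> card {x}" by (intro card_mono) auto
    then show False using deg[OF vV] by simp
  qed
  then have "{v, p} \<in> ?E \<and> {v, q} \<in> ?E \<or> {v, r} \<in> ?E \<and> {v, s} \<in> ?E"
    using sub n1 n2 n3 n4 unfolding neighbours_def by blast
  then show ?thesis
  proof
    assume "{v, p} \<in> ?E \<and> {v, q} \<in> ?E"
    moreover have "set [p, q, r, s, v] = ?V" unfolding V by auto
    moreover have "distinct [p, q, r, s, v]" using yd(1) vn by auto
    ultimately show ?thesis using goal[of p q r s] cyc by blast
  next
    assume "{v, r} \<in> ?E \<and> {v, s} \<in> ?E"
    moreover have "set [r, s, q, p, v] = ?V" unfolding V by auto
    moreover have "distinct [r, s, q, p, v]" using yd(1) vn by auto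
    ultimately show ?thesis using goal[of r s q p] cyc by blast
  qed
qed

section \<open>The maximum number of cycles\<close>

definition extremal_pattern :: "nat \<Rightarrow> nat \<Rightarrow> 'a sgraph \<Rightarrow> bool" where
  "extremal_pattern n k G \<longleftrightarrow> has_pattern pendant_pattern n G \<or> has_pattern isolated_pattern n G \<or>
     (n, k) = (5, 4) \<and> (has_pattern bipartite_pattern 5 G \<or> has_pattern split_pattern 5 G)"

lemma nonhamiltonian_iff:
  assumes "3 \<le> n"
  shows "nonhamiltonian_of_order n G \<longleftrightarrow>
    simple_graph G \<and> card (verts G) = n \<and> cycle_lists n (verts G) (edges G) = {}"
  using assms hamiltonian_iff_cycle_lists[of G] unfolding nonhamiltonian_of_order_def order_def by auto

lemma extremal_pattern_extremal:
  assumes "3 \<le> k" "k < n" "extremal_pattern n k G"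
  shows "card (verts G) = n" "cycle_lists n (verts G) (edges G) = {}"
    "card (cycle_lists k (verts G) (edges G)) = falling_fact (n - 1) k"
proof -
  show "card (verts G) = n"
    using assms(3) has_pattern_card[where G = G] unfolding extremal_pattern_def by auto
  consider "has_pattern pendant_pattern n G" | "has_pattern isolated_pattern n G"
    | R where "n = 5" "k = 4" "has_pattern R 5 G" "R = bipartite_pattern \<or> R = split_pattern"
    using assms(3) unfolding extremal_pattern_def by blast
  then have "cycle_lists n (verts G) (edges G) = {} \<and> card (cycle_lists k (verts G) (edges G)) = falling_fact (n - 1) k"
  proof cases
    case 1
    show ?thesis
      using low_degree_pattern_extremal[OF 1 assms(1,2)] by (auto simp: pendant_pattern_def isolated_pattern_def)
  next
    case 2
    show ?thesis
      using low_degree_pattern_extremal[OF 2 assms(1,2)] by (auto simp: isolated_pattern_def)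
  next
    case (3 R)
    have R: "\<And>i j. 2 \<le> i \<Longrightarrow> 2 \<le> j \<Longrightarrow> \<not> R i j" "\<And>i j. i < 2 \<Longrightarrow> 2 \<le> j \<Longrightarrow> R i j \<and> R j i"
      using 3(4) by (auto simp: bipartite_pattern_def split_pattern_def)
    show ?thesis using bipartite_or_split_pattern_extremal[OF 3(3) R] 3(1,2) by simp
  qed
  then show "cycle_lists n (verts G) (edges G) = {}"
    "card (cycle_lists k (verts G) (edges G)) = falling_fact (n - 1) k" by blast+
qed

theorem nonhamiltonian_cycle_lists:
  fixes G :: "'a sgraph"
  assumes "3 \<le> k" "k < n" "simple_graph G" "card (verts G) = n" "cycle_lists n (verts G) (edges G) = {}"
  shows "card (cycle_lists k (verts G) (edges G)) \<le> falling_fact (n - 1) k"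
    and "card (cycle_lists k (verts G) (edges G)) = falling_fact (n - 1) k \<Longrightarrow> extremal_pattern n k G"
proof -
  let ?L = "cycle_lists k (verts G) (edges G)"
  have fin: "finite (verts G)" and E: "edges G \<subseteq> pairs (verts G)"
    using assms(3) by (auto simp: simple_graph_def pairs_def)
  have "card ?L \<le> falling_fact (n - 1) k \<and> (card ?L = falling_fact (n - 1) k \<longrightarrow> extremal_pattern n k G)"
  proof (cases "\<exists>a\<in>verts G. card (neighbours (verts G) (edges G) a) \<le> 1")
    case True
    then obtain a where a: "a \<in> verts G" "card (neighbours (verts G) (edges G) a) \<le> 1" by blast
    have "card ?L \<le> falling_fact (n - 1) k"
      using cycle_lists_degree_le_1[OF assms(1) fin a] card_cycle_lists_le[of "verts G - {a}" k "edges G"] fin assms(4) a(1)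
      by simp
    then show ?thesis
      using extremal_low_degree_pattern[OF assms(3,4,1,2) _ a] unfolding extremal_pattern_def by blast
  next
    case False
    then have deg: "2 \<le> card (neighbours (verts G) (edges G) v)" if "v \<in> verts G" for v using that by force
    show ?thesis
    proof (cases "(n, k) = (5, 4)")
      case False
      then show ?thesis
        using card_cycle_lists_less_min_degree_2[OF fin assms(4) E assms(5,1,2) deg] by simp
    next
      case True
      then have nk: "n = 5" "k = 4" by auto
      show ?thesis
      proof (cases "?L = {}")
        case True
        have "0 < falling_fact (n - 1) k" using assms(2) by (intro falling_fact_pos) simp
        then show ?thesis using True by simp
      next
        case False
        then have ep: "extremal_pattern n k G"
          using order_5_with_4_cycle[OF assms(3) _ _ _ deg] assms(4,5) nk unfolding extremal_pattern_def by simp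
        then show ?thesis using extremal_pattern_extremal(3)[OF assms(1,2) ep] by simp
      qed
    qed
  qed
  then show "card ?L \<le> falling_fact (n - 1) k" "card ?L = falling_fact (n - 1) k \<Longrightarrow> extremal_pattern n k G" by blast+
qed

lemma perm_number_eq_falling_fact:
  assumes "k < n" "2 \<le> n"
  shows "perm_number (int n - 1) (int k) = real (falling_fact (n - 1) k)"
proof -
  have e: "int n - 1 = int (n - 1)" "int (n - 1) - int k = int (n - 1 - k)" using assms by auto
  have "real (falling_fact (n - 1) k * fact (n - 1 - k)) = real (fact (n - 1))"
    using falling_fact_mult_fact[of k "n - 1"] assms by simp
  then have f: "real (falling_fact (n - 1) k) = fact (n - 1) / fact (n - 1 - k)"
    by (simp add: field_simps)
  have c: "0 \<le> int k \<and> int k \<le> int (n - 1) \<and> 1 \<le> int (n - 1)" using assms by auto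
  show ?thesis unfolding perm_number_def e(1) if_P[OF c] e(2) nat_int f ..
qed

theorem theorem2:
  fixes n k :: nat
  assumes "3 \<le> k" and "k \<le> n - 1"
  shows
    "(\<exists>G :: nat sgraph. nonhamiltonian_of_order n G \<and>
        real (num_cycles k G) = perm_number (int n - 1) (int k) / (2 * real k)) \<and>
     (\<forall>G :: 'a sgraph. nonhamiltonian_of_order n G \<longrightarrow>
        real (num_cycles k G) \<le> perm_number (int n - 1) (int k) / (2 * real k)) \<and>
     (\<forall>G :: 'a sgraph.
        (nonhamiltonian_of_order n G \<and>
         real (num_cycles k G) = perm_number (int n - 1) (int k) / (2 * real k)) \<longleftrightarrow>
        (simple_graph G \<and>
         (if (n, k) \<noteq> (5, 4)
          then G \<simeq> complete_with_pendant (n - 1) \<or>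
               G \<simeq> disjoint_union (complete_graph (n - 1)) (complete_graph 1)
          else G \<simeq> complete_with_pendant 4 \<or>
               G \<simeq> disjoint_union (complete_graph 4) (complete_graph 1) \<or>
               G \<simeq> complete_bipartite 2 3 \<or>
               G \<simeq> disjoint_join (complete_graph 2) (copies 3 (complete_graph 1)))))"
proof -
  have k: "0 < k" "k < n" "3 \<le> n" using assms by auto
  then have n2: "2 \<le> n" by simp
  let ?M = "perm_number (int n - 1) (int k) / (2 * real k)"
  have num: "real (num_cycles k G) = real (card (cycle_lists k (verts G) (edges G))) / (2 * real k)"
    if "simple_graph G" for G :: "'b sgraph"
    using card_cycle_lists[OF assms(1), of G] that k(1) by (simp add: simple_graph_def field_simps)
  have eq: "real (num_cycles k G) = ?M \<longleftrightarrow> card (cycle_lists k (verts G) (edges G)) = falling_fact (n - 1) k"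
    and le: "real (num_cycles k G) \<le> ?M \<longleftrightarrow> card (cycle_lists k (verts G) (edges G)) \<le> falling_fact (n - 1) k"
    if "simple_graph G" for G :: "'b sgraph"
    using k(1) by (simp_all add: num[OF that] perm_number_eq_falling_fact[OF k(2) n2] divide_right_mono divide_le_cancel)
  have extremal: "nonhamiltonian_of_order n G \<and> real (num_cycles k G) = ?M \<longleftrightarrow> simple_graph G \<and> extremal_pattern n k G"
    for G :: "'b sgraph"
    using nonhamiltonian_cycle_lists(2)[OF assms(1) k(2), of G] extremal_pattern_extremal[OF assms(1) k(2), of G] eq[of G]
    unfolding nonhamiltonian_iff[OF k(3)] by blast
  have pats: "has_pattern pendant_pattern n G \<longleftrightarrow> G \<simeq> complete_with_pendant (n - 1)"
    "has_pattern isolated_pattern n G \<longleftrightarrow> G \<simeq> disjoint_union (complete_graph (n - 1)) (complete_graph 1)"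
    "has_pattern bipartite_pattern 5 G \<longleftrightarrow> G \<simeq> complete_bipartite 2 3"
    "has_pattern split_pattern 5 G \<longleftrightarrow> G \<simeq> disjoint_join (complete_graph 2) (copies 3 (complete_graph 1))"
    for G :: "'b sgraph"
    using graph_iso_iff_has_pattern[OF complete_with_pendant_has_pattern, of n G]
      graph_iso_iff_has_pattern[OF disjoint_union_has_pattern, of n G]
      graph_iso_iff_has_pattern[OF complete_bipartite_has_pattern, of G]
      graph_iso_iff_has_pattern[OF disjoint_join_has_pattern, of G] k(3) by simp_all
  show ?thesis
  proof (intro conjI allI impI)
    define G where "G = \<lparr>verts = {..<n}, edges = pairs {1..<n}\<rparr>"
    have "has_pattern isolated_pattern n G"
      unfolding has_pattern_def G_def
      by (rule exI[of _ "[0..<n]"]) (auto simp: isolated_pattern_def atLeast0LessThan)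
    moreover have "simple_graph G" by (auto simp: simple_graph_def G_def pairs_def)
    ultimately show "\<exists>G :: nat sgraph. nonhamiltonian_of_order n G \<and> real (num_cycles k G) = ?M"
      using extremal[of G] unfolding extremal_pattern_def by blast
  next
    fix G :: "'a sgraph"
    assume "nonhamiltonian_of_order n G"
    then show "real (num_cycles k G) \<le> ?M"
      using nonhamiltonian_cycle_lists(1)[OF assms(1) k(2), of G] le[of G]
      unfolding nonhamiltonian_iff[OF k(3)] by blast
  next
    fix G :: "'a sgraph"
    show "(nonhamiltonian_of_order n G \<and> real (num_cycles k G) = ?M) \<longleftrightarrow>
        (simple_graph G \<and>
         (if (n, k) \<noteq> (5, 4)
          then G \<simeq> complete_with_pendant (n - 1) \<or>
               G \<simeq> disjoint_union (complete_graph (n - 1)) (complete_graph 1)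
          else G \<simeq> complete_with_pendant 4 \<or>
               G \<simeq> disjoint_union (complete_graph 4) (complete_graph 1) \<or>
               G \<simeq> complete_bipartite 2 3 \<or>
               G \<simeq> disjoint_join (complete_graph 2) (copies 3 (complete_graph 1))))"
      unfolding extremal extremal_pattern_def pats by (cases "(n, k) = (5, 4)") auto
  qed
qed

end
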